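(* Let $(T(t))_{t\ge 0}$ be a bounded $C_0$-semigroup on a Hilbert space $H$ with generator $A$ such that $i\mathbb{R}\subset\varrho(A)$. Then for a fixed $\alpha>0$ the following conditions are equivalent: (i) $\|R(is,A)\|=O(|s|^{\alpha})$ as $|s|\to\infty$ ($s\in\mathbb{R}$); (ii) $\|T(t)(-A)^{-\alpha}\|=O(t^{-1})$ as $t\to\infty$; (iii) for every $x\in H$, $\|T(t)(-A)^{-\alpha}x\|=o(t^{-1})$ as $t\to\infty$; (iv) $\|T(t)A^{-1}\|=O(t^{-1/\alpha})$ as $t\to\infty$; (v) for every $x\in H$, $\|T(t)A^{-1}x\|=o(t^{-1/\alpha})$ as $t\to\infty$.
   Context: $H$ is a complex Hilbert space. $\varrho(A)$ is the resolvent set of $A$ and $R(\lambda,A)=(\lambda-A)^{-1}$ for $\lambda\in\varrho(A)$. Bounded semigroup means $\sup_{t\ge0}\|T(t)\|<\infty$. $(-A)^{-\alpha}$ is the usual (bounded) negative fractional power of the sectorial operator $-A$, which is invertible because $0\in\varrho(A)$. *)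

theory Defs
  imports "HOL-Analysis.Analysis" "HOL-Library.Landau_Symbols"
begin

(* The distribution has no complex Hilbert spaces.  Extending banach keeps the library's norm,
   topology, completeness and Henstock-Kurzweil integral available; the last assumption says that
   this norm is the one induced by the inner product.  The inner product is linear in its first
   argument. *)
class complex_hilbert_space = banach +
  fixes scaleC :: "complex \<Rightarrow> 'a \<Rightarrow> 'a" (infixr "*\<^sub>C" 75)
    and cinner :: "'a \<Rightarrow> 'a \<Rightarrow> complex"
  assumes scaleC_add_right: "c *\<^sub>C (x + y) = c *\<^sub>C x + c *\<^sub>C y"
    and scaleC_add_left: "(c + d) *\<^sub>C x = c *\<^sub>C x + d *\<^sub>C x"
    and scaleC_scaleC: "c *\<^sub>C d *\<^sub>C x = (c * d) *\<^sub>C x"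
    and scaleC_of_real: "complex_of_real r *\<^sub>C x = r *\<^sub>R x"
    and cinner_commute: "cinner x y = cnj (cinner y x)"
    and cinner_add_left: "cinner (x + y) z = cinner x z + cinner y z"
    and cinner_scaleC_left: "cinner (c *\<^sub>C x) y = c * cinner x y"
    and norm_eq_sqrt_cinner: "norm x = sqrt (Re (cinner x x))"

instantiation complex :: complex_hilbert_space
begin

definition scaleC_complex :: "complex \<Rightarrow> complex \<Rightarrow> complex"
  where "scaleC_complex c x = c * x"

definition cinner_complex :: "complex \<Rightarrow> complex \<Rightarrow> complex"
  where "cinner_complex x y = x * cnj y"

instance
proof
  fix r :: real and x :: complex
  show "complex_of_real r *\<^sub>C x = r *\<^sub>R x"
    by (simp add: scaleC_complex_def scaleR_conv_of_real)
  show "norm x = sqrt (Re (cinner x x))"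
    by (simp add: cinner_complex_def cmod_def power2_eq_square)
qed (simp_all add: scaleC_complex_def cinner_complex_def algebra_simps)

end

definition bounded_clinear :: "('a::complex_hilbert_space \<Rightarrow> 'a) \<Rightarrow> bool" where
  "bounded_clinear f \<longleftrightarrow> bounded_linear f \<and> (\<forall>c x. f (c *\<^sub>C x) = c *\<^sub>C f x)"

definition C0_semigroup :: "(real \<Rightarrow> 'a::complex_hilbert_space \<Rightarrow> 'a) \<Rightarrow> bool" where
  "C0_semigroup T \<longleftrightarrow>
     (\<forall>t\<ge>0. bounded_clinear (T t)) \<and>
     T 0 = id \<and>
     (\<forall>s\<ge>0. \<forall>t\<ge>0. T (s + t) = T s \<circ> T t) \<and>
     (\<forall>x. ((\<lambda>t. T t x) \<longlongrightarrow> x) (at_right 0))"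

definition bounded_semigroup :: "(real \<Rightarrow> 'a::complex_hilbert_space \<Rightarrow> 'a) \<Rightarrow> bool" where
  "bounded_semigroup T \<longleftrightarrow> bdd_above ((\<lambda>t. onorm (T t)) ` {0..})"

(* An unbounded operator is given by its domain D and a function A; the values of A outside D
   are irrelevant. *)
definition is_generator ::
    "'a set \<Rightarrow> ('a \<Rightarrow> 'a) \<Rightarrow> (real \<Rightarrow> 'a::complex_hilbert_space \<Rightarrow> 'a) \<Rightarrow> bool" where
  "is_generator D A T \<longleftrightarrow>
     D = {x. \<exists>y. ((\<lambda>t. (T t x - x) /\<^sub>R t) \<longlongrightarrow> y) (at_right 0)} \<and>
     (\<forall>x\<in>D. ((\<lambda>t. (T t x - x) /\<^sub>R t) \<longlongrightarrow> A x) (at_right 0))"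

definition resolvent ::
    "'a set \<Rightarrow> ('a \<Rightarrow> 'a) \<Rightarrow> complex \<Rightarrow> 'a::complex_hilbert_space \<Rightarrow> 'a" where
  "resolvent D A z = inv_into D (\<lambda>x. z *\<^sub>C x - A x)"

definition resolvent_set ::
    "'a set \<Rightarrow> ('a \<Rightarrow> 'a::complex_hilbert_space) \<Rightarrow> complex set" where
  "resolvent_set D A =
     {z. bij_betw (\<lambda>x. z *\<^sub>C x - A x) D UNIV \<and> bounded_clinear (resolvent D A z)}"

(* The power B^(-\<alpha>), \<alpha> > 0, of an invertible sectorial operator B with domain D.
   For 0 < \<beta> < 1 it is given by Balakrishnan's formula
     B^(-\<beta>) x = (sin (\<pi> \<beta>) / \<pi>) \<integral>_0^\<infinity> t^(-\<beta>) (t + B)^(-1) x dt,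
   and in general B^(-\<alpha>) = (B^(-1))^n B^(-\<beta>) with n = floor \<alpha>, \<beta> = frac \<alpha>.
   The integral converges absolutely in norm because (t + B)^(-1) = O(1/(1+t)).
   The Henstock-Kurzweil integral is used since the Bochner integral of the library
   requires a separable range type. *)
definition neg_frac_power ::
    "'a set \<Rightarrow> ('a \<Rightarrow> 'a) \<Rightarrow> real \<Rightarrow> 'a::complex_hilbert_space \<Rightarrow> 'a" where
  "neg_frac_power D B \<alpha> x =
     (inv_into D B ^^ nat \<lfloor>\<alpha>\<rfloor>)
       (if frac \<alpha> = 0 then x
        else (sin (pi * frac \<alpha>) / pi) *\<^sub>R
               integral {0..} (\<lambda>t. t powr (- frac \<alpha>) *\<^sub>R inv_into D (\<lambda>y. t *\<^sub>R y + B y) x))"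

end

theory Submission
  imports Defs
begin

text \<open>This is the theorem of Borichev and Tomilov. Write \<open>G = (-A)\<^sup>-\<^sup>1\<close>, \<open>R(z)\<close> for the
resolvent and \<open>B = (-A)\<^sup>-\<^sup>\<alpha>\<close>. The proof is the cycle (i) \<open>\<Longrightarrow>\<close> (iv)
\<open>\<Longrightarrow>\<close> (ii) \<open>\<Longrightarrow>\<close> (i), and (iii) and (v) are then attached to (ii) and (iv).

(i) \<open>\<Longrightarrow>\<close> (iv) is the step that needs a Hilbert space. On the Laplace side,
\<open>t\<^sup>k T(t) P\<close> corresponds, up to the factor \<open>k!\<close>, to \<open>R(z)\<^sup>k P\<close> acting on the
transform of \<open>T(t)\<close>. Plancherel's theorem thus turns a bound of \<open>R(z)\<^sup>k P\<close> on the right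
half plane into a bound of \<open>t\<^sup>k T(t) P\<close> in a weighted \<open>L\<^sup>2\<close> norm in time, and boundedness of
the semigroup turns that into a pointwise bound. Everything is discretised here: the semigroup is
replaced by powers of the backward Euler operator \<open>(1 - hA)\<^sup>-\<^sup>1\<close>, its Laplace transform by a power
series on the unit disc whose symbol is again a resolvent, and Plancherel's theorem by Parseval's
identity for finitely many roots of unity, which is plain algebra in an inner product space
(\<open>norm_power_series_le_imp_sum_norm_sq_le\<close>, \<open>norm_euler_pow_decay\<close>). Letting the step size tend
to \<open>0\<close> gives \<open>semigroup_decay_of_resolvent_power_bound\<close>. It is applied to a truncation
\<open>P = (1 - hA)\<^sup>-\<^sup>N G\<close> of \<open>G\<close> to the part of the spectrum of size at most \<open>1 / h\<close>. Under (i), if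
\<open>k\<alpha> \<ge> 1\<close> and \<open>N\<close> is close to \<open>k\<alpha>\<close>, then \<open>R(z)\<^sup>k P\<close> is of order \<open>h\<close> to the power \<open>1 - k\<alpha>\<close>, while
\<open>G - P\<close> is of order \<open>h\<close>; taking for \<open>h\<close> the power \<open>-1/\<alpha>\<close> of \<open>t\<close> balances the two
contributions. In this way an integer \<open>k\<close> yields the rate \<open>1/\<alpha>\<close> for every positive real \<open>\<alpha>\<close>.

(iv) \<open>\<Longrightarrow>\<close> (ii): for the integer part of \<open>\<alpha>\<close> one iterates (iv). For the fractional
part \<open>\<beta>\<close> one applies \<open>T(t)\<close> under Balakrishnan's integral and splits it where the bound
\<open>O(1/\<tau>)\<close> for \<open>T(t) R(\<tau>)\<close> becomes better than the bound given by (iv).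

(ii) \<open>\<Longrightarrow>\<close> (i): if \<open>y = R(is)x\<close>, then \<open>y\<close> is an approximate eigenvector of \<open>A\<close>
for the eigenvalue \<open>is\<close>, so that \<open>By\<close> is close to \<open>y\<close> multiplied by the power \<open>-\<alpha>\<close> of \<open>-is\<close>.
Applied to \<open>T(t)y\<close>, this and (ii) bound \<open>\<parallel>T(t)y\<parallel>\<close> by half of \<open>\<parallel>y\<parallel>\<close> plus a multiple of
\<open>\<bar>s\<bar>\<^sup>\<alpha> \<parallel>x\<parallel>\<close> as soon as \<open>t\<close> is a large multiple of \<open>\<bar>s\<bar>\<^sup>\<alpha>\<close>. On the other
hand \<open>y\<close> and \<open>e\<^sup>-\<^sup>i\<^sup>s\<^sup>t T(t)y\<close> differ by at most a multiple of \<open>t \<parallel>x\<parallel>\<close>.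

The pointwise statements imply the uniform ones by the Banach--Steinhaus theorem. Conversely, the
uniform estimate and (iv), each at time \<open>t/2\<close>, together give a better rate on the range of \<open>G\<close>, which is dense.

The generator is given by difference quotients at \<open>0\<close>. The semigroup law moves them to any other time, so
that estimates over a time interval follow from telescoping sums with step size tending to \<open>0\<close>
(\<open>mean_value_from_right_increments\<close>).\<close>

section \<open>Complex Hilbert spaces\<close>

lemma scaleC_scaleR_left: "(r *\<^sub>R c) *\<^sub>C x = r *\<^sub>R (c *\<^sub>C (x::'a::complex_hilbert_space))"
  by (metis scaleC_of_real scaleC_scaleC scaleR_conv_of_real)

lemma scaleC_scaleR_right: "c *\<^sub>C (r *\<^sub>R x) = r *\<^sub>R (c *\<^sub>C (x::'a::complex_hilbert_space))"
  by (metis mult.commute scaleC_of_real scaleC_scaleC)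

text \<open>The symmetry of the inner product makes \<open>cinner x x\<close> real, so the axiom on the norm determines it.\<close>

lemma cinner_self: "cinner x x = complex_of_real ((norm (x::'a::complex_hilbert_space))\<^sup>2)"
proof -
  have "Im (cinner x x) = 0"
    using cinner_commute[of x x] by (metis Reals_cnj_iff complex_is_Real_iff)
  moreover have "Re (cinner x x) = (norm x)\<^sup>2"
  proof -
    have "sqrt (Re (cinner x x)) \<ge> 0" using norm_eq_sqrt_cinner[of x] norm_ge_zero[of x] by metis
    then have "Re (cinner x x) \<ge> 0" by simp
    then show ?thesis using norm_eq_sqrt_cinner[of x] by simp
  qed
  ultimately show ?thesis by (simp add: complex_eq_iff)
qed

lemma cinner_scaleC_right: "cinner x (c *\<^sub>C y) = cnj c * cinner x (y::'a::complex_hilbert_space)"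
  by (metis cinner_commute cinner_scaleC_left complex_cnj_mult)

lemma cinner_add_right: "cinner x (y + z) = cinner x y + cinner x (z::'a::complex_hilbert_space)"
  by (metis cinner_commute cinner_add_left complex_cnj_add)

lemma norm_scaleC [simp]: "norm (c *\<^sub>C x) = cmod c * norm (x::'a::complex_hilbert_space)"
proof -
  have "complex_of_real ((norm (c *\<^sub>C x))\<^sup>2) = c * cnj c * complex_of_real ((norm x)\<^sup>2)"
    unfolding cinner_self[symmetric] cinner_scaleC_left cinner_scaleC_right by simp
  also have "\<dots> = of_real ((cmod c * norm x)\<^sup>2)"
    by (simp add: complex_norm_square[symmetric] power_mult_distrib)
  finally have "(norm (c *\<^sub>C x))\<^sup>2 = (cmod c * norm x)\<^sup>2" using of_real_eq_iff by blast
  then show ?thesis by (simp add: power2_eq_iff_nonneg)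
qed

lemma bounded_bilinear_scaleC:
  "bounded_bilinear (scaleC :: complex \<Rightarrow> 'a \<Rightarrow> 'a::complex_hilbert_space)"
proof
  show "\<exists>K. \<forall>a b. norm (a *\<^sub>C (b::'a)) \<le> norm a * norm b * K" by (intro exI[of _ 1]) simp
qed (simp_all add: scaleC_add_left scaleC_add_right scaleC_scaleR_left scaleC_scaleR_right)

interpretation scaleC: bounded_bilinear "scaleC :: complex \<Rightarrow> 'a \<Rightarrow> 'a::complex_hilbert_space"
  by (rule bounded_bilinear_scaleC)

lemma scaleC_one [simp]: "1 *\<^sub>C x = (x::'a::complex_hilbert_space)"
  using scaleC_of_real[of 1 x] by simp

lemma cinner_zero_left [simp]: "cinner 0 y = 0" for y :: "'a::complex_hilbert_space"
  using cinner_add_left[of 0 0 y] by simp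

lemma cinner_zero_right [simp]: "cinner y 0 = 0" for y :: "'a::complex_hilbert_space"
  using cinner_add_right[of y 0 0] by simp

lemma cinner_sum_left: "cinner (sum f S) y = (\<Sum>i\<in>S. cinner (f i) y)"
  for f :: "'i \<Rightarrow> 'a::complex_hilbert_space"
  by (induction S rule: infinite_finite_induct) (simp_all add: cinner_add_left)

lemma cinner_sum_right: "cinner y (sum f S) = (\<Sum>i\<in>S. cinner y (f i))"
  for f :: "'i \<Rightarrow> 'a::complex_hilbert_space"
  by (induction S rule: infinite_finite_induct) (simp_all add: cinner_add_right)

lemma bounded_clinearI:
  assumes "\<And>x y. f (x + y) = f x + f y" "\<And>c x. f (c *\<^sub>C x) = c *\<^sub>C f x"
    "\<And>x. norm (f x) \<le> K * norm x"
  shows "bounded_clinear f"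
proof -
  have "f (r *\<^sub>R x) = r *\<^sub>R f x" for r x using assms(2)[of "of_real r" x] by (simp add: scaleC_of_real)
  then have "bounded_linear f"
    using assms by (intro bounded_linear_intro[of f K]) (auto simp: mult.commute)
  then show ?thesis using assms unfolding bounded_clinear_def by blast
qed


section \<open>Power series on a circle and square sums of their coefficients\<close>

text \<open>For \<open>j \<noteq> k\<close> the terms form a geometric progression whose ratio is an \<open>N\<close>-th root of unity different from \<open>1\<close>; the bounds on \<open>j\<close> and \<open>k\<close> exclude aliasing.\<close>

lemma sum_roots_of_unity:
  fixes j k :: nat
  assumes "j < N" "k < N"
  shows "(\<Sum>l<N. cis (2 * pi * real l / real N) ^ j * cnj (cis (2 * pi * real l / real N)) ^ k)
    = (if j = k then of_nat N else 0)"
proof -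
  have N: "N > 0" using assms by simp
  define w where "w = cis (2 * pi * (real j - real k) / N)"
  have tm: "cis (2 * pi * real l / real N) ^ j * cnj (cis (2 * pi * real l / real N)) ^ k = w ^ l" for l :: nat
  proof -
    have "real j * (2 * pi * real l / real N) + real k * - (2 * pi * real l / real N)
        = real l * (2 * pi * (real j - real k) / real N)"
      by (simp add: diff_divide_distrib algebra_simps)
    then show ?thesis by (simp only: w_def cis_cnj Complex.DeMoivre cis_mult)
  qed
  have wN: "w ^ N = 1"
  proof -
    have "w ^ N = cis (2 * pi * of_int (int j - int k))"
      using N by (simp add: w_def Complex.DeMoivre)
    then show ?thesis by (metis cis_multiple_2pi Ints_of_int)
  qed
  show ?thesis
  proof (cases "j = k")
    case True
    have "w = 1" using True by (simp add: w_def)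
    then show ?thesis using True tm by simp
  next
    case False
    have "w \<noteq> 1"
    proof
      assume "w = 1"
      then have "cos (2 * pi * ((real j - real k) / N)) = 1"
        by (simp add: w_def complex_eq_iff)
      then obtain m :: int where "2 * pi * ((real j - real k) / N) = of_int m * 2 * pi"
        using cos_one_2pi_int by blast
      then have "(2 * pi) * ((real j - real k) / N) = (2 * pi) * m" by (simp only: mult_ac)
      then have "(real j - real k) / N = m" by (simp only: mult_cancel_left) simp
      then have "real j - real k = real_of_int (m * int N)" using N by (simp add: field_simps)
      then have "real_of_int (int j - int k) = real_of_int (m * int N)" by simp
      then have eq: "int j - int k = m * int N" using of_int_eq_iff by blast
      then have "m \<noteq> 0" using False by auto
      then have "1 * int N \<le> \<bar>m\<bar> * int N" by (intro mult_right_mono) auto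
      then have "\<bar>m * int N\<bar> \<ge> int N" by (simp add: abs_mult)
      then show False using eq assms by linarith
    qed
    then have "(\<Sum>l<N. w ^ l) = 0" using wN by (simp add: geometric_sum)
    then show ?thesis using False tm by simp
  qed
qed

lemma discrete_parseval:
  fixes a :: "nat \<Rightarrow> 'a::complex_hilbert_space"
  shows "(\<Sum>l<N. (norm (\<Sum>j<N. cis (2 * pi * real l / real N) ^ j *\<^sub>C a j))\<^sup>2) = N * (\<Sum>j<N. (norm (a j))\<^sup>2)"
proof -
  have "complex_of_real (\<Sum>l<N. (norm (\<Sum>j<N. cis (2 * pi * real l / real N) ^ j *\<^sub>C a j))\<^sup>2)
      = (\<Sum>l<N. \<Sum>j<N. \<Sum>k<N. (cis (2 * pi * real l / real N) ^ j * cnj (cis (2 * pi * real l / real N)) ^ k) * cinner (a j) (a k))"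
    unfolding of_real_sum cinner_self[symmetric]
    by (subst cinner_sum_left, subst cinner_sum_right)
      (simp add: cinner_scaleC_left cinner_scaleC_right mult_ac sum_distrib_left)
  also have "\<dots> = (\<Sum>j<N. \<Sum>k<N. (\<Sum>l<N. cis (2 * pi * real l / real N) ^ j * cnj (cis (2 * pi * real l / real N)) ^ k) * cinner (a j) (a k))"
    unfolding sum_distrib_right
    by (subst sum.swap, rule sum.cong[OF refl], subst sum.swap, rule refl)
  also have "\<dots> = (\<Sum>j<N. \<Sum>k<N. (if j = k then of_nat N else 0) * cinner (a j) (a k))"
    by (intro sum.cong refl) (subst sum_roots_of_unity, simp_all)
  also have "\<dots> = (\<Sum>j<N. of_nat N * cinner (a j) (a j))"
    by (intro sum.cong refl) (simp add: if_distrib[of "\<lambda>c. c * _"] cong: if_cong)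
  also have "\<dots> = of_real (N * (\<Sum>j<N. (norm (a j))\<^sup>2))"
    by (simp add: cinner_self sum_distrib_left)
  finally show ?thesis using of_real_eq_iff by blast
qed

text \<open>This replaces Plancherel's theorem. The series are truncated at \<open>N\<close>, where Parseval's identity for the \<open>N\<close>-th
roots of unity is exact, and the truncation errors are uniform on the circle by absolute summability.\<close>

lemma norm_power_series_le_imp_sum_norm_sq_le:
  fixes v w :: "nat \<Rightarrow> 'a::complex_hilbert_space"
  assumes v: "summable (\<lambda>j. norm (v j))" and w: "summable (\<lambda>j. norm (w j))" and C: "C \<ge> 0"
    and le: "\<And>z. cmod z = 1 \<Longrightarrow> norm (\<Sum>j. z ^ j *\<^sub>C w j) \<le> C * norm (\<Sum>j. z ^ j *\<^sub>C v j)"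
    and S: "\<And>N. (\<Sum>j<N. (norm (v j))\<^sup>2) \<le> S"
  shows "(\<Sum>j<n. (norm (w j))\<^sup>2) \<le> C\<^sup>2 * S"
proof -
  define B where "B = (\<Sum>j. norm (v j))"
  define e where "e N = (\<Sum>j. norm (w (j + N))) + C * (\<Sum>j. norm (v (j + N)))" for N
  have trunc: "norm ((\<Sum>j. z ^ j *\<^sub>C u j) - (\<Sum>j<N. z ^ j *\<^sub>C u j)) \<le> (\<Sum>j. norm (u (j + N)))"
    if u: "summable (\<lambda>j. norm (u j))" and z: "cmod z = 1" for u :: "nat \<Rightarrow> 'a" and z N
  proof -
    have s: "summable (\<lambda>j. norm (z ^ j *\<^sub>C u j))" using u z by (simp add: norm_power)
    have s2: "summable (\<lambda>j. norm (z ^ (j + N) *\<^sub>C u (j + N)))"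
      using summable_iff_shift[of "\<lambda>j. norm (z ^ j *\<^sub>C u j)" N] s by blast
    have "(\<Sum>j. z ^ j *\<^sub>C u j) - (\<Sum>j<N. z ^ j *\<^sub>C u j) = (\<Sum>j. z ^ (j + N) *\<^sub>C u (j + N))"
      using suminf_minus_initial_segment[OF summable_norm_cancel[OF s], of N] by simp
    also have "norm \<dots> \<le> (\<Sum>j. norm (z ^ (j + N) *\<^sub>C u (j + N)))" by (rule summable_norm[OF s2])
    finally show ?thesis using z by (simp add: norm_power)
  qed
  have e0: "e \<longlonglongrightarrow> 0"
    unfolding e_def
    using tendsto_add[OF suminf_exist_split2[OF w] tendsto_mult_left[OF suminf_exist_split2[OF v], of C]]
    by simp
  have eN: "e N \<ge> 0" for N
    unfolding e_def using C v w
    by (intro add_nonneg_nonneg mult_nonneg_nonneg suminf_nonneg) (auto simp: summable_iff_shift[of "\<lambda>j. norm (_ j)"])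
  have B0: "B \<ge> 0" unfolding B_def using v by (intro suminf_nonneg) auto
  \<comment> \<open>average the pointwise bound \<open>pt\<close> over the \<open>N\<close>-th roots of unity\<close>
  have bnd: "(\<Sum>j<N. (norm (w j))\<^sup>2) \<le> C\<^sup>2 * S + (2 * C * B * e N + (e N)\<^sup>2)" if N: "N > 0" for N
  proof -
    have pt: "(norm (\<Sum>j<N. z ^ j *\<^sub>C w j))\<^sup>2
        \<le> C\<^sup>2 * (norm (\<Sum>j<N. z ^ j *\<^sub>C v j))\<^sup>2 + (2 * C * B * e N + (e N)\<^sup>2)" if z: "cmod z = 1" for z
    proof -
      let ?W = "\<Sum>j<N. z ^ j *\<^sub>C w j" and ?V = "\<Sum>j<N. z ^ j *\<^sub>C v j"
      let ?Wi = "\<Sum>j. z ^ j *\<^sub>C w j" and ?Vi = "\<Sum>j. z ^ j *\<^sub>C v j"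
      have "norm ?W \<le> norm ?Wi + (\<Sum>j. norm (w (j + N)))"
        using trunc[OF w z, of N] norm_triangle_ineq3[of ?Wi ?W] by linarith
      moreover have "C * norm ?Vi \<le> C * (norm ?V + (\<Sum>j. norm (v (j + N))))"
        using trunc[OF v z, of N] norm_triangle_ineq3[of ?Vi ?V] C by (intro mult_left_mono) linarith+
      ultimately have W: "norm ?W \<le> C * norm ?V + e N"
        using le[OF z] by (simp add: e_def algebra_simps)
      have "norm ?V \<le> (\<Sum>j<N. norm (z ^ j *\<^sub>C v j))" by (rule norm_sum)
      also have "\<dots> = (\<Sum>j<N. norm (v j))" using z by (simp add: norm_power)
      also have "\<dots> \<le> B" unfolding B_def using v by (intro sum_le_suminf) auto
      finally have V: "norm ?V \<le> B" .
      have "(norm ?W)\<^sup>2 \<le> (C * norm ?V + e N)\<^sup>2" using W by (intro power_mono) auto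
      also have "\<dots> = C\<^sup>2 * (norm ?V)\<^sup>2 + (2 * C * norm ?V * e N + (e N)\<^sup>2)"
        by (simp add: power2_eq_square algebra_simps)
      also have "\<dots> \<le> C\<^sup>2 * (norm ?V)\<^sup>2 + (2 * C * B * e N + (e N)\<^sup>2)"
        using V C eN[of N] by (intro add_left_mono add_right_mono mult_right_mono mult_left_mono) auto
      finally show ?thesis .
    qed
    have "N * (\<Sum>j<N. (norm (w j))\<^sup>2) = (\<Sum>l<N. (norm (\<Sum>j<N. cis (2 * pi * real l / real N) ^ j *\<^sub>C w j))\<^sup>2)"
      using discrete_parseval[of N w] by simp
    also have "\<dots> \<le> (\<Sum>l<N. C\<^sup>2 * (norm (\<Sum>j<N. cis (2 * pi * real l / real N) ^ j *\<^sub>C v j))\<^sup>2 + (2 * C * B * e N + (e N)\<^sup>2))"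
      by (intro sum_mono pt) simp
    also have "\<dots> = C\<^sup>2 * (N * (\<Sum>j<N. (norm (v j))\<^sup>2)) + N * (2 * C * B * e N + (e N)\<^sup>2)"
      unfolding sum.distrib sum_distrib_left[symmetric] discrete_parseval by (simp add: distrib_left)
    also have "\<dots> \<le> C\<^sup>2 * (N * S) + N * (2 * C * B * e N + (e N)\<^sup>2)"
      using S by (intro add_right_mono mult_left_mono) auto
    also have "\<dots> = N * (C\<^sup>2 * S + (2 * C * B * e N + (e N)\<^sup>2))" by (simp add: algebra_simps)
    finally show ?thesis using N by simp
  qed
  have "(\<lambda>N. C\<^sup>2 * S + (2 * C * B * e N + (e N)\<^sup>2)) \<longlonglongrightarrow> C\<^sup>2 * S + (2 * C * B * 0 + 0\<^sup>2)"
    by (intro tendsto_intros e0)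
  then have lim: "(\<lambda>N. C\<^sup>2 * S + (2 * C * B * e N + (e N)\<^sup>2)) \<longlonglongrightarrow> C\<^sup>2 * S" by simp
  show ?thesis
  proof (rule tendsto_lowerbound[OF lim])
    show "\<forall>\<^sub>F N in sequentially. (\<Sum>j<n. (norm (w j))\<^sup>2) \<le> C\<^sup>2 * S + (2 * C * B * e N + (e N)\<^sup>2)"
      using eventually_ge_at_top[of "Suc n"]
    proof eventually_elim
      case (elim N)
      have "(\<Sum>j<n. (norm (w j))\<^sup>2) \<le> (\<Sum>j<N. (norm (w j))\<^sup>2)" using elim by (intro sum_mono2) auto
      also have "\<dots> \<le> C\<^sup>2 * S + (2 * C * B * e N + (e N)\<^sup>2)" using elim by (intro bnd) auto
      finally show ?case .
    qed
  qed simp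
qed


section \<open>Uniform boundedness and absolutely convergent integrals\<close>

text \<open>By Baire's theorem some set \<open>F n\<close> contains a ball, and linearity moves the bound from that ball to the origin.\<close>

lemma banach_steinhaus:
  fixes f :: "'i \<Rightarrow> 'a::banach \<Rightarrow> 'b::real_normed_vector"
  assumes lin: "\<And>i. i \<in> I \<Longrightarrow> bounded_linear (f i)"
    and pt: "\<And>x. \<exists>B. \<forall>i\<in>I. norm (f i x) \<le> B"
  obtains C where "C > 0" "\<And>i x. i \<in> I \<Longrightarrow> norm (f i x) \<le> C * norm x"
proof -
  define F where "F n = {x. \<forall>i\<in>I. norm (f i x) \<le> real n}" for n :: nat
  have cl: "closed (F n)" for n
  proof -
    have "F n = (\<Inter>i\<in>I. {x. norm (f i x) \<le> real n})" by (auto simp: F_def)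
    moreover have "closed {x. norm (f i x) \<le> real n}" if "i \<in> I" for i
      by (intro closed_Collect_le continuous_intros bounded_linear.continuous_on[OF lin[OF that]])
    ultimately show ?thesis by auto
  qed
  have un: "(\<Union>n. F n) = UNIV"
  proof -
    have "\<exists>n. x \<in> F n" for x
    proof -
      obtain B where B: "\<forall>i\<in>I. norm (f i x) \<le> B" using pt by blast
      obtain n :: nat where "B \<le> n" using real_arch_simple by blast
      then have "x \<in> F n" using B unfolding F_def by (blast intro: order_trans)
      then show ?thesis by blast
    qed
    then show ?thesis by auto
  qed
  have "\<exists>n. interior (F n) \<noteq> {}"
  proof (rule ccontr)
    assume "\<not> ?thesis"
    then have "euclidean interior_of \<Union>(range F) = {}"
      using cl by (intro Baire_category_alt) (auto simp: completely_metrizable_space_euclidean)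
    then show False using un by simp
  qed
  then obtain n x0 e where e: "e > 0" "cball x0 e \<subseteq> F n"
    by (metis all_not_in_conv mem_interior_cball)
  have "norm (f i x) \<le> (2 * n / e + 1) * norm x" if i: "i \<in> I" for i x
  proof (cases "x = 0")
    case True
    then show ?thesis using linear_simps(3)[OF lin[OF i]] by simp
  next
    case False
    define c where "c = e / norm x"
    have c: "c > 0" using e False by (simp add: c_def)
    have "x0 + c *\<^sub>R x \<in> F n" "x0 \<in> F n" using e False by (auto simp: c_def dist_norm subset_iff)
    then have "norm (f i (x0 + c *\<^sub>R x)) \<le> n" "norm (f i x0) \<le> n" using i by (auto simp: F_def)
    moreover have "f i (x0 + c *\<^sub>R x) - f i x0 = c *\<^sub>R f i x"
      using lin[OF i] by (simp add: linear_simps)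
    ultimately have "norm (c *\<^sub>R f i x) \<le> 2 * n"
      using norm_triangle_ineq4[of "f i (x0 + c *\<^sub>R x)" "f i x0"] by simp
    then have "norm (f i x) \<le> 2 * n / c" using c by (simp add: field_simps)
    also have "\<dots> \<le> (2 * n / e + 1) * norm x" using e by (simp add: c_def field_simps)
    finally show ?thesis .
  qed
  moreover have "2 * n / e + 1 > 0" using e by (simp add: add_nonneg_pos)
  ultimately show ?thesis using that by blast
qed

text \<open>The substitution \<open>u = x powr (1 - \<beta>)\<close> removes the singularity: composed with it, the integral of a continuous function is
a primitive on the interior that is continuous up to \<open>0\<close>.\<close>

lemma integrable_on_powr_times_continuous:
  fixes g :: "real \<Rightarrow> 'a::banach"
  assumes \<beta>: "\<beta> < 1" and c: "c \<ge> 0" and g: "continuous_on {0..c} g"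
  shows "(\<lambda>x. x powr (-\<beta>) *\<^sub>R g x) integrable_on {0..c}"
proof -
  define p where "p = 1 / (1 - \<beta>)"
  have p: "p > 0" "(1 - \<beta>) * p = 1" using \<beta> by (auto simp: p_def)
  let ?d = "c powr (1 - \<beta>)" and ?k = "\<lambda>u. g (u powr p)"
  have inv: "(x powr (1 - \<beta>)) powr p = x" if "x \<ge> 0" for x using p that by (simp add: powr_powr)
  have le: "u powr p \<le> c" if "0 \<le> u" "u \<le> ?d" for u
    using powr_mono2[OF less_imp_le[OF p(1)] that] inv[OF c] by simp
  have k: "continuous_on {0..?d} ?k"
    using p le by (intro continuous_on_compose2[OF g] continuous_on_powr' continuous_intros) auto
  define F where "F x = p *\<^sub>R integral {0..x powr (1 - \<beta>)} ?k" for x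
  have "continuous_on {0..c} (\<lambda>x. integral {0..x powr (1 - \<beta>)} ?k)"
  proof (rule continuous_on_compose2[OF indefinite_integral_continuous_1[OF integrable_continuous_interval[OF k]]])
    show "continuous_on {0..c} (\<lambda>x. x powr (1 - \<beta>))"
      using \<beta> by (intro continuous_on_powr' continuous_intros) auto
    show "(\<lambda>x. x powr (1 - \<beta>)) ` {0..c} \<subseteq> {0..?d}"
      using \<beta> by (auto intro!: powr_mono2)
  qed
  then have "continuous_on {0..c} F" unfolding F_def by (intro continuous_intros)
  moreover have "(F has_vector_derivative x powr (-\<beta>) *\<^sub>R g x) (at x)" if x: "x \<in> {0<..<c}" for x
  proof -
    let ?u = "x powr (1 - \<beta>)"
    have u: "?u \<in> {0<..<?d}" using x \<beta> by (auto intro: powr_less_mono2)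
    have "((\<lambda>u. integral {0..u} ?k) has_vector_derivative ?k ?u) (at ?u within {0..?d})"
      using u by (intro integral_has_vector_derivative k) auto
    then have 1: "((\<lambda>u. integral {0..u} ?k) has_vector_derivative ?k ?u) (at ?u)"
      using u by (subst (asm) at_within_interior) auto
    have "((\<lambda>x. x powr (1 - \<beta>)) has_real_derivative (1 - \<beta>) * x powr (-\<beta>)) (at x)"
      using x by (auto intro!: derivative_eq_intros)
    then have "((\<lambda>x. x powr (1 - \<beta>)) has_vector_derivative (1 - \<beta>) * x powr (-\<beta>)) (at x)"
      by (simp add: has_real_derivative_iff_has_vector_derivative)
    from has_vector_derivative_scaleR[OF DERIV_const[of p] vector_diff_chain_at[OF this 1]]
    show ?thesis using p x inv[of x] by (simp add: F_def[abs_def] o_def mult.assoc[symmetric] mult.commute[of p])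
  qed
  ultimately have "((\<lambda>x. x powr (-\<beta>) *\<^sub>R g x) has_integral (F c - F 0)) {0..c}"
    by (intro fundamental_theorem_of_calculus_interior c)
  then show ?thesis by blast
qed

text \<open>Integrals over large intervals are Cauchy because their differences are dominated by those of \<open>g\<close>.\<close>

lemma integrable_on_dominated_half_line:
  fixes f :: "real \<Rightarrow> 'a::banach"
  assumes f: "\<And>c. c \<ge> 0 \<Longrightarrow> f integrable_on {0..c}"
    and g: "g integrable_on {0..}" and le: "\<And>x. x \<ge> 0 \<Longrightarrow> norm (f x) \<le> g x"
  shows "f integrable_on {0..}"
proof -
  let ?f = "\<lambda>x. if x \<in> {0..} then f x else 0" and ?g = "\<lambda>x. if x \<in> {0..} then g x else 0"
  have leg: "norm (?f x) \<le> ?g x" for x using le[of x] by auto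
  have gab: "?g integrable_on cbox a b" for a b using integrable_altD(1)[OF g] .
  have fab: "?f integrable_on cbox a b" for a b :: real
  proof -
    have "f integrable_on {max 0 a..b}"
      by (rule integrable_subinterval_real[OF f[of "max 0 b"]]) auto
    moreover have "{max 0 a..b} = {0..} \<inter> {a..b}" by auto
    ultimately show ?thesis by (metis (no_types) integrable_restrict_Int cbox_interval)
  qed
  have diff: "norm (integral (cbox a b) ?f - integral (cbox c d) ?f)
      \<le> integral (cbox c d) ?g - integral (cbox a b) ?g" if sub: "cbox a b \<subseteq> cbox c d" for a b c d :: real
  proof -
    let ?fr = "\<lambda>x. if x \<in> cbox a b then ?f x else 0" and ?gr = "\<lambda>x. if x \<in> cbox a b then ?g x else 0"
    have rf: "?fr integrable_on cbox c d" "integral (cbox c d) ?fr = integral (cbox a b) ?f"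
      by (simp_all only: integrable_restrict_Int integral_restrict_Int Int_absorb2[OF sub] fab[unfolded integrable_restrict_Int])
    have rg: "?gr integrable_on cbox c d" "integral (cbox c d) ?gr = integral (cbox a b) ?g"
      by (simp_all only: integrable_restrict_Int integral_restrict_Int Int_absorb2[OF sub] gab[unfolded integrable_restrict_Int])
    have "norm (integral (cbox c d) (\<lambda>x. ?f x - ?fr x)) \<le> integral (cbox c d) (\<lambda>x. ?g x - ?gr x)"
    proof (rule Henstock_Kurzweil_Integration.integral_norm_bound_integral)
      show "norm (?f x - ?fr x) \<le> ?g x - ?gr x" for x using leg[of x] by auto
    qed (intro Henstock_Kurzweil_Integration.integrable_diff fab gab rf rg)+
    then show ?thesis
      unfolding Henstock_Kurzweil_Integration.integral_diff[OF fab[of c d] rf(1)]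
        Henstock_Kurzweil_Integration.integral_diff[OF gab[of c d] rg(1)] rf(2) rg(2)
      by (metis (no_types, lifting) norm_minus_commute)
  qed
  show ?thesis
  proof (rule integrable_alt_subset[THEN iffD2], intro conjI allI impI)
    show "?f integrable_on cbox a b" for a b by (rule fab)
  next
    fix e :: real assume "e > 0"
    obtain B where B: "B > 0" "\<forall>a b c d. ball 0 B \<subseteq> cbox a b \<and> ball 0 B \<subseteq> cbox c d \<longrightarrow>
      norm (integral (cbox a b) ?g - integral (cbox c d) ?g) < e"
      by (rule exE[OF integrable_altD(2)[OF g \<open>e > 0\<close>]], elim conjE) (rule that)
    show "\<exists>B>0. \<forall>a b c d. ball 0 B \<subseteq> cbox a b \<and> cbox a b \<subseteq> cbox c d \<longrightarrow>
      norm (integral (cbox a b) ?f - integral (cbox c d) ?f) < e"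
    proof (intro exI conjI allI impI)
      fix a b c d assume h: "ball (0::real) B \<subseteq> cbox a b \<and> cbox a b \<subseteq> cbox c d"
      then have "ball 0 B \<subseteq> cbox a b \<and> ball 0 B \<subseteq> cbox c d" by blast
      then have "norm (integral (cbox a b) ?g - integral (cbox c d) ?g) < e"
        by (rule B(2)[rule_format])
      then show "norm (integral (cbox a b) ?f - integral (cbox c d) ?f) < e"
        using diff[OF conjunct2[OF h]] unfolding real_norm_def by linarith
    qed fact
  qed
qed

text \<open>The integral is split at a threshold \<open>\<delta>\<close>, with the bound \<open>a\<close> below and the bound \<open>b / x\<close> above it. The freedom to choose \<open>\<delta>\<close> is what makes the estimate an interpolation.\<close>

lemma integral_powr_kernel_bound:
  fixes g :: "real \<Rightarrow> 'a::banach"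
  assumes \<beta>: "0 < \<beta>" "\<beta> < 1" and \<delta>: "\<delta> > 0" and cont: "continuous_on {0..} g" and nn: "a \<ge> 0" "b \<ge> 0"
    and small: "\<And>x. 0 < x \<Longrightarrow> norm (g x) \<le> a"
    and large: "\<And>x. 0 < x \<Longrightarrow> norm (g x) \<le> b / x"
  shows "(\<lambda>x. x powr (-\<beta>) *\<^sub>R g x) integrable_on {0..}" (is "?f integrable_on _")
    and "norm (integral {0..} (\<lambda>x. x powr (-\<beta>) *\<^sub>R g x))
      \<le> a * \<delta> powr (1 - \<beta>) / (1 - \<beta>) + b * \<delta> powr (-\<beta>) / \<beta>"
proof -
  define g1 where "g1 x = (if x \<in> {0..\<delta>} then a * x powr (-\<beta>) else 0)" for x
  define g2 where "g2 x = (if x \<in> {\<delta>..} then b * x powr (-\<beta> - 1) else 0)" for x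
  have "((\<lambda>x. a * x powr (-\<beta>)) has_integral a * (\<delta> powr (-\<beta> + 1) / (-\<beta> + 1))) {0..\<delta>}"
    using \<beta> \<delta> by (intro has_integral_mult_right has_integral_powr_from_0) auto
  then have 1: "(g1 has_integral a * (\<delta> powr (-\<beta> + 1) / (-\<beta> + 1))) {0..}"
    unfolding g1_def by (subst has_integral_restrict) auto
  have "((\<lambda>x. b * x powr (-\<beta> - 1)) has_integral b * (-(\<delta> powr ((-\<beta> - 1) + 1)) / ((-\<beta> - 1) + 1))) {\<delta>..}"
    using \<beta> \<delta> by (intro has_integral_mult_right has_integral_powr_to_inf) auto
  then have 2: "(g2 has_integral b * (-(\<delta> powr ((-\<beta> - 1) + 1)) / ((-\<beta> - 1) + 1))) {0..}"
    unfolding g2_def using \<delta> by (subst has_integral_restrict) auto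
  have 3: "((\<lambda>x. g1 x + g2 x) has_integral
      (a * \<delta> powr (1 - \<beta>) / (1 - \<beta>) + b * \<delta> powr (-\<beta>) / \<beta>)) {0..}"
    using has_integral_add[OF 1 2] by (simp add: add.commute)
  have le: "norm (?f x) \<le> g1 x + g2 x" if "x \<ge> 0" for x
  proof (cases "x = 0")
    case False
    then have x: "x > 0" using that by simp
    have "norm (?f x) \<le> a * x powr (-\<beta>)" "norm (?f x) \<le> b * x powr (-\<beta> - 1)"
      using mult_left_mono[OF small[OF x], of "x powr (-\<beta>)"] mult_left_mono[OF large[OF x], of "x powr (-\<beta>)"] x
      by (simp_all add: powr_diff mult_ac)
    then show ?thesis using x nn by (auto simp: g1_def g2_def add_increasing2)
  qed (use \<delta> in \<open>simp add: g1_def g2_def\<close>)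
  show int: "?f integrable_on {0..}"
  proof (rule integrable_on_dominated_half_line[OF _ has_integral_integrable[OF 3] le])
    show "?f integrable_on {0..c}" if "c \<ge> 0" for c
      using \<beta> that by (intro integrable_on_powr_times_continuous continuous_on_subset[OF cont]) auto
  qed
  have "norm (integral {0..} ?f) \<le> integral {0..} (\<lambda>x. g1 x + g2 x)"
    by (rule Henstock_Kurzweil_Integration.integral_norm_bound_integral[OF int has_integral_integrable[OF 3] le]) simp
  then show "norm (integral {0..} ?f) \<le> a * \<delta> powr (1 - \<beta>) / (1 - \<beta>) + b * \<delta> powr (-\<beta>) / \<beta>"
    using integral_unique[OF 3] by simp
qed


section \<open>Mean values and operator norms\<close>

text \<open>The increment over \<open>[0, t]\<close> is the sum of \<open>n\<close> increments over intervals of length \<open>t / n\<close>, with an error \<open>e\<close> that is uniform in their position and tends to \<open>0\<close>.\<close>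

lemma mean_value_from_right_increments:
  fixes f :: "real \<Rightarrow> 'a::real_normed_vector"
  assumes t: "t \<ge> 0" and e: "(e \<longlongrightarrow> 0) (at_right 0)"
    and inc: "\<And>a h. 0 \<le> a \<Longrightarrow> a \<le> t \<Longrightarrow> h > 0 \<Longrightarrow> norm (f (a + h) - f a) \<le> h * (c + e h)"
  shows "norm (f t - f 0) \<le> t * c"
proof (cases "t = 0")
  case False
  then have t: "t > 0" using t by simp
  have step: "norm (f t - f 0) \<le> t * (c + e (t / n))" if n: "n > 0" for n :: nat
  proof -
    define h where "h = t / n"
    have h: "h > 0" "n * h = t" using t n by (auto simp: h_def)
    have "norm (f (Suc j * h) - f (j * h)) \<le> h * (c + e h)" if "j < n" for j
    proof -
      have "j * h \<le> n * h" using that h by (intro mult_right_mono) auto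
      moreover have "Suc j * h = j * h + h" by (simp add: algebra_simps)
      ultimately show ?thesis using inc[of "j * h" h] h by simp
    qed
    then have "norm (\<Sum>j<n. f (Suc j * h) - f (j * h)) \<le> (\<Sum>j<n. h * (c + e h))"
      by (intro sum_norm_le) auto
    also have "(\<Sum>j<n. f (Suc j * h) - f (j * h)) = f t - f 0"
      unfolding sum_lessThan_telescope[of "\<lambda>j. f (j * h)"] h(2) by simp
    also have "(\<Sum>j<n. h * (c + e h)) = t * (c + e h)" unfolding h(2)[symmetric] by simp
    finally show ?thesis by (simp only: h_def)
  qed
  have "filterlim (\<lambda>n. t / real n) (at_right 0) sequentially" using t by real_asymp
  then have "(\<lambda>n. t * (c + e (t / real n))) \<longlonglongrightarrow> t * (c + 0)"
    by (intro tendsto_intros filterlim_compose[OF e])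
  then have "norm (f t - f 0) \<le> t * (c + 0)"
    by (rule tendsto_lowerbound[OF _ eventually_mono[OF eventually_gt_at_top[of 0] step]]) simp_all
  then show ?thesis by simp
qed simp

lemma onorm_bigo_iff:
  assumes lin: "\<forall>\<^sub>F i in F. bounded_linear (L i)"
  shows "(\<lambda>i. onorm (L i)) \<in> O[F](g) \<longleftrightarrow> (\<exists>c. \<forall>\<^sub>F i in F. \<forall>x. norm (L i x) \<le> c * norm (g i) * norm x)"
proof
  assume "(\<lambda>i. onorm (L i)) \<in> O[F](g)"
  then obtain c where "\<forall>\<^sub>F i in F. norm (onorm (L i)) \<le> c * norm (g i)" by (rule landau_o.bigE)
  with lin have "\<forall>\<^sub>F i in F. \<forall>x. norm (L i x) \<le> c * norm (g i) * norm x"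
  proof eventually_elim
    case (elim i)
    have "norm (L i x) \<le> onorm (L i) * norm x" for x by (rule onorm[OF elim(1)])
    moreover have "onorm (L i) * norm x \<le> c * norm (g i) * norm x" for x
      using elim(2) by (intro mult_right_mono) auto
    ultimately show ?case by (blast intro: order_trans)
  qed
  then show "\<exists>c. \<forall>\<^sub>F i in F. \<forall>x. norm (L i x) \<le> c * norm (g i) * norm x" by blast
next
  assume "\<exists>c. \<forall>\<^sub>F i in F. \<forall>x. norm (L i x) \<le> c * norm (g i) * norm x"
  then obtain c where "\<forall>\<^sub>F i in F. \<forall>x. norm (L i x) \<le> c * norm (g i) * norm x" by blast
  with lin have "\<forall>\<^sub>F i in F. norm (onorm (L i)) \<le> max c 1 * norm (g i)"
  proof eventually_elim
    case (elim i)
    have "onorm (L i) \<le> max c 1 * norm (g i)"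
      using elim(2) by (intro onorm_bound) (auto intro!: order_trans[OF elim(2)[rule_format]] mult_right_mono)
    then show ?case using onorm_pos_le[OF elim(1)] by simp
  qed
  then show "(\<lambda>i. onorm (L i)) \<in> O[F](g)" by (intro landau_o.bigI[of "max c 1"]) auto
qed

section \<open>Bounded semigroups and their resolvents\<close>

locale bounded_semigroup_generator =
  fixes T :: "real \<Rightarrow> 'a::complex_hilbert_space \<Rightarrow> 'a" and D :: "'a set" and A :: "'a \<Rightarrow> 'a"
  assumes semigroup: "C0_semigroup T"
    and bounded: "bounded_semigroup T"
    and generator: "is_generator D A T"
    and imaginary_axis: "\<And>s::real. \<i> * of_real s \<in> resolvent_set D A"
begin

text \<open>The maximum with \<open>1\<close> only serves to have \<open>M \<ge> 1\<close>; on the zero space the supremum is \<open>0\<close>.\<close>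

definition M :: real where "M = max 1 (SUP t\<in>{0..}. onorm (T t))"

abbreviation R :: "complex \<Rightarrow> 'a \<Rightarrow> 'a" where "R \<equiv> resolvent D A"

abbreviation R_im :: "real \<Rightarrow> 'a \<Rightarrow> 'a" where "R_im s \<equiv> R (\<i> * complex_of_real s)"

abbreviation R_re :: "real \<Rightarrow> 'a \<Rightarrow> 'a" where "R_re \<tau> \<equiv> R (complex_of_real \<tau>)"

text \<open>The operator \<open>(-A)\<^sup>-\<^sup>1\<close>; the sign makes \<open>G\<close> the one from which negative fractional powers are built.\<close>

definition G :: "'a \<Rightarrow> 'a" where "G = R 0"

lemma T_bounded_linear: "t \<ge> 0 \<Longrightarrow> bounded_linear (T t)"
  using semigroup unfolding C0_semigroup_def bounded_clinear_def by blast

lemma T_scaleC: "t \<ge> 0 \<Longrightarrow> T t (c *\<^sub>C x) = c *\<^sub>C T t x"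
  using semigroup unfolding C0_semigroup_def bounded_clinear_def by blast

lemma T_zero [simp]: "T 0 x = x"
  using semigroup unfolding C0_semigroup_def by simp

lemma T_add: "s \<ge> 0 \<Longrightarrow> t \<ge> 0 \<Longrightarrow> T (s + t) x = T s (T t x)"
  using semigroup unfolding C0_semigroup_def by simp

lemma T_at_0: "((\<lambda>t. T t x) \<longlongrightarrow> x) (at_right 0)"
  using semigroup unfolding C0_semigroup_def by blast

lemmas T_linear_simps = linear_simps[OF T_bounded_linear]

lemma M_ge_1: "M \<ge> 1" by (simp add: M_def)

lemma M_pos: "M > 0" using M_ge_1 by simp

lemma norm_T_le: assumes "t \<ge> 0" shows "norm (T t x) \<le> M * norm x"
proof -
  have "norm (T t x) \<le> onorm (T t) * norm x" by (rule onorm[OF T_bounded_linear[OF assms]])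
  also have "onorm (T t) \<le> (SUP t\<in>{0..}. onorm (T t))"
    using bounded assms unfolding bounded_semigroup_def by (intro cSUP_upper) auto
  also have "\<dots> \<le> M" by (simp add: M_def)
  finally show ?thesis by (simp add: mult_right_mono)
qed

lemma T_scaleR: "t \<ge> 0 \<Longrightarrow> T t (r *\<^sub>R x) = r *\<^sub>R T t x"
  by (simp add: T_linear_simps)

lemma generator_limit: "x \<in> D \<Longrightarrow> ((\<lambda>h. (T h x - x) /\<^sub>R h) \<longlongrightarrow> A x) (at_right 0)"
  using generator unfolding is_generator_def by blast

lemma generatorI:
  assumes "((\<lambda>h. (T h x - x) /\<^sub>R h) \<longlongrightarrow> y) (at_right 0)"
  shows "x \<in> D" "A x = y"
proof -
  show "x \<in> D" using generator assms unfolding is_generator_def by blast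
  from generator_limit[OF this] assms show "A x = y"
    by (rule tendsto_unique[rotated]) simp
qed

lemma generator_quotientI:
  assumes "(q \<longlongrightarrow> y) (at_right 0)" and q: "\<And>h. h > 0 \<Longrightarrow> q h = (T h x - x) /\<^sub>R h"
  shows "x \<in> D" "A x = y"
proof -
  have "((\<lambda>h. (T h x - x) /\<^sub>R h) \<longlongrightarrow> y) (at_right 0)"
    using assms(1) by (rule Lim_transform_eventually) (rule eventually_mono[OF eventually_at_right_less[of 0] q])
  then show "x \<in> D" "A x = y" by (rule generatorI)+
qed

lemma generator_add:
  assumes "x \<in> D" "y \<in> D" shows "x + y \<in> D" "A (x + y) = A x + A y"
proof -
  have "((\<lambda>h. (T h x - x) /\<^sub>R h + (T h y - y) /\<^sub>R h) \<longlongrightarrow> A x + A y) (at_right 0)"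
    by (intro tendsto_add generator_limit assms)
  then show "x + y \<in> D" "A (x + y) = A x + A y"
    by (rule generator_quotientI; simp add: T_linear_simps algebra_simps)+
qed

lemma generator_scaleC:
  assumes "x \<in> D" shows "c *\<^sub>C x \<in> D" "A (c *\<^sub>C x) = c *\<^sub>C A x"
proof -
  have "((\<lambda>h. c *\<^sub>C ((T h x - x) /\<^sub>R h)) \<longlongrightarrow> c *\<^sub>C A x) (at_right 0)"
    by (intro scaleC.tendsto tendsto_const generator_limit assms)
  then show "c *\<^sub>C x \<in> D" "A (c *\<^sub>C x) = c *\<^sub>C A x"
    by (rule generator_quotientI; simp add: T_scaleC scaleC_scaleR_right scaleC.diff_right)+
qed

lemma generator_diff:
  assumes "x \<in> D" "y \<in> D" shows "x - y \<in> D" "A (x - y) = A x - A y"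
proof -
  have m: "- y = (- 1) *\<^sub>C y" "- A y = (- 1) *\<^sub>C A y" by (simp_all add: scaleC.minus_left)
  show "x - y \<in> D" "A (x - y) = A x - A y"
    using generator_add[OF assms(1) generator_scaleC(1)[OF assms(2), of "- 1"]]
      generator_scaleC(2)[OF assms(2), of "- 1"] by (simp_all add: m[symmetric])
qed

lemma generator_T:
  assumes "x \<in> D" and t: "t \<ge> 0" shows "T t x \<in> D" "A (T t x) = T t (A x)"
proof -
  have lim: "((\<lambda>h. T t ((T h x - x) /\<^sub>R h)) \<longlongrightarrow> T t (A x)) (at_right 0)"
    by (intro bounded_linear.tendsto[OF T_bounded_linear] generator_limit assms)
  have eq: "T t ((T h x - x) /\<^sub>R h) = (T h (T t x) - T t x) /\<^sub>R h" if "h > 0" for h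
    using that t T_add[of t h x] T_add[of h t x] by (simp add: T_linear_simps add.commute)
  show "T t x \<in> D" "A (T t x) = T t (A x)" by (rule generator_quotientI[OF lim eq]; assumption)+
qed

text \<open>The rescaled semigroup \<open>e\<^sup>-\<^sup>i\<^sup>s\<^sup>t T(t)\<close> has generator \<open>A - is\<close>.\<close>

lemma rotated_generator_limit:
  fixes s :: real
  assumes "y \<in> D"
  shows "((\<lambda>h. (cis (- s * h) *\<^sub>C T h y - y) /\<^sub>R h) \<longlongrightarrow> A y - (\<i> * s) *\<^sub>C y) (at_right 0)"
proof -
  have "((\<lambda>h::complex. (exp (- (\<i> * s) * h) - 1) / h) \<longlongrightarrow> - (\<i> * s)) (at 0)"
  proof -
    have "((\<lambda>h. exp (- (\<i> * s) * h)) has_field_derivative - (\<i> * s)) (at 0)"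
      by (auto intro!: derivative_eq_intros)
    then show ?thesis by (simp add: DERIV_def)
  qed
  moreover have "filterlim complex_of_real (at 0) (at_right 0)"
    unfolding filterlim_at
    by (auto intro!: tendsto_eq_intros simp: eventually_at_filter)
  ultimately have "((\<lambda>h::real. (exp (- (\<i> * s) * of_real h) - 1) / of_real h) \<longlongrightarrow> - (\<i> * s)) (at_right 0)"
    by (rule filterlim_compose)
  then have cis: "((\<lambda>h. (cis (- s * h) - 1) /\<^sub>R h) \<longlongrightarrow> - (\<i> * s)) (at_right 0)"
    by (simp add: cis_conv_exp scaleR_conv_of_real divide_inverse mult_ac)
  have "((\<lambda>h. cis (- s * h)) \<longlongrightarrow> cis (- s * 0)) (at_right 0)" by (intro tendsto_intros)
  then have "((\<lambda>h. cis (- s * h) *\<^sub>C ((T h y - y) /\<^sub>R h) + ((cis (- s * h) - 1) /\<^sub>R h) *\<^sub>C y)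
      \<longlongrightarrow> cis (- s * 0) *\<^sub>C A y + (- (\<i> * s)) *\<^sub>C y) (at_right 0)"
    by (intro tendsto_add scaleC.tendsto cis generator_limit assms tendsto_const)
  then show ?thesis
    by (simp add: scaleC_scaleR_left scaleC_scaleR_right scaleC.diff_left scaleC.diff_right
        scaleC.minus_left algebra_simps)
qed

text \<open>By the semigroup law, an increment of the rescaled orbit at time \<open>a\<close> is the image of the increment at time \<open>0\<close>, up to a factor of modulus \<open>1\<close>.\<close>

lemma norm_rotated_T_diff_le:
  fixes s :: real
  assumes y: "y \<in> D" and t: "t \<ge> 0"
  shows "norm (cis (- s * t) *\<^sub>C T t y - y) \<le> M * t * norm ((\<i> * s) *\<^sub>C y - A y)"
proof -
  let ?U = "\<lambda>a. cis (- s * a) *\<^sub>C T a y" and ?d = "A y - (\<i> * s) *\<^sub>C y"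
  let ?q = "\<lambda>h. (?U h - y) /\<^sub>R h"
  have "norm (?U t - ?U 0) \<le> t * (M * norm ?d)"
  proof (rule mean_value_from_right_increments[OF t])
    have "((\<lambda>h. M * (norm (?q h) - norm ?d)) \<longlongrightarrow> M * (norm ?d - norm ?d)) (at_right 0)"
      by (intro tendsto_intros rotated_generator_limit y)
    then show "((\<lambda>h. M * (norm (?q h) - norm ?d)) \<longlongrightarrow> 0) (at_right 0)" by simp
    fix a h :: real assume a: "0 \<le> a" and h: "h > 0"
    have "T (a + h) y = T a (T h y)" using a h by (intro T_add) auto
    moreover have "cis (- s * (a + h)) = cis (- s * a) * cis (- s * h)" by (simp add: cis_mult algebra_simps)
    ultimately have "?U (a + h) - ?U a = cis (- s * a) *\<^sub>C T a (?U h - y)"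
      using a by (simp add: T_linear_simps T_scaleC scaleC_scaleC scaleC.diff_right)
    then have "norm (?U (a + h) - ?U a) \<le> M * norm (?U h - y)" using norm_T_le[OF a] by simp
    also have "norm (?U h - y) = h * norm (?q h)" using h unfolding norm_scaleR by simp
    finally show "norm (?U (a + h) - ?U a) \<le> h * (M * norm ?d + M * (norm (?q h) - norm ?d))"
      by (simp add: algebra_simps)
  qed
  then show ?thesis by (simp add: norm_minus_commute mult_ac)
qed

text \<open>This is dissipativity of \<open>A\<close> in the equivalent norm \<open>sup \<parallel>T(t)x\<parallel>\<close>, in which the semigroup is contractive. Since it
preserves bounds on whole orbits, it can be iterated without accumulating powers of \<open>M\<close>.\<close>

lemma orbit_bound_resolvent:
  assumes y: "y \<in> D" and z: "Re z > 0" and t: "t \<ge> 0"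
    and b: "\<And>t. t \<ge> 0 \<Longrightarrow> norm (T t (z *\<^sub>C y - A y)) \<le> b"
  shows "norm (T t y) \<le> b / Re z"
proof -
  define b' where "b' = (SUP t\<in>{0..}. norm (T t y))"
  have bdd: "bdd_above ((\<lambda>t. norm (T t y)) ` {0..})"
    by (rule bdd_aboveI2[of _ _ "M * norm y"]) (simp add: norm_T_le)
  have le_b': "norm (T t y) \<le> b'" if "t \<ge> 0" for t
    unfolding b'_def using that by (intro cSUP_upper bdd) auto
  have ineq: "Re z * b' \<le> b + M * norm ((T h y - y) /\<^sub>R h - A y)" if h: "h > 0" for h
  proof -
    define r where "r = norm ((T h y - y) /\<^sub>R h - A y)"
    have "b' \<le> (b' + h * b + M * (h * r)) / (1 + h * Re z)"
      unfolding b'_def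
    proof (rule cSUP_least)
      fix t :: real assume "t \<in> {0..}"
      then have t: "t \<ge> 0" by simp
      let ?e = "T h y - y - h *\<^sub>R A y"
      have e: "norm ?e = h * r"
      proof -
        have "?e = h *\<^sub>R ((T h y - y) /\<^sub>R h - A y)" using h by (simp add: algebra_simps)
        then show ?thesis using h by (simp add: r_def)
      qed
      have "(1 + of_real h * z) *\<^sub>C T t y = T (t + h) y + h *\<^sub>R T t (z *\<^sub>C y - A y) - T t ?e"
        using t h T_add[of t h y]
        by (simp add: T_linear_simps T_scaleC scaleC_add_left scaleC_scaleC[symmetric] scaleC_of_real scaleC_scaleR_right algebra_simps)
      then have "cmod (1 + of_real h * z) * norm (T t y)
          = norm (T (t + h) y + h *\<^sub>R T t (z *\<^sub>C y - A y) - T t ?e)"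
        by (metis norm_scaleC)
      also have "\<dots> \<le> norm (T (t + h) y) + norm (h *\<^sub>R T t (z *\<^sub>C y - A y)) + norm (T t ?e)"
        by (rule order_trans[OF norm_triangle_ineq4 add_right_mono[OF norm_triangle_ineq]])
      also have "\<dots> \<le> b' + h * b + M * (h * r)"
        using le_b'[of "t + h"] b[OF t] norm_T_le[OF t, of ?e] t h
        by (intro add_mono) (auto simp: e mult_left_mono)
      finally have "cmod (1 + of_real h * z) * norm (T t y) \<le> b' + h * b + M * (h * r)" .
      moreover have "1 + h * Re z \<le> cmod (1 + of_real h * z)"
        using complex_Re_le_cmod[of "1 + of_real h * z"] by simp
      ultimately have "(1 + h * Re z) * norm (T t y) \<le> b' + h * b + M * (h * r)"
        by (meson mult_right_mono norm_ge_zero order_trans)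
      then show "norm (T t y) \<le> ((SUP t\<in>{0..}. norm (T t y)) + h * b + M * (h * r)) / (1 + h * Re z)"
        using h z by (simp add: field_simps b'_def add_pos_pos)
    qed simp
    then have "(1 + h * Re z) * b' \<le> b' + h * b + M * (h * r)"
      using h z by (simp add: field_simps add_pos_pos)
    then have "h * (Re z * b') \<le> h * (b + M * r)" by (simp add: algebra_simps)
    then show ?thesis using h by (simp add: r_def)
  qed
  have "((\<lambda>h. b + M * norm ((T h y - y) /\<^sub>R h - A y)) \<longlongrightarrow> b + M * norm (A y - A y)) (at_right 0)"
    by (intro tendsto_intros generator_limit y)
  then have "Re z * b' \<le> b + M * norm (A y - A y)"
    by (rule tendsto_lowerbound)
      (auto intro: eventually_mono[OF eventually_at_right_less[of 0]] ineq)
  then have "b' \<le> b / Re z" using z by (simp add: field_simps)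
  then show ?thesis using le_b'[OF t] by simp
qed

lemma resolvent_bij: "z \<in> resolvent_set D A \<Longrightarrow> bij_betw (\<lambda>x. z *\<^sub>C x - A x) D UNIV"
  by (simp add: resolvent_set_def)

lemma resolvent_in_domain: "z \<in> resolvent_set D A \<Longrightarrow> R z x \<in> D"
  unfolding resolvent_def using resolvent_bij[of z] by (metis bij_betw_imp_surj_on inv_into_into UNIV_I)

lemma resolvent_right_inverse: "z \<in> resolvent_set D A \<Longrightarrow> z *\<^sub>C R z x - A (R z x) = x"
  unfolding resolvent_def using resolvent_bij[of z] by (meson UNIV_I bij_betw_inv_into_right)

lemma resolvent_eqI:
  assumes "z \<in> resolvent_set D A" "y \<in> D" "z *\<^sub>C y - A y = x"
  shows "R z x = y"
  using bij_betw_inv_into_left[OF resolvent_bij[OF assms(1)] assms(2)] assms(3)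
  by (simp add: resolvent_def)

lemma resolvent_bounded_linear: "z \<in> resolvent_set D A \<Longrightarrow> bounded_linear (R z)"
  by (simp add: resolvent_set_def bounded_clinear_def)

lemma resolvent_scaleC: "z \<in> resolvent_set D A \<Longrightarrow> R z (c *\<^sub>C x) = c *\<^sub>C R z x"
  by (simp add: resolvent_set_def bounded_clinear_def)

text \<open>The equation for \<open>z\<close> is the fixed point equation \<open>x = R(w)(y - (z - w)x)\<close>, a contraction when \<open>z\<close> is close to \<open>w\<close>.\<close>

lemma surj_near_resolvent_set:
  assumes w: "w \<in> resolvent_set D A" and c: "\<And>x. norm (R w x) \<le> c * norm x" "c \<ge> 0"
    and z: "cmod (z - w) * c < 1"
  obtains x where "x \<in> D" "z *\<^sub>C x - A x = y"
proof -
  let ?f = "\<lambda>x. R w (y - (z - w) *\<^sub>C x)"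
  have "\<exists>!x. ?f x = x"
  proof (rule banach_fix_type)
    show "0 \<le> cmod (z - w) * c" using c by simp
    show "\<forall>x x'. dist (?f x) (?f x') \<le> cmod (z - w) * c * dist x x'"
    proof (intro allI)
      fix x x'
      have "?f x - ?f x' = R w ((z - w) *\<^sub>C (x' - x))"
        by (simp add: linear_simps[OF resolvent_bounded_linear[OF w], symmetric] scaleC.diff_right algebra_simps)
      then show "dist (?f x) (?f x') \<le> cmod (z - w) * c * dist x x'"
        using c(1)[of "(z - w) *\<^sub>C (x' - x)"] by (simp add: dist_norm norm_minus_commute mult_ac)
    qed
  qed fact
  then obtain x where x: "?f x = x" by blast
  have "w *\<^sub>C x - A x = y - (z - w) *\<^sub>C x"
    using resolvent_right_inverse[OF w, of "y - (z - w) *\<^sub>C x"] x by simp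
  then have "z *\<^sub>C x - A x = y" by (simp add: scaleC.diff_left algebra_simps)
  moreover have "x \<in> D" using resolvent_in_domain[OF w] x by metis
  ultimately show ?thesis using that by blast
qed

lemma norm_le_in_right_half_plane:
  assumes "y \<in> D" "Re z > 0" shows "norm y \<le> M / Re z * norm (z *\<^sub>C y - A y)"
  using orbit_bound_resolvent[OF assms, of 0 "M * norm (z *\<^sub>C y - A y)"] norm_T_le by simp

text \<open>In the right half plane, dissipativity already gives injectivity and the bound, so only surjectivity has to be checked.\<close>

lemma in_resolvent_setI:
  assumes z: "Re z > 0" and surj: "\<And>y. \<exists>x\<in>D. z *\<^sub>C x - A x = y"
  shows "z \<in> resolvent_set D A"
proof -
  have "inj_on (\<lambda>x. z *\<^sub>C x - A x) D"
  proof (rule inj_onI)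
    fix x y assume xy: "x \<in> D" "y \<in> D" "z *\<^sub>C x - A x = z *\<^sub>C y - A y"
    then have "(z *\<^sub>C x - A x) - (z *\<^sub>C y - A y) = 0" by simp
    then have "z *\<^sub>C (x - y) - A (x - y) = 0"
      using xy by (simp only: generator_diff scaleC.diff_right) (simp add: algebra_simps)
    then show "x = y" using norm_le_in_right_half_plane[OF generator_diff(1)[OF xy(1,2)] z] by simp
  qed
  then have bij: "bij_betw (\<lambda>x. z *\<^sub>C x - A x) D UNIV"
    using surj by (auto simp: bij_betw_def image_iff) metis
  have inD: "R z x \<in> D" for x
    unfolding resolvent_def using bij by (metis bij_betw_imp_surj_on inv_into_into UNIV_I)
  have rinv: "z *\<^sub>C R z x - A (R z x) = x" for x
    unfolding resolvent_def using bij by (meson UNIV_I bij_betw_inv_into_right)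
  have eqI: "R z x = y" if "y \<in> D" "z *\<^sub>C y - A y = x" for x y
    using bij_betw_inv_into_left[OF bij that(1)] that(2) by (simp add: resolvent_def)
  have "bounded_clinear (R z)"
  proof (rule bounded_clinearI)
    show "R z (x + y) = R z x + R z y" for x y
      using rinv[of x] rinv[of y]
      by (intro eqI) (simp_all add: generator_add inD scaleC_add_right add_diff_add)
    show "R z (c *\<^sub>C x) = c *\<^sub>C R z x" for c x
    proof (rule eqI)
      have "z *\<^sub>C c *\<^sub>C R z x = c *\<^sub>C z *\<^sub>C R z x" by (simp add: scaleC_scaleC mult.commute)
      then show "z *\<^sub>C c *\<^sub>C R z x - A (c *\<^sub>C R z x) = c *\<^sub>C x"
        using rinv[of x] by (simp add: generator_scaleC inD scaleC.diff_right[symmetric])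
    qed (simp add: generator_scaleC inD)
    show "norm (R z x) \<le> M / Re z * norm x" for x
      using norm_le_in_right_half_plane[OF inD z, of x] rinv[of x] by simp
  qed
  then show ?thesis using bij by (simp add: resolvent_set_def)
qed

lemma norm_resolvent_le:
  assumes "z \<in> resolvent_set D A" "Re z > 0" shows "norm (R z x) \<le> M / Re z * norm x"
  using norm_le_in_right_half_plane[OF resolvent_in_domain[OF assms(1)] assms(2), of x]
    resolvent_right_inverse[OF assms(1), of x] by simp

lemma imaginary_axis': "Re z = 0 \<Longrightarrow> z \<in> resolvent_set D A"
  using imaginary_axis[of "Im z"] by (metis complex_eq mult_zero_left add_0 of_real_0)

text \<open>The point \<open>0\<close> is in the resolvent set, hence so is some \<open>w0 > 0\<close>. From there the resolvent extends to the connected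
open half plane, since by \<open>norm_resolvent_le\<close> the radius of solvability around \<open>w\<close> is at least \<open>Re w / M\<close>.\<close>

lemma right_half_plane_in_resolvent_set:
  assumes "Re z \<ge> 0" shows "z \<in> resolvent_set D A"
proof (cases "Re z = 0")
  case False
  let ?S = "{w. Re w > 0}"
  have ext: "w' \<in> resolvent_set D A"
    if w: "w \<in> resolvent_set D A" "Re w > 0" "Re w' > 0" "cmod (w' - w) * M < Re w" for w w'
  proof (rule in_resolvent_setI[OF w(3)])
    fix y
    have "cmod (w' - w) * (M / Re w) < 1" using w by (simp add: field_simps)
    then obtain x where "x \<in> D" "w' *\<^sub>C x - A x = y"
      using surj_near_resolvent_set[OF w(1) norm_resolvent_le[OF w(1,2)]] M_pos w(2) by (metis divide_nonneg_pos less_imp_le)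
    then show "\<exists>x\<in>D. w' *\<^sub>C x - A x = y" by blast
  qed
  have 0: "0 \<in> resolvent_set D A" by (rule imaginary_axis') simp
  obtain c where c: "c > 0" "\<And>x. norm (R 0 x) \<le> norm x * c"
    using bounded_linear.pos_bounded[OF resolvent_bounded_linear[OF 0]] by blast
  define w0 where "w0 = complex_of_real (1 / (2 * c))"
  have w0: "Re w0 > 0" "w0 \<in> resolvent_set D A"
  proof -
    show *: "Re w0 > 0" using c by (simp add: w0_def)
    show "w0 \<in> resolvent_set D A"
    proof (rule in_resolvent_setI[OF *])
      fix y
      have "cmod (w0 - 0) * c < 1" using c by (simp add: w0_def norm_divide)
      then show "\<exists>x\<in>D. w0 *\<^sub>C x - A x = y"
        using surj_near_resolvent_set[OF 0, of c w0 y] c by (metis less_imp_le mult.commute)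
    qed
  qed
  have "connected ?S" by (intro convex_connected convex_halfspace_Re_gt)
  then show ?thesis
  proof (rule connected_induction_simple[where P = "\<lambda>w. w \<in> resolvent_set D A"])
    show "w0 \<in> ?S" "w0 \<in> resolvent_set D A" using w0 by auto
    show "z \<in> ?S" using False assms by simp
    fix a :: complex assume a: "a \<in> ?S"
    \<comment> \<open>small enough for any two points of the ball to be within each other's radius of solvability\<close>
    define d where "d = Re a / (4 * M)"
    have d: "d > 0" "4 * (d * M) = Re a" "d \<le> Re a / 4"
      using a M_ge_1 by (auto simp: d_def field_simps)
    show "\<exists>T. openin (top_of_set ?S) T \<and> a \<in> T \<and>
        (\<forall>x\<in>T. \<forall>y\<in>T. x \<in> resolvent_set D A \<longrightarrow> y \<in> resolvent_set D A)"
    proof (intro exI conjI ballI impI)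
      show "openin (top_of_set ?S) (?S \<inter> ball a d)" by (simp add: openin_open_Int)
      show "a \<in> ?S \<inter> ball a d" using a d by simp
      fix x y assume xy: "x \<in> ?S \<inter> ball a d" "y \<in> ?S \<inter> ball a d" "x \<in> resolvent_set D A"
      have "cmod (y - x) < 2 * d"
        using xy norm_triangle_ineq4[of "a - x" "a - y"] by (simp add: dist_norm)
      then have "cmod (y - x) * M < 2 * d * M" using M_pos by (intro mult_strict_right_mono)
      moreover have "\<bar>Re (a - x)\<bar> < d" using xy abs_Re_le_cmod[of "a - x"] by (auto simp: dist_norm)
      ultimately have "cmod (y - x) * M < Re x" using d by (simp add: mult.assoc)
      then show "y \<in> resolvent_set D A" using xy by (intro ext[of x y]) auto
    qed
  qed
qed (rule imaginary_axis')

lemmas R_bounded_linear = resolvent_bounded_linear[OF right_half_plane_in_resolvent_set]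
lemmas R_in_domain = resolvent_in_domain[OF right_half_plane_in_resolvent_set]
lemmas R_right_inverse = resolvent_right_inverse[OF right_half_plane_in_resolvent_set]
lemmas R_eqI = resolvent_eqI[OF right_half_plane_in_resolvent_set]
lemmas R_scaleC = resolvent_scaleC[OF right_half_plane_in_resolvent_set]
lemmas R_linear_simps = linear_simps[OF R_bounded_linear]

lemma norm_R_le: "Re z > 0 \<Longrightarrow> norm (R z x) \<le> M / Re z * norm x"
  by (rule norm_resolvent_le[OF right_half_plane_in_resolvent_set]) auto

lemma R_orbit_bound:
  assumes "Re z > 0" "\<And>t. t \<ge> 0 \<Longrightarrow> norm (T t x) \<le> b" "t \<ge> 0"
  shows "norm (T t (R z x)) \<le> b / Re z"
  using assms by (intro orbit_bound_resolvent R_in_domain) (auto simp: R_right_inverse)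

lemma R_identity:
  assumes "Re z \<ge> 0" "Re w \<ge> 0"
  shows "R z x - R w x = (w - z) *\<^sub>C R z (R w x)"
proof -
  have "z *\<^sub>C R w x - A (R w x) = x + (z - w) *\<^sub>C R w x"
    using R_right_inverse[OF assms(2), of x] by (simp add: scaleC.diff_left algebra_simps)
  then have "R z (x + (z - w) *\<^sub>C R w x) = R w x" using assms by (intro R_eqI R_in_domain)
  moreover have "R z (x + (z - w) *\<^sub>C R w x) = R z x + (z - w) *\<^sub>C R z (R w x)"
    by (simp only: R_linear_simps(1)[OF assms(1)] R_scaleC[OF assms(1)])
  ultimately have eq: "R z x + (z - w) *\<^sub>C R z (R w x) = R w x" by (simp only:)
  have "a - c = - b" if "a + b = c" for a b c :: 'a using that by auto
  from this[OF eq] show ?thesis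
    by (simp only: scaleC.minus_left[symmetric] minus_diff_eq)
qed

lemma R_commute:
  assumes "Re z \<ge> 0" "Re w \<ge> 0" shows "R z (R w x) = R w (R z x)"
proof (cases "z = w")
  case False
  have "(w - z) *\<^sub>C R z (R w x) = R z x - R w x" by (rule R_identity[OF assms, symmetric])
  also have "\<dots> = - (R w x - R z x)" by simp
  also have "R w x - R z x = (z - w) *\<^sub>C R w (R z x)" by (rule R_identity[OF assms(2,1)])
  also have "- ((z - w) *\<^sub>C R w (R z x)) = (w - z) *\<^sub>C R w (R z x)"
    by (simp only: scaleC.minus_left[symmetric] minus_diff_eq)
  finally have "(w - z) *\<^sub>C R z (R w x) = (w - z) *\<^sub>C R w (R z x)" .
  then have "inverse (w - z) *\<^sub>C (w - z) *\<^sub>C R z (R w x) = inverse (w - z) *\<^sub>C (w - z) *\<^sub>C R w (R z x)" by (rule arg_cong)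
  then show ?thesis using False by (simp add: scaleC_scaleC)
qed simp

lemma R_T_commute:
  assumes "Re z \<ge> 0" "t \<ge> 0" shows "R z (T t x) = T t (R z x)"
proof (rule R_eqI[OF assms(1)])
  show "T t (R z x) \<in> D" using assms by (intro generator_T R_in_domain)
  have "z *\<^sub>C T t (R z x) - A (T t (R z x)) = T t (z *\<^sub>C R z x - A (R z x))"
    using assms by (simp add: generator_T R_in_domain T_linear_simps T_scaleC)
  then show "z *\<^sub>C T t (R z x) - A (T t (R z x)) = T t x" by (simp only: R_right_inverse[OF assms(1)])
qed

lemma G_bounded_linear: "bounded_linear G" unfolding G_def by (rule R_bounded_linear) simp
lemma G_in_domain: "G x \<in> D" unfolding G_def by (rule R_in_domain) simp
lemma A_G: "A (G x) = - x"
proof -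
  have "0 *\<^sub>C R 0 x - A (R 0 x) = x" by (rule R_right_inverse) simp
  then have "- A (G x) = x" by (simp only: G_def scaleC.zero_left diff_0)
  then have "- (- A (G x)) = - x" by (rule arg_cong)
  then show ?thesis by (simp only: minus_minus)
qed
lemma G_scaleC: "G (c *\<^sub>C x) = c *\<^sub>C G x" unfolding G_def by (rule R_scaleC) simp
lemma G_R_commute: "Re z \<ge> 0 \<Longrightarrow> G (R z x) = R z (G x)" unfolding G_def by (rule R_commute) simp_all
lemma G_T_commute: "t \<ge> 0 \<Longrightarrow> G (T t x) = T t (G x)" unfolding G_def by (rule R_T_commute) simp_all
lemmas G_linear_simps = linear_simps[OF G_bounded_linear]

text \<open>Equivalently, \<open>1 = (z - A) R(z)\<close> multiplied by \<open>G\<close>. Every estimate that trades a power of \<open>G\<close> for a power of \<open>z\<close> comes from here.\<close>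

lemma G_identity:
  assumes "Re z \<ge> 0" shows "G x = R z x + z *\<^sub>C R z (G x)"
proof -
  have "G x - R z x = (z - 0) *\<^sub>C G (R z x)" unfolding G_def using assms by (intro R_identity) auto
  then have "G x - R z x = z *\<^sub>C R z (G x)" by (simp only: diff_zero G_R_commute[OF assms])
  then have "G x = z *\<^sub>C R z (G x) + R z x" by (rule diff_eq_eq[THEN iffD1])
  also have "\<dots> = R z x + z *\<^sub>C R z (G x)" by (rule add.commute)
  finally show ?thesis .
qed

lemma G_bound: obtains g where "g > 0" "\<And>x. norm (G x) \<le> g * norm x"
proof -
  obtain c where c: "c > 0" "\<And>x. norm (G x) \<le> norm x * c"
    using bounded_linear.pos_bounded[OF G_bounded_linear] by blast
  then show ?thesis by (intro that[of c]) (simp_all add: mult.commute)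
qed

text \<open>The vector is \<open>-A R(\<tau>) x = x - \<tau> R(\<tau>) x\<close>, which is bounded uniformly in \<open>\<tau>\<close>.\<close>

lemma norm_R_positive_le_G:
  fixes \<tau> :: real
  assumes "\<tau> \<ge> 0"
  obtains y where "R (of_real \<tau>) x = G y" "norm y \<le> (1 + M) * norm x"
proof
  let ?y = "x - of_real \<tau> *\<^sub>C R (of_real \<tau>) x"
  have \<tau>: "Re (of_real \<tau>) \<ge> 0" using assms by simp
  have "G ?y = G x - of_real \<tau> *\<^sub>C G (R (of_real \<tau>) x)" by (simp add: G_linear_simps G_scaleC)
  also have "\<dots> = R (of_real \<tau>) x"
    using G_identity[OF \<tau>, of x] G_R_commute[OF \<tau>, of x] by (metis add_diff_cancel_right')
  finally show "R (of_real \<tau>) x = G ?y" by simp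
  have "\<tau> * norm (R (of_real \<tau>) x) \<le> M * norm x"
  proof (cases "\<tau> = 0")
    case False
    then show ?thesis using norm_R_le[of "of_real \<tau>" x] assms by (simp add: field_simps)
  qed (use M_pos in simp)
  then show "norm ?y \<le> (1 + M) * norm x"
    using norm_triangle_ineq4[of x "of_real \<tau> *\<^sub>C R (of_real \<tau>) x"] assms by (simp add: algebra_simps)
qed

text \<open>Moving to the right costs only a factor: \<open>R(\<sigma> + is) = R(is) (1 - \<sigma> R(\<sigma> + is))\<close>, and the second factor is bounded.\<close>

lemma norm_R_shift_le:
  fixes s \<sigma> :: real
  assumes "\<And>x. norm (R (\<i> * s) x) \<le> c * norm x" "c \<ge> 0" "\<sigma> \<ge> 0"
  shows "norm (R (\<sigma> + \<i> * s) x) \<le> c * (1 + M) * norm x"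
proof -
  let ?y = "x - of_real \<sigma> *\<^sub>C R (\<sigma> + \<i> * s) x"
  have "R (\<sigma> + \<i> * s) x = R (\<i> * s) ?y"
    using R_identity[of "\<i> * s" "\<sigma> + \<i> * s" x] assms(3)
    by (simp add: R_linear_simps R_scaleC algebra_simps)
  moreover have "\<sigma> * norm (R (\<sigma> + \<i> * s) x) \<le> M * norm x"
  proof (cases "\<sigma> = 0")
    case False
    then show ?thesis using norm_R_le[of "\<sigma> + \<i> * s" x] assms(3) by (simp add: field_simps)
  qed (use M_pos in simp)
  then have "norm ?y \<le> (1 + M) * norm x"
    using norm_triangle_ineq4[of x "of_real \<sigma> *\<^sub>C R (\<sigma> + \<i> * s) x"] assms(3) by (simp add: algebra_simps)
  ultimately show ?thesis
    using order_trans[OF assms(1)[of ?y] mult_left_mono[OF _ assms(2)]] by (simp add: mult.assoc)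
qed

text \<open>The resolvent is locally bounded on the imaginary axis, and the segment is compact.\<close>

lemma R_bounded_on_segment:
  fixes a b :: real
  assumes "a \<le> b"
  shows "\<exists>C. \<forall>s. a \<le> s \<and> s \<le> b \<longrightarrow> (\<forall>x. norm (R (\<i> * s) x) \<le> C * norm x)"
proof -
  define P where "P = (\<lambda>a b. \<exists>C. \<forall>s. a \<le> s \<and> s \<le> b \<longrightarrow> (\<forall>x. norm (R_im s x) \<le> C * norm x))"
  have "P a b"
  proof (rule Bolzano[OF assms])
    fix a b c assume "P a b" "P b c"
    then obtain C C' where C: "\<And>s x. a \<le> s \<Longrightarrow> s \<le> b \<Longrightarrow> norm (R_im s x) \<le> C * norm x"
      "\<And>s x. b \<le> s \<Longrightarrow> s \<le> c \<Longrightarrow> norm (R_im s x) \<le> C' * norm x"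
      unfolding P_def by meson
    have "norm (R_im s x) \<le> max C C' * norm x" if "a \<le> s" "s \<le> c" for s x
    proof (cases "s \<le> b")
      case True
      then show ?thesis using C(1)[of s x] that by (meson max.cobounded1 mult_right_mono norm_ge_zero order_trans)
    next
      case False
      then show ?thesis using C(2)[of s x] that by (meson linear max.cobounded2 mult_right_mono norm_ge_zero order_trans)
    qed
    then show "P a c" unfolding P_def by blast
  next
    fix x0 :: real
    let ?R = "R (\<i> * of_real x0)"
    obtain c where c: "c > 0" "\<And>x. norm (?R x) \<le> norm x * c"
      using bounded_linear.pos_bounded[OF R_bounded_linear[of "\<i> * of_real x0"]] by auto
    have "norm (R_im s x) \<le> 2 * c * norm x" if s: "\<bar>s - x0\<bar> < 1 / (2 * c)" for s x
    proof -
      let ?r = "R_im s x"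
      have "?r = ?R x - ?R ((\<i> * of_real s - \<i> * of_real x0) *\<^sub>C ?r)"
        using R_identity[of "\<i> * of_real x0" "\<i> * of_real s" x]
        by (simp add: R_scaleC algebra_simps)
      then have "norm ?r \<le> norm (?R x) + norm (?R ((\<i> * of_real s - \<i> * of_real x0) *\<^sub>C ?r))"
        by (metis norm_triangle_ineq4)
      also have "\<dots> \<le> norm x * c + (\<bar>s - x0\<bar> * norm ?r) * c"
      proof (intro add_mono c(2))
        have "cmod (\<i> * of_real s - \<i> * of_real x0) = \<bar>s - x0\<bar>"
          by (simp flip: right_diff_distrib of_real_diff add: norm_mult)
        then show "norm (?R ((\<i> * of_real s - \<i> * of_real x0) *\<^sub>C ?r)) \<le> (\<bar>s - x0\<bar> * norm ?r) * c"
          using c(2)[of "(\<i> * of_real s - \<i> * of_real x0) *\<^sub>C ?r"] by simp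
      qed
      also have "(\<bar>s - x0\<bar> * norm ?r) * c \<le> (1 / (2 * c) * norm ?r) * c"
        using s c by (intro mult_right_mono) auto
      finally show ?thesis using c by (simp add: field_simps)
    qed
    then have "P a b" if "a \<le> x0 \<and> x0 \<le> b \<and> b - a < 1 / (2 * c)" for a b
      unfolding P_def using that by (intro exI[of _ "2 * c"]) auto
    then show "\<exists>d>0. \<forall>a b. a \<le> x0 \<and> x0 \<le> b \<and> b - a < d \<longrightarrow> P a b"
      using c by (intro exI[of _ "1 / (2 * c)"]) auto
  qed
  then show ?thesis unfolding P_def .
qed

end

section \<open>The backward Euler scheme\<close>

lemma funpow_commute:
  fixes f g :: "'a \<Rightarrow> 'a"
  shows "(\<And>x. f (g x) = g (f x)) \<Longrightarrow> (f ^^ n) (g x) = g ((f ^^ n) x)"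
  by (induction n) simp_all

lemma bounded_linear_funpow:
  fixes f :: "'a::real_normed_vector \<Rightarrow> 'a"
  shows "bounded_linear f \<Longrightarrow> bounded_linear (f ^^ n)"
proof (induction n)
  case 0
  have "f ^^ 0 = (\<lambda>x. x)" by (rule ext) simp
  then show ?case by (simp only: bounded_linear_ident)
next
  case (Suc n)
  have "f ^^ Suc n = (\<lambda>x. f ((f ^^ n) x))" by (rule ext) simp
  then show ?case using bounded_linear_compose[OF Suc.prems Suc.IH[OF Suc.prems]] by (simp only:)
qed

lemma summable_binomial_geometric:
  fixes r :: real
  assumes "0 \<le> r" "r < 1"
  shows "summable (\<lambda>j. real (j + k choose k) * r ^ j)"
proof -
  define c where "c = (1 + r) / 2"
  define N where "N = nat \<lceil>r * k / (c - r)\<rceil>"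
  have c: "c < 1" "c - r > 0" using assms by (auto simp: c_def)
  show ?thesis
  proof (rule summable_ratio_test[OF c(1)])
    fix j assume "j \<ge> N"
    have "r * k / (c - r) \<le> real N" unfolding N_def by (rule real_nat_ceiling_ge)
    also have "\<dots> \<le> Suc j" using \<open>j \<ge> N\<close> by simp
    finally have "r * k / (c - r) \<le> Suc j" .
    then have "r * k \<le> Suc j * (c - r)" using c by (simp add: pos_divide_le_eq)
    then have 1: "r * (Suc j + k) \<le> c * Suc j" by (simp add: algebra_simps)
    have "Suc j * (Suc j + k choose k) = (Suc j + k) * (j + k choose k)"
      using binomial_absorb_comp[of "Suc j + k" k] by simp
    then have 2: "real (Suc j) * (Suc j + k choose k) = (Suc j + k) * real (j + k choose k)"
      by (metis of_nat_mult of_nat_add)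
    have "real (Suc j) * ((Suc j + k choose k) * r ^ Suc j)
        = (real (Suc j) * (Suc j + k choose k)) * r * r ^ j" by simp
    also have "\<dots> = (r * (Suc j + k)) * ((j + k choose k) * r ^ j)" unfolding 2 by simp
    also have "\<dots> \<le> (c * Suc j) * ((j + k choose k) * r ^ j)"
      using assms by (intro mult_right_mono 1) auto
    finally have "real (Suc j) * ((Suc j + k choose k) * r ^ Suc j) \<le> real (Suc j) * (c * ((j + k choose k) * r ^ j))"
      by (simp only: mult_ac)
    then have "(Suc j + k choose k) * r ^ Suc j \<le> c * ((j + k choose k) * r ^ j)"
      by (rule mult_left_le_imp_le) simp
    then show "norm ((Suc j + k choose k) * r ^ Suc j) \<le> c * norm ((j + k choose k) * r ^ j)"
      using assms by simp
  qed
qed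

context bounded_semigroup_generator
begin

text \<open>The backward Euler operator \<open>(1 - hA)\<^sup>-\<^sup>1\<close> with step size \<open>h\<close>.\<close>

definition euler :: "real \<Rightarrow> 'a \<Rightarrow> 'a" where
  "euler h x = (1 / h) *\<^sub>R R_re (1 / h) x"

context
  fixes h :: real
  assumes h: "h > 0"
begin

lemma Re_inverse_step: "Re (complex_of_real (1 / h)) > 0" using h by simp

lemmas Re_inverse_step' = Re_inverse_step[THEN less_imp_le]

lemma euler_bounded_linear: "bounded_linear (euler h)"
  unfolding euler_def
  by (intro bounded_linear_const_scaleR R_bounded_linear Re_inverse_step')

lemma euler_scaleC: "euler h (c *\<^sub>C x) = c *\<^sub>C euler h x"
  unfolding euler_def by (simp only: R_scaleC[OF Re_inverse_step'] scaleC_scaleR_right)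

lemma R_euler_commute: "Re z \<ge> 0 \<Longrightarrow> R z (euler h x) = euler h (R z x)"
  unfolding euler_def by (simp only: R_linear_simps R_commute[OF _ Re_inverse_step'])

lemma G_euler_commute: "G (euler h x) = euler h (G x)"
  unfolding G_def by (rule R_euler_commute) simp

lemma euler_orbit_bound:
  assumes "\<And>t. t \<ge> 0 \<Longrightarrow> norm (T t x) \<le> b" "t \<ge> 0"
  shows "norm (T t (euler h x)) \<le> b"
proof -
  have "norm (T t (R_re (1 / h) x)) \<le> b / Re (complex_of_real (1 / h))"
    by (rule R_orbit_bound[OF Re_inverse_step assms])
  then show ?thesis using h assms(2) by (simp add: euler_def T_scaleR field_simps)
qed

text \<open>Power boundedness is where the orbit bound of \<open>euler_orbit_bound\<close>, rather than a norm bound, is essential.\<close>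

lemma norm_euler_pow_le: "norm ((euler h ^^ n) x) \<le> M * norm x"
proof -
  have "norm (T t ((euler h ^^ n) x)) \<le> M * norm x" if "t \<ge> 0" for t
    using that
  proof (induction n arbitrary: t)
    case 0
    then show ?case by (simp add: norm_T_le)
  next
    case (Suc n)
    then show ?case using euler_orbit_bound[of "(euler h ^^ n) x" "M * norm x" t] by simp
  qed
  from this[of 0] show ?thesis by simp
qed

lemma norm_euler_le: "norm (euler h x) \<le> M * norm x"
  using norm_euler_pow_le[of 1 x] by simp

lemma euler_G: "euler h (G x) = G x - h *\<^sub>R euler h x"
proof -
  have "G x = R_re (1 / h) x + of_real (1 / h) *\<^sub>C R_re (1 / h) (G x)"
    by (rule G_identity[OF Re_inverse_step'])
  also have "\<dots> = h *\<^sub>R euler h x + euler h (G x)"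
    using h by (simp add: euler_def scaleC_of_real del: of_real_divide)
  finally show ?thesis by (metis add_diff_cancel_left')
qed

end

lemma norm_T_G_diff_le: "t \<ge> 0 \<Longrightarrow> norm (T t (G u) - G u) \<le> M * t * norm u"
  using norm_rotated_T_diff_le[OF G_in_domain, of t 0 u] by (simp add: A_G scaleC.zero_left)

text \<open>Second order Taylor estimate for the orbit of \<open>G (G u)\<close>, whose derivative at \<open>0\<close> is \<open>-G u\<close>: the increments of the remainder at time \<open>a\<close> are of first order in \<open>a\<close>.\<close>

lemma norm_T_taylor_le:
  assumes t: "t \<ge> 0"
  shows "norm (T t (G (G u)) - G (G u) + t *\<^sub>R G u) \<le> M * t\<^sup>2 * norm u"
proof -
  let ?y = "G (G u)"
  let ?f = "\<lambda>a. T a ?y + a *\<^sub>R G u" and ?q = "\<lambda>h. norm ((T h ?y - ?y) /\<^sub>R h - A ?y)"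
  have "norm (?f t - ?f 0) \<le> t * (M * t * norm u)"
  proof (rule mean_value_from_right_increments[OF t])
    have "((\<lambda>h. M * ?q h) \<longlongrightarrow> M * norm (A ?y - A ?y)) (at_right 0)"
      by (intro tendsto_intros generator_limit G_in_domain)
    then show "((\<lambda>h. M * ?q h) \<longlongrightarrow> 0) (at_right 0)" by simp
    fix a h :: real assume a: "0 \<le> a" "a \<le> t" and h: "h > 0"
    let ?e = "T h ?y - ?y + h *\<^sub>R G u"
    have "?e = h *\<^sub>R ((T h ?y - ?y) /\<^sub>R h - A ?y)" using h by (simp add: A_G algebra_simps)
    then have e: "norm ?e = h * ?q h" using h by simp
    have eq: "?f (a + h) - ?f a = T a ?e - h *\<^sub>R (T a (G u) - G u)"
      using a h T_add[of a h ?y] by (simp add: T_linear_simps algebra_simps)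
    have "norm (?f (a + h) - ?f a) \<le> norm (T a ?e) + norm (h *\<^sub>R (T a (G u) - G u))"
      unfolding eq by (rule norm_triangle_ineq4)
    also have "\<dots> \<le> M * norm ?e + h * (M * t * norm u)"
    proof (rule add_mono)
      show "norm (T a ?e) \<le> M * norm ?e" using a by (intro norm_T_le)
      have "norm (T a (G u) - G u) \<le> M * a * norm u" using a by (intro norm_T_G_diff_le)
      also have "\<dots> \<le> M * t * norm u" using a M_pos by (intro mult_right_mono mult_left_mono) auto
      finally show "norm (h *\<^sub>R (T a (G u) - G u)) \<le> h * (M * t * norm u)" using h by simp
    qed
    finally show "norm (?f (a + h) - ?f a) \<le> h * (M * t * norm u + M * ?q h)"
      unfolding e by (simp add: algebra_simps)
  qed
  then show ?thesis by (simp add: power2_eq_square mult_ac algebra_simps)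
qed

lemma norm_T_diff_euler_le:
  assumes h: "h > 0"
  shows "norm (T h (G (G u)) - euler h (G (G u))) \<le> 2 * M * h\<^sup>2 * norm u"
proof -
  have e: "euler h (G (G u)) = G (G u) - h *\<^sub>R G u + h\<^sup>2 *\<^sub>R euler h u"
    by (simp add: euler_G[OF h] power2_eq_square algebra_simps)
  have eq: "T h (G (G u)) - euler h (G (G u)) = (T h (G (G u)) - G (G u) + h *\<^sub>R G u) - h\<^sup>2 *\<^sub>R euler h u"
    unfolding e by (simp add: algebra_simps)
  have "norm (T h (G (G u)) - euler h (G (G u))) \<le> M * h\<^sup>2 * norm u + h\<^sup>2 * (M * norm u)"
    unfolding eq
  proof (rule order_trans[OF norm_triangle_ineq4], rule add_mono)
    show "norm (h\<^sup>2 *\<^sub>R euler h u) \<le> h\<^sup>2 * (M * norm u)"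
      using norm_euler_le[OF h, of u] by (simp add: mult_left_mono)
  qed (use norm_T_taylor_le[of h u] h in simp)
  then show ?thesis by (simp add: algebra_simps)
qed

text \<open>The local error of order \<open>h\<^sup>2\<close> accumulates only linearly, because the powers of the semigroup and of the Euler operator are bounded. The hypothesis bounds the whole
Euler orbit of \<open>u\<close>, so that it passes to \<open>euler h u\<close> in the induction.\<close>

lemma norm_T_diff_euler_pow_le:
  assumes h: "h > 0" and b: "\<And>j. norm ((euler h ^^ j) u) \<le> b"
  shows "norm (T (n * h) (G (G u)) - (euler h ^^ n) (G (G u))) \<le> n * (2 * M\<^sup>2 * h\<^sup>2 * b)"
  using b
proof (induction n arbitrary: u)
  case (Suc n)
  let ?y = "G (G u)"
  have n: "real n * h \<ge> 0" using h by simp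
  have "T (Suc n * h) ?y = T (n * h) (T h ?y)"
    using T_add[of "n * h" h ?y] h by (simp add: algebra_simps)
  then have eq: "T (Suc n * h) ?y - (euler h ^^ Suc n) ?y
      = T (n * h) (T h ?y - euler h ?y) + (T (n * h) (G (G (euler h u))) - (euler h ^^ n) (G (G (euler h u))))"
    using n by (simp add: T_linear_simps G_euler_commute[OF h] funpow_Suc_right del: funpow.simps)
  have "norm (T (Suc n * h) ?y - (euler h ^^ Suc n) ?y) \<le> 2 * M\<^sup>2 * h\<^sup>2 * b + n * (2 * M\<^sup>2 * h\<^sup>2 * b)"
    unfolding eq
  proof (rule order_trans[OF norm_triangle_ineq], rule add_mono)
    have "norm (T (n * h) (T h ?y - euler h ?y)) \<le> M * (2 * M * h\<^sup>2 * norm u)"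
      using M_pos by (intro order_trans[OF norm_T_le[OF n]] mult_left_mono norm_T_diff_euler_le h) auto
    also have "\<dots> = 2 * M\<^sup>2 * h\<^sup>2 * norm u" by (simp add: power2_eq_square)
    also have "\<dots> \<le> 2 * M\<^sup>2 * h\<^sup>2 * b" using Suc.prems[of 0] by (intro mult_left_mono) auto
    finally show "norm (T (n * h) (T h ?y - euler h ?y)) \<le> 2 * M\<^sup>2 * h\<^sup>2 * b" .
    show "norm (T (n * h) (G (G (euler h u))) - (euler h ^^ n) (G (G (euler h u)))) \<le> n * (2 * M\<^sup>2 * h\<^sup>2 * b)"
    proof (rule Suc.IH)
      show "norm ((euler h ^^ j) (euler h u)) \<le> b" for j
        using Suc.prems[of "Suc j"] by (simp add: funpow_Suc_right del: funpow.simps)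
    qed
  qed
  then show ?case by (simp add: algebra_simps)
qed simp

lemma euler_pow_tendsto:
  assumes t: "t > 0"
  shows "(\<lambda>n. (euler (t / real n) ^^ n) (G (G u))) \<longlonglongrightarrow> T t (G (G u))"
proof -
  have bound: "norm ((euler (t / real n) ^^ n) (G (G u)) - T t (G (G u))) \<le> 2 * M\<^sup>2 * t\<^sup>2 * (M * norm u) / n"
    if n: "n > 0" for n :: nat
  proof -
    have h: "t / n > 0" using t n by simp
    have "norm (T (n * (t / n)) (G (G u)) - (euler (t / n) ^^ n) (G (G u))) \<le> n * (2 * M\<^sup>2 * (t / n)\<^sup>2 * (M * norm u))"
      by (rule norm_T_diff_euler_pow_le[OF h norm_euler_pow_le[OF h]])
    also have "\<dots> = 2 * M\<^sup>2 * t\<^sup>2 * (M * norm u) / n" using n by (simp add: power2_eq_square field_simps)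
    finally show ?thesis using n by (simp add: norm_minus_commute)
  qed
  have "(\<lambda>n. 2 * M\<^sup>2 * t\<^sup>2 * (M * norm u) / real n) \<longlonglongrightarrow> 0"
    by (rule tendsto_divide_0[OF tendsto_const]) (simp add: filterlim_at_top_imp_at_infinity filterlim_real_sequentially)
  then have "(\<lambda>n. (euler (t / real n) ^^ n) (G (G u)) - T t (G (G u))) \<longlonglongrightarrow> 0"
    by (rule Lim_null_comparison[rotated]) (rule eventually_mono[OF eventually_gt_at_top[of 0] bound])
  then show ?thesis by (simp add: LIM_zero_iff)
qed


section \<open>From powers of the resolvent to decay of the semigroup\<close>

context
  fixes h :: real and z :: complex
  assumes h: "h > 0" and z: "cmod z < 1"
begin

text \<open>The generating function \<open>(1 - zL)\<^sup>-\<^sup>k\<^sup>-\<^sup>1 y\<close>, where \<open>L\<close> is the Euler operator: up to the factor \<open>k!\<close>, the discrete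
counterpart of the Laplace transform of \<open>t\<^sup>k T(t) y\<close>.\<close>

definition euler_series :: "nat \<Rightarrow> 'a \<Rightarrow> 'a" where
  "euler_series k y = (\<Sum>j. (of_nat (j + k choose k) * z ^ j) *\<^sub>C (euler h ^^ j) y)"

lemma summable_euler_series:
  "summable (\<lambda>j. norm ((of_nat (j + k choose k) * z ^ j) *\<^sub>C (euler h ^^ j) y))"
proof (rule summable_comparison_test')
  show "summable (\<lambda>j. (M * norm y) * (real (j + k choose k) * cmod z ^ j))"
    using z by (intro summable_mult summable_binomial_geometric) auto
  show "norm (norm ((of_nat (j + k choose k) * z ^ j) *\<^sub>C (euler h ^^ j) y))
      \<le> (M * norm y) * (real (j + k choose k) * cmod z ^ j)" for j
    using mult_right_mono[OF norm_euler_pow_le[OF h, of j y], of "real (j + k choose k) * cmod z ^ j"]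
    by (simp add: norm_mult norm_power mult_ac)
qed

lemma euler_series_sums:
  "(\<lambda>j. (of_nat (j + k choose k) * z ^ j) *\<^sub>C (euler h ^^ j) y) sums euler_series k y"
  unfolding euler_series_def
  by (rule summable_sums[OF summable_norm_cancel[OF summable_euler_series]])

text \<open>Comparing coefficients, this is Pascal's rule.\<close>

lemma euler_series_Suc: "euler_series (Suc k) y - z *\<^sub>C euler h (euler_series (Suc k) y) = euler_series k y"
proof -
  define g where "g j = (of_nat (j + Suc k choose Suc k) * z ^ j) *\<^sub>C (euler h ^^ j) y" for j
  define g' where "g' j = (if j = 0 then 0 else z *\<^sub>C euler h (g (j - 1)))" for j
  have g: "g sums euler_series (Suc k) y" unfolding g_def by (rule euler_series_sums)
  then have "(\<lambda>j. z *\<^sub>C euler h (g j)) sums (z *\<^sub>C euler h (euler_series (Suc k) y))"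
    by (intro bounded_linear.sums[OF scaleC.bounded_linear_right] bounded_linear.sums[OF euler_bounded_linear[OF h]])
  then have "(\<lambda>j. g' (Suc j)) sums (z *\<^sub>C euler h (euler_series (Suc k) y))" by (simp add: g'_def)
  then have g': "g' sums (z *\<^sub>C euler h (euler_series (Suc k) y))"
    using sums_Suc_iff[of g'] by (simp add: g'_def)
  have "g j - g' j = (of_nat (j + k choose k) * z ^ j) *\<^sub>C (euler h ^^ j) y" for j
  proof (cases j)
    case (Suc i)
    have p: "Suc i + Suc k choose Suc k = (Suc i + k choose k) + (i + Suc k choose Suc k)"
      using binomial_Suc_Suc[of "Suc i + k" k] by simp
    have "g' j = (of_nat (i + Suc k choose Suc k) * z ^ j) *\<^sub>C (euler h ^^ j) y"
      unfolding g'_def g_def Suc by (simp add: euler_scaleC[OF h] scaleC_scaleC mult_ac)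
    then show ?thesis
      unfolding g_def Suc p by (simp only: of_nat_add distrib_right scaleC_add_left) simp
  qed (simp add: g_def g'_def)
  then have "(\<lambda>j. (of_nat (j + k choose k) * z ^ j) *\<^sub>C (euler h ^^ j) y)
      sums (euler_series (Suc k) y - z *\<^sub>C euler h (euler_series (Suc k) y))"
    using sums_diff[OF g g'] by simp
  then show ?thesis using euler_series_sums sums_unique2 by blast
qed

lemma Re_symbol_pos: "Re ((1 - z) / of_real h) > 0"
proof -
  have "Re z < 1" using z complex_Re_le_cmod[of z] by linarith
  then show ?thesis using h by simp
qed

text \<open>The symbol of the Euler scheme is a resolvent: this is the resolvent identity for the points \<open>1/h\<close> and \<open>(1 - z)/h\<close>.\<close>

lemma euler_conv_resolvent: "euler h y = (1 / h) *\<^sub>R R ((1 - z) / of_real h) (y - z *\<^sub>C euler h y)"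
proof -
  let ?w = "(1 - z) / of_real h" and ?m = "complex_of_real (1 / h)"
  have w: "Re ?w \<ge> 0" using Re_symbol_pos by simp
  have "R ?w y - R ?m y = (?m - ?w) *\<^sub>C R ?w (R ?m y)" by (rule R_identity[OF w Re_inverse_step'[OF h]])
  also have "?m - ?w = z * of_real (1 / h)" using h by (simp add: field_simps)
  also have "(z * of_real (1 / h)) *\<^sub>C R ?w (R ?m y) = R ?w (z *\<^sub>C euler h y)"
    unfolding euler_def scaleC_of_real[symmetric] scaleC_scaleC R_scaleC[OF w] ..
  finally have "R ?m y = R ?w (y - z *\<^sub>C euler h y)" by (simp add: R_linear_simps[OF w] algebra_simps)
  then show ?thesis unfolding euler_def[of h y] by simp
qed

lemma euler_pow_series:
  "(euler h ^^ k) (euler_series k y) = (1 / h) ^ k *\<^sub>R (R ((1 - z) / of_real h) ^^ k) (euler_series 0 y)"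
proof (induction k)
  case (Suc k)
  let ?w = "(1 - z) / of_real h"
  have w: "Re ?w \<ge> 0" using Re_symbol_pos by simp
  have "euler h (euler_series (Suc k) y) = (1 / h) *\<^sub>R R ?w (euler_series k y)"
    unfolding euler_series_Suc[of k y, symmetric] by (rule euler_conv_resolvent)
  then have "(euler h ^^ Suc k) (euler_series (Suc k) y) = (euler h ^^ k) ((1 / h) *\<^sub>R R ?w (euler_series k y))"
    by (simp only: funpow_Suc_right o_apply)
  also have "\<dots> = (1 / h) *\<^sub>R R ?w ((euler h ^^ k) (euler_series k y))"
    using linear_simps(5)[OF bounded_linear_funpow[OF euler_bounded_linear[OF h]]]
      funpow_commute[of "euler h" "R ?w" k] R_euler_commute[OF h w] by metis
  finally show ?case unfolding Suc.IH by (simp add: R_linear_simps[OF w])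
qed simp

end

text \<open>The sequences \<open>v\<close> and \<open>w\<close> are the coefficients, on the circle of radius \<open>r\<close>, of the generating functions of \<open>L\<^sup>j x\<close>
and \<open>(j + k choose k) L\<^sup>j\<^sup>+\<^sup>k P x\<close>. The latter is \<open>(R/h)\<^sup>k P\<close> applied to the former, so the hypothesis controls the square sum of
\<open>w\<close> by that of \<open>v\<close>. The \<open>n\<close> terms with \<open>n \<le> j < 2n\<close> all dominate the term at time \<open>2n + k\<close>, by power boundedness.\<close>

lemma norm_euler_pow_decay:
  assumes h: "h > 0" and n: "n \<ge> 1" and k: "k \<ge> 1"
    and P: "bounded_linear P" "\<And>c x. P (c *\<^sub>C x) = c *\<^sub>C P x" "\<And>z x. Re z \<ge> 0 \<Longrightarrow> P (R z x) = R z (P x)"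
    and C: "\<And>z x. Re z > 0 \<Longrightarrow> norm ((R z ^^ k) (P x)) \<le> C * norm x" "C \<ge> 0"
  shows "(n * h) ^ k * norm ((euler h ^^ (2 * n + k)) (P x)) \<le> real k ^ k * exp 2 * M\<^sup>2 * C * norm x"
proof -
  \<comment> \<open>with this radius the weights \<open>r\<^sup>2\<^sup>j\<close> are of size \<open>1\<close> up to \<open>j\<close> of order \<open>n\<close>, and their sum is exactly \<open>n + 1\<close>\<close>
  define r where "r = sqrt (n / (n + 1))"
  have r: "0 < r" "r < 1" "r\<^sup>2 = n / (n + 1)" using n by (auto simp: r_def)
  let ?L = "euler h"
  have PL: "P (?L y) = ?L (P y)" for y
    unfolding euler_def by (simp only: linear_simps(5)[OF P(1)] P(3)[OF Re_inverse_step'[OF h]])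
  define v where "v j = r ^ j *\<^sub>R (?L ^^ j) x" for j
  define w where "w j = (real (j + k choose k) * r ^ j) *\<^sub>R (?L ^^ (j + k)) (P x)" for j
  have v_norm: "norm (v j) \<le> M * norm x * r ^ j" for j
    using norm_euler_pow_le[OF h, of j x] r by (simp add: v_def mult.commute mult_left_mono)
  have sv: "summable (\<lambda>j. norm (v j))"
    by (rule summable_comparison_test'[where g = "\<lambda>j. M * norm x * r ^ j"])
       (use r v_norm in \<open>auto intro!: summable_mult summable_geometric\<close>)
  have sw: "summable (\<lambda>j. norm (w j))"
  proof (rule summable_comparison_test')
    show "summable (\<lambda>j. (M * norm (P x)) * (real (j + k choose k) * r ^ j))"
      using r by (intro summable_mult summable_binomial_geometric) auto
    show "norm (norm (w j)) \<le> (M * norm (P x)) * (real (j + k choose k) * r ^ j)" for j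
      using mult_right_mono[OF norm_euler_pow_le[OF h, of "j + k" "P x"], of "real (j + k choose k) * r ^ j"] r
      by (simp add: w_def mult_ac)
  qed
  have main: "(\<Sum>j<2 * n. (norm (w j))\<^sup>2) \<le> ((1 / h) ^ k * C)\<^sup>2 * ((M * norm x)\<^sup>2 * (n + 1))"
  proof (rule norm_power_series_le_imp_sum_norm_sq_le[OF sv sw])
    show "(1 / h) ^ k * C \<ge> 0" using h C by simp
    fix \<zeta> :: complex assume \<zeta>: "cmod \<zeta> = 1"
    define z where "z = of_real r * \<zeta>"
    have z: "cmod z < 1" using \<zeta> r by (simp add: z_def norm_mult)
    let ?w = "(1 - z) / of_real h"
    have w0: "Re ?w > 0" by (rule Re_symbol_pos[OF h z])
    have lin: "bounded_linear (?L ^^ k)" by (rule bounded_linear_funpow[OF euler_bounded_linear[OF h]])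
    have powC: "(?L ^^ k) (c *\<^sub>C y) = c *\<^sub>C (?L ^^ k) y" for c y
      using funpow_commute[of ?L "\<lambda>y. c *\<^sub>C y" k y] euler_scaleC[OF h] by blast
    have "(\<lambda>j. (?L ^^ k) ((of_nat (j + k choose k) * z ^ j) *\<^sub>C (?L ^^ j) (P x)))
        sums (?L ^^ k) (euler_series h z k (P x))"
      by (rule bounded_linear.sums[OF lin euler_series_sums[OF h z]])
    moreover have "(?L ^^ k) ((of_nat (j + k choose k) * z ^ j) *\<^sub>C (?L ^^ j) (P x)) = \<zeta> ^ j *\<^sub>C w j" for j
    proof -
      have "(?L ^^ k) ((?L ^^ j) (P x)) = (?L ^^ (j + k)) (P x)"
        by (simp add: funpow_add[symmetric, THEN fun_cong, unfolded o_apply] add.commute)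
      then show ?thesis
        unfolding powC w_def by (simp add: scaleC_of_real[symmetric] scaleC_scaleC z_def power_mult_distrib mult_ac)
    qed
    ultimately have "(\<Sum>j. \<zeta> ^ j *\<^sub>C w j) = (?L ^^ k) (euler_series h z k (P x))"
      using sums_unique[symmetric] by auto
    also have "\<dots> = (1 / h) ^ k *\<^sub>R (R ?w ^^ k) (euler_series h z 0 (P x))"
      by (rule euler_pow_series[OF h z])
    also have "euler_series h z 0 (P x) = P (euler_series h z 0 x)"
    proof -
      have "(\<lambda>j. P ((of_nat (j + 0 choose 0) * z ^ j) *\<^sub>C (?L ^^ j) x)) sums P (euler_series h z 0 x)"
        by (rule bounded_linear.sums[OF P(1) euler_series_sums[OF h z]])
      then have "(\<lambda>j. (of_nat (j + 0 choose 0) * z ^ j) *\<^sub>C (?L ^^ j) (P x)) sums P (euler_series h z 0 x)"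
        by (simp add: P(2) funpow_commute[of ?L P, OF PL[symmetric]])
      then show ?thesis using euler_series_sums[OF h z] sums_unique2 by blast
    qed
    also have "euler_series h z 0 x = (\<Sum>j. \<zeta> ^ j *\<^sub>C v j)"
      unfolding euler_series_def[OF h z] v_def
      by (simp add: scaleC_of_real[symmetric] scaleC_scaleC z_def power_mult_distrib mult_ac)
    finally have "norm (\<Sum>j. \<zeta> ^ j *\<^sub>C w j) = (1 / h) ^ k * norm ((R ?w ^^ k) (P (\<Sum>j. \<zeta> ^ j *\<^sub>C v j)))"
      using h by simp
    also have "\<dots> \<le> (1 / h) ^ k * (C * norm (\<Sum>j. \<zeta> ^ j *\<^sub>C v j))"
      using h by (intro mult_left_mono C w0) auto
    finally show "norm (\<Sum>j. \<zeta> ^ j *\<^sub>C w j) \<le> (1 / h) ^ k * C * norm (\<Sum>j. \<zeta> ^ j *\<^sub>C v j)"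
      by (simp add: mult.assoc)
  next
    fix N
    have "(norm (v j))\<^sup>2 \<le> (M * norm x)\<^sup>2 * (r\<^sup>2) ^ j" for j
      using power_mono[OF v_norm[of j], of 2] by (simp add: power_mult_distrib power_even_eq mult.commute flip: power_mult)
    then have "(\<Sum>j<N. (norm (v j))\<^sup>2) \<le> (M * norm x)\<^sup>2 * (\<Sum>j<N. (r\<^sup>2) ^ j)"
      unfolding sum_distrib_left by (intro sum_mono)
    also have "\<dots> \<le> (M * norm x)\<^sup>2 * (n + 1)"
    proof (intro mult_left_mono)
      have r2: "0 \<le> r\<^sup>2" "r\<^sup>2 < 1" using n by (auto simp: r(3))
      have "(\<Sum>j<N. (r\<^sup>2) ^ j) \<le> (\<Sum>j. (r\<^sup>2) ^ j)"
        using r2 by (intro sum_le_suminf summable_geometric) auto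
      also have "\<dots> = 1 / (1 - r\<^sup>2)" using r2 by (intro suminf_geometric) auto
      also have "\<dots> = n + 1" unfolding r(3) by (simp add: field_simps)
      finally show "(\<Sum>j<N. (r\<^sup>2) ^ j) \<le> n + 1" .
    qed simp
    finally show "(\<Sum>j<N. (norm (v j))\<^sup>2) \<le> (M * norm x)\<^sup>2 * (n + 1)" .
  qed
  define N where "N = norm ((?L ^^ (2 * n + k)) (P x))"
  have exp: "exp (-2) \<le> (r\<^sup>2) ^ (2 * n)"
  proof -
    have "1 / r\<^sup>2 = 1 + 1 / n" using n by (simp add: r(3) field_simps)
    then have "1 / r\<^sup>2 \<le> exp (1 / n)" using exp_ge_add_one_self[of "1 / n"] by simp
    then have "(1 / r\<^sup>2) ^ (2 * n) \<le> exp (1 / n) ^ (2 * n)" using r by (intro power_mono) auto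
    also have "\<dots> = exp 2" using n by (simp flip: exp_of_nat_mult)
    finally have "1 / (r\<^sup>2) ^ (2 * n) \<le> exp 2" by (simp add: power_one_over)
    then show ?thesis using r(1) by (simp add: exp_minus field_simps)
  qed
  have w_ge: "(real n / k) ^ (2 * k) * exp (-2) * (N / M)\<^sup>2 \<le> (norm (w j))\<^sup>2" if j: "j \<in> {n..<2 * n}" for j
  proof -
    have "real n / k \<le> (j + k) / k" using j k by (intro divide_right_mono) auto
    then have "(real n / k) ^ k \<le> ((j + k) / k) ^ k" by (intro power_mono) auto
    also have "\<dots> \<le> real (j + k choose k)"
      using binomial_ge_n_over_k_pow_k[of k "j + k", where 'a = real] by simp
    finally have 1: "(real n / k) ^ k \<le> real (j + k choose k)" .
    have "(r\<^sup>2) ^ (2 * n) \<le> (r\<^sup>2) ^ j" using j r by (intro power_decreasing) (auto simp: power_le_one)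
    then have 2: "exp (-2) \<le> (r ^ j)\<^sup>2" using exp by (simp add: power_mult[symmetric] mult.commute)
    have "(?L ^^ (2 * n + k)) (P x) = (?L ^^ (2 * n - j)) ((?L ^^ (j + k)) (P x))"
      using j by (simp flip: funpow_add[THEN fun_cong, unfolded o_apply])
    then have "N \<le> M * norm ((?L ^^ (j + k)) (P x))" unfolding N_def using norm_euler_pow_le[OF h] by simp
    then have 3: "N / M \<le> norm ((?L ^^ (j + k)) (P x))" using M_pos by (simp add: field_simps)
    have "(real n / k) ^ (2 * k) * exp (-2) * (N / M)\<^sup>2 = ((real n / k) ^ k)\<^sup>2 * exp (-2) * (N / M)\<^sup>2"
      by (simp add: power_mult[symmetric] mult.commute)
    also have "\<dots> \<le> (real (j + k choose k))\<^sup>2 * (r ^ j)\<^sup>2 * (norm ((?L ^^ (j + k)) (P x)))\<^sup>2"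
      using 1 2 3 M_pos by (intro mult_mono power_mono) (auto simp: N_def)
    also have "\<dots> = (norm (w j))\<^sup>2" by (simp add: w_def power_mult_distrib)
    finally show ?thesis .
  qed
  have "n * ((real n / k) ^ (2 * k) * exp (-2) * (N / M)\<^sup>2) = (\<Sum>j\<in>{n..<2 * n}. (real n / k) ^ (2 * k) * exp (-2) * (N / M)\<^sup>2)"
    by simp
  also have "\<dots> \<le> (\<Sum>j\<in>{n..<2 * n}. (norm (w j))\<^sup>2)" by (intro sum_mono w_ge)
  also have "\<dots> \<le> (\<Sum>j<2 * n. (norm (w j))\<^sup>2)" by (intro sum_mono2) auto
  also have "\<dots> \<le> ((1 / h) ^ k * C)\<^sup>2 * ((M * norm x)\<^sup>2 * (n + 1))" by (rule main)
  also have "\<dots> \<le> ((1 / h) ^ k * C)\<^sup>2 * ((M * norm x)\<^sup>2 * (2 * n))"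
    using n by (intro mult_left_mono) auto
  finally have "n * ((real n / k) ^ (2 * k) * exp (-2) * (N / M)\<^sup>2)
      \<le> n * (2 * ((1 / h) ^ k * C)\<^sup>2 * (M * norm x)\<^sup>2)" by (simp add: mult_ac)
  then have "(real n / k) ^ (2 * k) * exp (-2) * (N / M)\<^sup>2 \<le> 2 * ((1 / h) ^ k * C)\<^sup>2 * (M * norm x)\<^sup>2"
    by (rule mult_left_le_imp_le) (use n in simp)
  also have "\<dots> \<le> exp 2 * ((1 / h) ^ k * C)\<^sup>2 * (M * norm x)\<^sup>2"
    using exp_ge_add_one_self[of 2] by (intro mult_right_mono) auto
  finally have le: "(real n / k) ^ (2 * k) * exp (-2) * (N / M)\<^sup>2 \<le> exp 2 * ((1 / h) ^ k * C)\<^sup>2 * (M * norm x)\<^sup>2" .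
  have "((real n / k) ^ k * (N / M))\<^sup>2 = exp 2 * ((real n / k) ^ (2 * k) * exp (-2) * (N / M)\<^sup>2)"
    unfolding power_mult_distrib[of _ "N / M"] power_even_eq exp_minus by simp
  also have "\<dots> \<le> exp 2 * (exp 2 * ((1 / h) ^ k * C)\<^sup>2 * (M * norm x)\<^sup>2)"
    by (intro mult_left_mono le) simp
  also have "\<dots> = (exp 2 * ((1 / h) ^ k * C) * (M * norm x))\<^sup>2"
    by (simp add: power2_eq_square)
  finally have "(real n / k) ^ k * (N / M) \<le> exp 2 * ((1 / h) ^ k * C) * (M * norm x)"
    by (rule power2_le_imp_le) (use C h M_pos in auto)
  then have "(real k * h) ^ k * M * ((real n / k) ^ k * (N / M))
      \<le> (real k * h) ^ k * M * (exp 2 * ((1 / h) ^ k * C) * (M * norm x))"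
    by (rule mult_left_mono) (use h M_pos in auto)
  moreover have "(real k * h) ^ k * M * ((real n / k) ^ k * (N / M)) = (n * h) ^ k * N"
    using k M_pos by (simp add: power_mult_distrib power_divide)
  moreover have "(real k * h) ^ k * M * (exp 2 * ((1 / h) ^ k * C) * (M * norm x))
      = real k ^ k * exp 2 * M\<^sup>2 * C * norm x"
    using h by (simp add: power_mult_distrib power_divide power2_eq_square)
  ultimately show ?thesis by (simp only: N_def)
qed

text \<open>The estimate for the Euler scheme is uniform in the step size, which tends to \<open>0\<close> while the number of steps times the step
size stays equal to \<open>t\<close>. The hypothesis on the range of \<open>P\<close> puts \<open>P x\<close> where the scheme converges.\<close>

lemma semigroup_decay_of_resolvent_power_bound:
  assumes k: "k \<ge> 1" and t: "t > 0"
    and P: "bounded_linear P" "\<And>c x. P (c *\<^sub>C x) = c *\<^sub>C P x" "\<And>z x. Re z \<ge> 0 \<Longrightarrow> P (R z x) = R z (P x)"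
    and range: "\<And>x. \<exists>u. P x = G (G u)"
    and C: "\<And>z x. Re z > 0 \<Longrightarrow> norm ((R z ^^ k) (P x)) \<le> C * norm x" "C \<ge> 0"
  shows "t ^ k * norm (T t (P x)) \<le> (3 * real k) ^ k * exp 2 * M\<^sup>2 * C * norm x"
proof -
  obtain u where u: "P x = G (G u)" using range by blast
  have sub: "filterlim (\<lambda>n. 2 * n + k) sequentially sequentially"
    by (rule filterlim_subseq) (simp add: strict_mono_def)
  have "(\<lambda>n. t ^ k * norm ((euler (t / real (2 * n + k)) ^^ (2 * n + k)) (P x))) \<longlonglongrightarrow> t ^ k * norm (T t (P x))"
    unfolding u by (intro tendsto_intros tendsto_norm filterlim_compose[OF euler_pow_tendsto[OF t] sub])
  then show ?thesis
  proof (rule tendsto_upperbound)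
    show "\<forall>\<^sub>F n in sequentially. t ^ k * norm ((euler (t / real (2 * n + k)) ^^ (2 * n + k)) (P x))
        \<le> (3 * real k) ^ k * exp 2 * M\<^sup>2 * C * norm x"
      using eventually_ge_at_top[of k]
    proof eventually_elim
      case (elim n)
      define h where "h = t / real (2 * n + k)"
      have h: "h > 0" using t k by (simp add: h_def)
      have "t / 3 \<le> n * h" using t elim k by (simp add: h_def field_simps)
      then have "(t / 3) ^ k \<le> (n * h) ^ k" using t by (intro power_mono) auto
      then have "(t / 3) ^ k * norm ((euler h ^^ (2 * n + k)) (P x)) \<le> (n * h) ^ k * norm ((euler h ^^ (2 * n + k)) (P x))"
        by (rule mult_right_mono) simp
      also have "\<dots> \<le> real k ^ k * exp 2 * M\<^sup>2 * C * norm x"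
        using elim k by (intro norm_euler_pow_decay[OF h _ k P C]) auto
      finally have "3 ^ k * ((t / 3) ^ k * norm ((euler h ^^ (2 * n + k)) (P x))) \<le> 3 ^ k * (real k ^ k * exp 2 * M\<^sup>2 * C * norm x)"
        by (intro mult_left_mono) auto
      then show ?case unfolding h_def[symmetric] by (simp add: power_divide power_mult_distrib mult_ac)
    qed
  qed simp
qed

end

section \<open>From resolvent growth to decay of the semigroup on the domain\<close>

context bounded_semigroup_generator
begin

definition resolvent_growth :: "real \<Rightarrow> bool" where
  "resolvent_growth \<alpha> \<longleftrightarrow>
    (\<exists>c S. \<forall>s x. \<bar>s\<bar> \<ge> S \<longrightarrow> norm (R_im s x) \<le> c * \<bar>s\<bar> powr \<alpha> * norm x)"

text \<open>Stated pointwise, so that it makes sense for \<open>B\<close> as a mere function; \<open>onorm\<close> is only meaningful for bounded linear maps.\<close>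

definition decays_like :: "('a \<Rightarrow> 'a) \<Rightarrow> real \<Rightarrow> bool" where
  "decays_like B \<gamma> \<longleftrightarrow> (\<exists>C t0. \<forall>t x. t \<ge> t0 \<longrightarrow> norm (T t (B x)) \<le> C * t powr (- \<gamma>) * norm x)"

lemma decays_likeE:
  assumes "decays_like B \<gamma>"
  obtains C t0 where "C > 0" "t0 \<ge> 1" "\<And>t x. t \<ge> t0 \<Longrightarrow> norm (T t (B x)) \<le> C * t powr (- \<gamma>) * norm x"
proof -
  obtain C t0 where C: "\<And>t x. t \<ge> t0 \<Longrightarrow> norm (T t (B x)) \<le> C * t powr (- \<gamma>) * norm x"
    using assms unfolding decays_like_def by blast
  have "norm (T t (B x)) \<le> max C 1 * t powr (- \<gamma>) * norm x" if "t \<ge> max t0 1" for t x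
    using that by (intro order_trans[OF C] mult_right_mono) auto
  then show ?thesis by (intro that[of "max C 1" "max t0 1"]) auto
qed

lemma resolvent_growth_half_plane:
  assumes \<alpha>: "\<alpha> > 0" and "resolvent_growth \<alpha>"
  obtains C where "C \<ge> 1" "\<And>z x. Re z \<ge> 0 \<Longrightarrow> norm (R z x) \<le> C * (max 1 (cmod z)) powr \<alpha> * norm x"
proof -
  obtain c S where growth: "\<And>s x. \<bar>s\<bar> \<ge> S \<Longrightarrow> norm (R_im s x) \<le> c * \<bar>s\<bar> powr \<alpha> * norm x"
    using assms(2) unfolding resolvent_growth_def by blast
  obtain C1 where C1: "\<forall>s. - \<bar>S\<bar> \<le> s \<and> s \<le> \<bar>S\<bar> \<longrightarrow> (\<forall>x. norm (R_im s x) \<le> C1 * norm x)"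
    using R_bounded_on_segment[of "- \<bar>S\<bar>" "\<bar>S\<bar>"] by auto
  define K where "K = max 1 (max \<bar>C1\<bar> \<bar>c\<bar>)"
  have K: "K \<ge> 1" "K \<ge> C1" "K \<ge> c" by (auto simp: K_def)
  have ax: "norm (R_im s x) \<le> K * (max 1 \<bar>s\<bar>) powr \<alpha> * norm x" for s x
  proof (cases "\<bar>s\<bar> \<le> \<bar>S\<bar>")
    case True
    then have "norm (R_im s x) \<le> C1 * norm x" using C1 by (auto simp: abs_le_iff)
    also have "C1 \<le> K * 1" using K by simp
    also have "K * 1 \<le> K * (max 1 \<bar>s\<bar>) powr \<alpha>" using K \<alpha> by (intro mult_left_mono ge_one_powr_ge_zero) auto
    finally show ?thesis by (simp add: mult_right_mono)
  next
    case False
    then have "norm (R_im s x) \<le> c * \<bar>s\<bar> powr \<alpha> * norm x" by (intro growth) auto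
    also have "\<dots> \<le> K * (max 1 \<bar>s\<bar>) powr \<alpha> * norm x"
      using K \<alpha> by (intro mult_right_mono mult_mono powr_mono2) auto
    finally show ?thesis .
  qed
  have "norm (R z x) \<le> (K * (1 + M)) * (max 1 (cmod z)) powr \<alpha> * norm x" if z: "Re z \<ge> 0" for z x
  proof -
    have "norm (R (of_real (Re z) + \<i> * of_real (Im z)) x) \<le> (K * (max 1 \<bar>Im z\<bar>) powr \<alpha>) * (1 + M) * norm x"
      using K z by (intro norm_R_shift_le ax) auto
    also have "\<dots> = (K * (1 + M)) * (max 1 \<bar>Im z\<bar>) powr \<alpha> * norm x" by simp
    also have "\<dots> \<le> (K * (1 + M)) * (max 1 (cmod z)) powr \<alpha> * norm x"
      using K M_pos \<alpha> abs_Im_le_cmod[of z] by (intro mult_right_mono mult_left_mono powr_mono2) auto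
    finally show ?thesis by (simp flip: complex_eq)
  qed
  moreover have "K * (1 + M) \<ge> 1 * 1" using K M_pos by (intro mult_mono) auto
  ultimately show ?thesis using that by auto
qed

lemma norm_G_pow_le:
  assumes "g \<ge> 0" "\<And>x. norm (G x) \<le> g * norm x" shows "norm ((G ^^ n) x) \<le> g ^ n * norm x"
proof (induction n)
  case (Suc n)
  have "norm (G ((G ^^ n) x)) \<le> g * norm ((G ^^ n) x)" by (rule assms)
  also have "\<dots> \<le> g * (g ^ n * norm x)" by (intro mult_left_mono Suc assms)
  finally show ?case by (simp add: mult.assoc)
qed simp

text \<open>At a spectral point of size \<open>1\<close> the operator is of size \<open>\<bar>z\<bar>\<^sup>-\<^sup>k\<close>, and near \<open>z\<close> it is of size \<open>\<bar>z\<bar>\<close> to the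
power \<open>k\<alpha> - m\<close>; these are the two terms. The induction trades one factor \<open>G\<close> for a factor \<open>1/z\<close> by means of
\<open>G_identity\<close>.\<close>

lemma R_pow_G_pow_bound:
  assumes \<alpha>: "\<alpha> > 0" and C: "C \<ge> 0"
    and growth: "\<And>z x. Re z > 0 \<Longrightarrow> cmod z \<ge> 1 \<Longrightarrow> norm (R z x) \<le> C * cmod z powr \<alpha> * norm x"
  shows "\<exists>K\<ge>0. \<forall>z x. Re z > 0 \<and> cmod z \<ge> 1 \<longrightarrow>
    norm ((R z ^^ k) ((G ^^ m) x)) \<le> K * (cmod z powr (- real k) + cmod z powr (k * \<alpha> - m)) * norm x"
proof (induction k arbitrary: m)
  case 0
  obtain g where g: "g > 0" "\<And>x. norm (G x) \<le> g * norm x" using G_bound by blast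
  have "norm ((G ^^ m) x) \<le> g ^ m * (cmod z powr (- real 0) + cmod z powr (real 0 * \<alpha> - m)) * norm x"
    if "cmod z \<ge> 1" for z x
  proof (rule order_trans[OF norm_G_pow_le[OF _ g(2)]])
    have "g ^ m * 1 \<le> g ^ m * (cmod z powr (- real 0) + cmod z powr (real 0 * \<alpha> - m))"
      using g that by (intro mult_left_mono) auto
    then show "g ^ m * norm x \<le> g ^ m * (cmod z powr (- real 0) + cmod z powr (real 0 * \<alpha> - m)) * norm x"
      by (intro mult_right_mono) auto
  qed (use g in simp)
  then show ?case using g by (intro exI[of _ "g ^ m"]) auto
next
  case (Suc k)
  note outer = Suc.IH
  show ?case
  proof (induction m)
    case 0
    obtain K where K: "K \<ge> 0" "\<And>z x. Re z > 0 \<Longrightarrow> cmod z \<ge> 1 \<Longrightarrow>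
        norm ((R z ^^ k) x) \<le> K * (cmod z powr (- real k) + cmod z powr (k * \<alpha>)) * norm x"
      using outer[of 0] by auto
    have "norm ((R z ^^ Suc k) x) \<le> (2 * C * K) * (cmod z powr (- real (Suc k)) + cmod z powr (Suc k * \<alpha> - real 0)) * norm x"
      if z: "Re z > 0" "cmod z \<ge> 1" for z x
    proof -
      let ?a = "cmod z"
      have "norm (R z ((R z ^^ k) x)) \<le> C * ?a powr \<alpha> * (K * (?a powr (- real k) + ?a powr (k * \<alpha>)) * norm x)"
        using C by (intro order_trans[OF growth[OF z]] mult_left_mono K z) auto
      also have "\<dots> = C * K * (?a powr (\<alpha> - k) + ?a powr (Suc k * \<alpha>)) * norm x"
        using z by (simp add: powr_add[symmetric] algebra_simps)
      also have "\<dots> \<le> C * K * (?a powr (Suc k * \<alpha>) + ?a powr (Suc k * \<alpha>)) * norm x"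
        using z C K \<alpha> by (intro mult_right_mono mult_left_mono add_right_mono powr_mono) (auto simp: algebra_simps)
      also have "\<dots> = 2 * C * K * (?a powr (Suc k * \<alpha>)) * norm x" by simp
      also have "\<dots> \<le> 2 * C * K * (?a powr (- real (Suc k)) + ?a powr (Suc k * \<alpha> - real 0)) * norm x"
        using C K by (intro mult_right_mono mult_left_mono) auto
      finally show ?thesis by simp
    qed
    then show ?case using C K by (intro exI[of _ "2 * C * K"]) auto
  next
    case (Suc m)
    obtain K1 where K1: "K1 \<ge> 0" "\<And>z x. Re z > 0 \<Longrightarrow> cmod z \<ge> 1 \<Longrightarrow>
        norm ((R z ^^ k) ((G ^^ Suc m) x)) \<le> K1 * (cmod z powr (- real k) + cmod z powr (k * \<alpha> - Suc m)) * norm x"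
      using outer[of "Suc m"] by blast
    obtain K2 where K2: "K2 \<ge> 0" "\<And>z x. Re z > 0 \<Longrightarrow> cmod z \<ge> 1 \<Longrightarrow>
        norm ((R z ^^ Suc k) ((G ^^ m) x)) \<le> K2 * (cmod z powr (- real (Suc k)) + cmod z powr (Suc k * \<alpha> - m)) * norm x"
      using Suc.IH by blast
    have "norm ((R z ^^ Suc k) ((G ^^ Suc m) x))
        \<le> (K1 + K2) * (cmod z powr (- real (Suc k)) + cmod z powr (Suc k * \<alpha> - Suc m)) * norm x"
      if z: "Re z > 0" "cmod z \<ge> 1" for z x
    proof -
      let ?a = "cmod z" and ?y = "(G ^^ m) x"
      let ?E = "?a powr (- real (Suc k)) + ?a powr (Suc k * \<alpha> - Suc m)"
      have z0: "Re z \<ge> 0" using z by simp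
      have lin: "bounded_linear (R z ^^ k)" by (rule bounded_linear_funpow[OF R_bounded_linear[OF z0]])
      have "R z ((R z ^^ k) (G ?y)) = (R z ^^ k) (R z (G ?y))" by (rule funpow_swap1)
      then have "z *\<^sub>C (R z ^^ Suc k) (G ?y) = (R z ^^ k) (z *\<^sub>C R z (G ?y))"
        using funpow_commute[of "R z" "\<lambda>y. z *\<^sub>C y" k "R z (G ?y)"] by (simp add: R_scaleC[OF z0])
      also have "z *\<^sub>C R z (G ?y) = G ?y - R z ?y" using G_identity[OF z0, of ?y] by (metis add_diff_cancel_left')
      also have "(R z ^^ k) (G ?y - R z ?y) = (R z ^^ k) (G ?y) - (R z ^^ Suc k) ?y"
        by (simp add: linear_simps[OF lin] funpow_swap1[of "R z" k ?y])
      finally have "?a * norm ((R z ^^ Suc k) (G ?y)) = norm ((R z ^^ k) (G ?y) - (R z ^^ Suc k) ?y)"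
        by (metis norm_scaleC)
      also have "\<dots> \<le> norm ((R z ^^ k) (G ?y)) + norm ((R z ^^ Suc k) ?y)" by (rule norm_triangle_ineq4)
      also have "\<dots> \<le> K1 * (?a powr (- real k) + ?a powr (k * \<alpha> - Suc m)) * norm x
          + K2 * (?a powr (- real (Suc k)) + ?a powr (Suc k * \<alpha> - m)) * norm x"
        using K1(2)[OF z, of x] K2(2)[OF z, of x] by (intro add_mono) simp_all
      also have "\<dots> \<le> K1 * (?a * ?E) * norm x + K2 * (?a * ?E) * norm x"
      proof (intro add_mono mult_right_mono mult_left_mono K1 K2)
        have a: "?a * ?E = ?a powr (- real k) + ?a powr (Suc k * \<alpha> - m)"
          using z by (simp add: distrib_left powr_mult_base algebra_simps)
        have mono: "?a powr p \<le> ?a powr q" if "p \<le> q" for p q using z that by (intro powr_mono) auto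
        show "?a powr (- real k) + ?a powr (k * \<alpha> - Suc m) \<le> ?a * ?E"
          unfolding a using \<alpha> by (intro add_left_mono mono) (simp add: algebra_simps)
        show "?a powr (- real (Suc k)) + ?a powr (Suc k * \<alpha> - m) \<le> ?a * ?E"
          unfolding a by (intro add_right_mono mono) simp
      qed auto
      also have "\<dots> = ?a * ((K1 + K2) * ?E * norm x)" by (simp add: algebra_simps)
      finally have "norm ((R z ^^ Suc k) (G ?y)) \<le> (K1 + K2) * ?E * norm x"
        by (rule mult_left_le_imp_le) (use z in linarith)
      then show ?thesis by simp
    qed
    then show ?case using K1 K2 by (intro exI[of _ "K1 + K2"]) auto
  qed
qed

text \<open>The other face of the Euler operator: for fixed \<open>h\<close> it maps like \<open>G / h\<close>, so its powers gain decay at frequencies above \<open>1/h\<close>.\<close>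

lemma euler_pow_factor:
  assumes h: "h > 0"
  shows "\<exists>y. (euler h ^^ n) x = (1 / h) ^ n *\<^sub>R (G ^^ n) y \<and> norm y \<le> (1 + M) ^ n * norm x"
proof (induction n)
  case (Suc n)
  then obtain y where y: "(euler h ^^ n) x = (1 / h) ^ n *\<^sub>R (G ^^ n) y" "norm y \<le> (1 + M) ^ n * norm x" by blast
  obtain y' where y': "R (complex_of_real (1 / h)) y = G y'" "norm y' \<le> (1 + M) * norm y"
    using norm_R_positive_le_G[of "1 / h" y] h by auto
  have "(euler h ^^ Suc n) x = (1 / h) ^ n *\<^sub>R (G ^^ n) (euler h y)"
    using funpow_commute[of G "euler h" n y] G_euler_commute[OF h]
    by (simp add: y(1) linear_simps[OF euler_bounded_linear[OF h]])
  also have "\<dots> = (1 / h) ^ Suc n *\<^sub>R (G ^^ Suc n) y'"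
    unfolding euler_def y'(1)
    by (simp add: linear_simps[OF bounded_linear_funpow[OF G_bounded_linear]] funpow_swap1)
  finally have eq: "(euler h ^^ Suc n) x = (1 / h) ^ Suc n *\<^sub>R (G ^^ Suc n) y'" .
  have "norm y' \<le> (1 + M) * ((1 + M) ^ n * norm x)"
    using y'(2) y(2) M_pos by (meson add_nonneg_nonneg less_imp_le mult_left_mono order_trans zero_le_one)
  then have "norm y' \<le> (1 + M) ^ Suc n * norm x" by (simp add: mult.assoc)
  with eq show ?case by blast
qed simp

lemma norm_G_diff_euler_pow_le:
  assumes h: "h > 0"
  shows "norm (G x - (euler h ^^ n) (G x)) \<le> n * (h * M * norm x)"
proof (induction n)
  case (Suc n)
  have lin: "bounded_linear (euler h ^^ n)" by (rule bounded_linear_funpow[OF euler_bounded_linear[OF h]])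
  have "(euler h ^^ Suc n) (G x) = (euler h ^^ n) (G x) - h *\<^sub>R (euler h ^^ Suc n) x"
    by (simp only: funpow_Suc_right o_apply euler_G[OF h] linear_simps[OF lin])
  then have "G x - (euler h ^^ Suc n) (G x) = (G x - (euler h ^^ n) (G x)) + h *\<^sub>R (euler h ^^ Suc n) x"
    by (simp only: diff_diff_eq2 add_diff_eq diff_add_eq)
  then have "norm (G x - (euler h ^^ Suc n) (G x)) \<le> norm (G x - (euler h ^^ n) (G x)) + norm (h *\<^sub>R (euler h ^^ Suc n) x)"
    by (metis norm_triangle_ineq)
  also have "\<dots> \<le> n * (h * M * norm x) + h * (M * norm x)"
    using Suc norm_euler_pow_le[OF h, of "Suc n" x] h
    by (intro add_mono) (auto simp del: funpow.simps intro: mult_left_mono)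
  finally show ?case by (simp add: algebra_simps)
qed simp

text \<open>Three regimes. For \<open>\<bar>z\<bar> \<le> 1\<close> everything is bounded. For \<open>\<bar>z\<bar> \<le> 1/h\<close> the Euler factors are
bounded and one factor \<open>G\<close> suffices. For \<open>\<bar>z\<bar> \<ge> 1/h\<close> the growth of the resolvent is absorbed by the \<open>N\<close> Euler
factors: \<open>N + 1 \<ge> k\<alpha>\<close> makes the exponent of \<open>\<bar>z\<bar>\<close> nonpositive, and \<open>N \<le> k\<alpha>\<close> keeps the
contribution of bounded frequencies, of order \<open>(1/h)\<close> to the power \<open>N - k\<close>, under control.\<close>

lemma R_pow_smoothing_bound:
  assumes \<alpha>: "\<alpha> > 0" and C: "C \<ge> 1"
    and growth: "\<And>z x. Re z \<ge> 0 \<Longrightarrow> norm (R z x) \<le> C * (max 1 (cmod z)) powr \<alpha> * norm x"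
    and k: "k \<ge> 1" "k * \<alpha> \<ge> 1" and N: "real N \<le> k * \<alpha>" "k * \<alpha> \<le> real N + 1"
  obtains K where "K \<ge> 0" "\<And>h z x. 0 < h \<Longrightarrow> h \<le> 1 \<Longrightarrow> Re z > 0 \<Longrightarrow>
    norm ((R z ^^ k) ((euler h ^^ N) (G x))) \<le> K * (1 / h) powr (k * \<alpha> - 1) * norm x"
proof -
  obtain g where g: "g > 0" "\<And>x. norm (G x) \<le> g * norm x" using G_bound by blast
  have growth1: "norm (R z x) \<le> C * cmod z powr \<alpha> * norm x" if "Re z > 0" "cmod z \<ge> 1" for z x
    using growth[of z x] that by (simp add: max_def)
  have C0: "C \<ge> 0" using C by simp
  obtain K1 where K1: "K1 \<ge> 0" "\<And>z x. Re z > 0 \<Longrightarrow> cmod z \<ge> 1 \<Longrightarrow>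
      norm ((R z ^^ k) (G x)) \<le> K1 * (cmod z powr (- real k) + cmod z powr (k * \<alpha> - 1)) * norm x"
    using R_pow_G_pow_bound[OF \<alpha> C0 growth1, of k 1] by auto
  obtain K2 where K2: "K2 \<ge> 0" "\<And>z x. Re z > 0 \<Longrightarrow> cmod z \<ge> 1 \<Longrightarrow>
      norm ((R z ^^ k) ((G ^^ Suc N) x)) \<le> K2 * (cmod z powr (- real k) + cmod z powr (k * \<alpha> - Suc N)) * norm x"
    using R_pow_G_pow_bound[OF \<alpha> C0 growth1, of k "Suc N"] by auto
  define K where "K = M * C ^ k * g + 2 * M * K1 + 2 * K2 * (1 + M) ^ N"
  have parts: "0 \<le> M * C ^ k * g" "0 \<le> 2 * M * K1" "0 \<le> 2 * K2 * (1 + M) ^ N"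
    using M_pos C0 g K1 K2 by auto
  have "norm ((R z ^^ k) ((euler h ^^ N) (G x))) \<le> K * (1 / h) powr (k * \<alpha> - 1) * norm x"
    if h: "0 < h" "h \<le> 1" and z: "Re z > 0" for h z x
  proof -
    define s where "s = 1 / h"
    have s: "s \<ge> 1" using h by (simp add: s_def)
    let ?q = "s powr (k * \<alpha> - 1)"
    have q: "?q \<ge> 1" using s k by (intro ge_one_powr_ge_zero) auto
    have z0: "Re z \<ge> 0" using z by simp
    have comm: "(R z ^^ k) ((euler h ^^ N) y) = (euler h ^^ N) ((R z ^^ k) y)" for y
      by (rule funpow_commute, rule sym, rule funpow_commute, rule sym, rule R_euler_commute[OF h(1) z0])
    have enough: "norm ((R z ^^ k) ((euler h ^^ N) (G x))) \<le> c * ?q * norm x \<Longrightarrow> ?thesis" if "c \<le> K" for c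
    proof -
      have "c * ?q * norm x \<le> K * ?q * norm x" using that by (intro mult_right_mono) auto
      then show "norm ((R z ^^ k) ((euler h ^^ N) (G x))) \<le> c * ?q * norm x \<Longrightarrow> ?thesis"
        by (simp add: s_def)
    qed
    consider "cmod z \<le> 1" | "1 \<le> cmod z" "cmod z \<le> s" | "s \<le> cmod z" using s by linarith
    then show ?thesis
    proof cases
      case 1
      have pow: "norm ((R z ^^ j) y) \<le> C ^ j * norm y" for j y
      proof (induction j)
        case (Suc j)
        have "norm (R z ((R z ^^ j) y)) \<le> C * norm ((R z ^^ j) y)"
          using growth[OF z0, of "(R z ^^ j) y"] 1 by (simp add: max_def split: if_splits)
        also have "\<dots> \<le> C * (C ^ j * norm y)" by (intro mult_left_mono Suc C0)
        finally show ?case by (simp add: mult.assoc)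
      qed simp
      have "norm ((R z ^^ k) ((euler h ^^ N) (G x))) \<le> M * (C ^ k * (g * norm x))"
        unfolding comm using M_pos C0
        by (intro order_trans[OF norm_euler_pow_le[OF h(1)]] mult_left_mono order_trans[OF pow] g) auto
      also have "\<dots> \<le> (M * C ^ k * g) * ?q * norm x"
        using mult_right_mono[OF mult_left_mono[OF q parts(1)], of "norm x"] by (simp add: mult.assoc)
      finally show ?thesis by (rule enough[rotated]) (use parts in \<open>simp add: K_def\<close>)
    next
      case 2
      have "norm ((R z ^^ k) ((euler h ^^ N) (G x))) \<le> M * (K1 * (cmod z powr (- real k) + cmod z powr (k * \<alpha> - 1)) * norm x)"
        unfolding comm using M_pos by (intro order_trans[OF norm_euler_pow_le[OF h(1)]] mult_left_mono K1 z 2) auto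
      also have "\<dots> \<le> M * (K1 * (?q + ?q) * norm x)"
      proof (intro mult_left_mono mult_right_mono add_mono)
        have "cmod z powr (- real k) \<le> cmod z powr 0" using 2 by (intro powr_mono) auto
        moreover have "cmod z powr 0 = 1" using 2 by (intro powr_zero_eq_one[THEN trans]) auto
        ultimately show "cmod z powr (- real k) \<le> ?q" using q by linarith
        show "cmod z powr (k * \<alpha> - 1) \<le> ?q" using 2 k by (intro powr_mono2) auto
      qed (use M_pos K1 in auto)
      also have "\<dots> = (2 * M * K1) * ?q * norm x" by simp
      finally show ?thesis by (rule enough[rotated]) (use parts in \<open>simp add: K_def\<close>)
    next
      case 3
      obtain y where y: "(euler h ^^ N) x = s ^ N *\<^sub>R (G ^^ N) y" "norm y \<le> (1 + M) ^ N * norm x"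
        using euler_pow_factor[OF h(1), of N x] by (auto simp: s_def)
      have "(euler h ^^ N) (G x) = s ^ N *\<^sub>R (G ^^ Suc N) y"
        using funpow_commute[of "euler h" G N x] G_euler_commute[OF h(1), symmetric]
        by (simp add: y(1) G_linear_simps)
      then have "norm ((R z ^^ k) ((euler h ^^ N) (G x))) = s ^ N * norm ((R z ^^ k) ((G ^^ Suc N) y))"
        using s by (simp add: linear_simps[OF bounded_linear_funpow[OF R_bounded_linear[OF z0]]] del: funpow.simps)
      also have "\<dots> \<le> s ^ N * (K2 * (cmod z powr (- real k) + cmod z powr (k * \<alpha> - Suc N)) * norm y)"
        using s 3 by (intro mult_left_mono K2 z) auto
      also have "\<dots> \<le> s ^ N * (K2 * (s powr (- real k) + s powr (k * \<alpha> - Suc N)) * norm y)"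
        using s 3 N K2 by (intro mult_left_mono mult_right_mono add_mono powr_mono2') auto
      also have "\<dots> = K2 * (s powr (N - real k) + s powr (k * \<alpha> - 1)) * norm y"
        using s by (simp add: powr_realpow[symmetric] powr_add[symmetric] algebra_simps)
      also have "\<dots> \<le> K2 * (?q + ?q) * ((1 + M) ^ N * norm x)"
        using s k N K2 y(2) by (intro mult_mono mult_left_mono add_right_mono powr_mono) auto
      also have "\<dots> = (2 * K2 * (1 + M) ^ N) * ?q * norm x" by simp
      finally show ?thesis by (rule enough[rotated]) (use parts in \<open>simp add: K_def\<close>)
    qed
  qed
  moreover have "K \<ge> 0" using parts by (simp add: K_def)
  ultimately show ?thesis using that by blast
qed

text \<open>The truncation \<open>P\<close> of \<open>G\<close> obeys a bound with rate \<open>t\<^sup>-\<^sup>k\<close> and a constant that grows like a power of \<open>1/h\<close>; the rest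
is of order \<open>h\<close>. Choosing \<open>h\<close> as a function of \<open>t\<close> interpolates to the rate \<open>1/\<alpha>\<close>, which need not be an
integer.\<close>

theorem domain_decay_of_resolvent_growth:
  assumes \<alpha>: "\<alpha> > 0" and growth: "resolvent_growth \<alpha>"
  shows "decays_like G (1 / \<alpha>)"
proof -
  obtain C where C: "C \<ge> 1" "\<And>z x. Re z \<ge> 0 \<Longrightarrow> norm (R z x) \<le> C * (max 1 (cmod z)) powr \<alpha> * norm x"
    using resolvent_growth_half_plane[OF \<alpha> growth] by blast
  \<comment> \<open>\<open>k\<alpha> > 1\<close> strictly, so that \<open>N \<ge> 1\<close> and the truncation maps into the range of \<open>G\<^sup>2\<close>\<close>
  define k where "k = nat \<lceil>1 / \<alpha>\<rceil> + 1"
  define N where "N = nat \<lceil>k * \<alpha>\<rceil> - 1"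
  have "1 / \<alpha> < real k" using real_nat_ceiling_ge[of "1 / \<alpha>"] by (simp add: k_def)
  then have k: "k \<ge> 1" "k * \<alpha> > 1" using \<alpha> by (auto simp: k_def field_simps)
  have "\<lceil>k * \<alpha>\<rceil> \<ge> 2" using k by (simp add: le_ceiling_iff)
  then have "nat \<lceil>k * \<alpha>\<rceil> \<ge> 2" "real (nat \<lceil>k * \<alpha>\<rceil>) = of_int \<lceil>k * \<alpha>\<rceil>" by linarith+
  then have N: "N \<ge> 1" "real N = of_int \<lceil>k * \<alpha>\<rceil> - 1" by (simp_all only: N_def)
  have N': "real N \<le> k * \<alpha>" "k * \<alpha> \<le> real N + 1" using N(2) by linarith+
  obtain K where K: "K \<ge> 0" "\<And>h z x. 0 < h \<Longrightarrow> h \<le> 1 \<Longrightarrow> Re z > 0 \<Longrightarrow>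
      norm ((R z ^^ k) ((euler h ^^ N) (G x))) \<le> K * (1 / h) powr (k * \<alpha> - 1) * norm x"
    using R_pow_smoothing_bound[OF \<alpha> C k(1) less_imp_le[OF k(2)] N'] by blast
  define B where "B = (3 * real k) ^ k * exp 2 * M\<^sup>2 * K + M * N * M"
  have "norm (T t (G x)) \<le> B * t powr (- (1 / \<alpha>)) * norm x" if t: "t \<ge> 1" for t x
  proof -
    define h where "h = t powr (- (1 / \<alpha>))"
    have h: "0 < h" "h \<le> 1"
      using t \<alpha> powr_mono[of "- (1 / \<alpha>)" 0 t] by (auto simp: h_def)
    let ?P = "\<lambda>x. (euler h ^^ N) (G x)"
    have dec: "t ^ k * norm (T t (?P x)) \<le> (3 * real k) ^ k * exp 2 * M\<^sup>2 * (K * (1 / h) powr (k * \<alpha> - 1)) * norm x"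
    proof (rule semigroup_decay_of_resolvent_power_bound[where P = ?P])
      show "bounded_linear ?P"
        by (intro bounded_linear_compose[OF bounded_linear_funpow G_bounded_linear] euler_bounded_linear h)
      show "?P (c *\<^sub>C x) = c *\<^sub>C ?P x" for c x
        using funpow_commute[of "euler h" "\<lambda>y. c *\<^sub>C y" N "G x"] by (simp add: G_scaleC euler_scaleC[OF h(1)])
      show "?P (R z x) = R z (?P x)" if "Re z \<ge> 0" for z x
        using funpow_commute[of "euler h" "R z" N "G x"] that by (simp add: G_R_commute R_euler_commute[OF h(1)])
      show "\<exists>u. ?P x = G (G u)" for x
      proof -
        obtain y where y: "(euler h ^^ N) x = (1 / h) ^ N *\<^sub>R (G ^^ N) y"
          using euler_pow_factor[OF h(1), of N x] by blast
        obtain m where m: "N = Suc m" using N(1) by (cases N) auto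
        have "?P x = G ((euler h ^^ N) x)"
          by (rule funpow_commute) (simp add: G_euler_commute[OF h(1)])
        also have "\<dots> = G (G ((1 / h) ^ N *\<^sub>R (G ^^ m) y))" unfolding y by (simp add: m G_linear_simps)
        finally show ?thesis by blast
      qed
      show "norm ((R z ^^ k) (?P x)) \<le> K * (1 / h) powr (k * \<alpha> - 1) * norm x" if "Re z > 0" for z x
        by (rule K(2)[OF h that])
    qed (use k t K h in auto)
    have "(1 / h) powr (k * \<alpha> - 1) = t ^ k * h"
    proof -
      have "1 / h = t powr (1 / \<alpha>)" by (simp add: h_def powr_minus_divide)
      then have "(1 / h) powr (k * \<alpha> - 1) = t powr (1 / \<alpha> * (k * \<alpha> - 1))" by (simp only: powr_powr)
      also have "1 / \<alpha> * (k * \<alpha> - 1) = k + - (1 / \<alpha>)" using \<alpha> by (simp add: field_simps)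
      also have "t powr (k + - (1 / \<alpha>)) = t ^ k * h" unfolding powr_add h_def using t by (simp add: powr_realpow)
      finally show ?thesis .
    qed
    with dec have "t ^ k * norm (T t (?P x)) \<le> t ^ k * ((3 * real k) ^ k * exp 2 * M\<^sup>2 * K * h * norm x)"
      by (simp add: mult_ac)
    then have 1: "norm (T t (?P x)) \<le> (3 * real k) ^ k * exp 2 * M\<^sup>2 * K * h * norm x"
      by (rule mult_left_le_imp_le) (use t in simp)
    have 2: "norm (T t (G x - ?P x)) \<le> M * (N * (h * M * norm x))"
      using t M_pos by (intro order_trans[OF norm_T_le] mult_left_mono norm_G_diff_euler_pow_le h) auto
    have "norm (T t (G x)) \<le> norm (T t (?P x)) + norm (T t (G x - ?P x))"
      using norm_triangle_ineq[of "T t (?P x)" "T t (G x - ?P x)"] t by (simp add: T_linear_simps)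
    also have "\<dots> \<le> B * h * norm x" using 1 2 by (simp add: B_def algebra_simps)
    finally show ?thesis by (simp add: h_def)
  qed
  then show ?thesis unfolding decays_like_def by blast
qed

end

section \<open>The Balakrishnan integral\<close>

context bounded_semigroup_generator
begin

text \<open>Balakrishnan's integral without its normalising factor, hence \<open>(-A)\<^sup>-\<^sup>\<beta>\<close> up to a positive constant when \<open>0 < \<beta> < 1\<close>.\<close>

definition balakrishnan :: "real \<Rightarrow> 'a \<Rightarrow> 'a" where
  "balakrishnan \<beta> x = integral {0..} (\<lambda>\<tau>. \<tau> powr (-\<beta>) *\<^sub>R R_re \<tau> x)"

lemma R_positive_bound:
  obtains B where "B > 0" "\<And>\<tau> x. \<tau> \<ge> 0 \<Longrightarrow> norm (R_re \<tau> x) \<le> B * norm x"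
proof -
  obtain g where g: "g > 0" "\<And>x. norm (G x) \<le> g * norm x" using G_bound by blast
  have "norm (R_re \<tau> x) \<le> g * (1 + M) * norm x" if \<tau>: "\<tau> \<ge> 0" for \<tau> x
  proof -
    obtain y where y: "R_re \<tau> x = G y" "norm y \<le> (1 + M) * norm x"
      using norm_R_positive_le_G[OF \<tau>] by blast
    have "norm (G y) \<le> g * norm y" by (rule g)
    also have "\<dots> \<le> g * ((1 + M) * norm x)" using g y by (intro mult_left_mono) auto
    finally show ?thesis by (simp add: y mult.assoc)
  qed
  moreover have "g * (1 + M) > 0" using g M_pos by simp
  ultimately show ?thesis using that by blast
qed

lemma R_positive_continuous: "continuous_on {0..} (\<lambda>\<tau>. R_re \<tau> x)"
proof -
  obtain B where B: "B > 0" "\<And>\<tau> x. \<tau> \<ge> 0 \<Longrightarrow> norm (R_re \<tau> x) \<le> B * norm x"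
    using R_positive_bound by blast
  have "(B * (B * norm x))-lipschitz_on {0..} (\<lambda>\<tau>. R_re \<tau> x)"
  proof (rule lipschitz_onI)
    fix \<sigma> \<tau> :: real assume st: "\<sigma> \<in> {0..}" "\<tau> \<in> {0..}"
    have "R_re \<sigma> x - R_re \<tau> x
        = of_real (\<tau> - \<sigma>) *\<^sub>C R_re \<sigma> (R_re \<tau> x)"
      unfolding of_real_diff using st by (intro R_identity) auto
    then have "dist (R_re \<sigma> x) (R_re \<tau> x)
        = \<bar>\<tau> - \<sigma>\<bar> * norm (R_re \<sigma> (R_re \<tau> x))"
      unfolding dist_norm by (simp only: norm_scaleC norm_of_real)
    also have "\<dots> \<le> \<bar>\<tau> - \<sigma>\<bar> * (B * (B * norm x))"
      using st B by (intro mult_left_mono order_trans[OF B(2)]) auto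
    finally show "dist (R_re \<sigma> x) (R_re \<tau> x) \<le> B * (B * norm x) * dist \<sigma> \<tau>"
      by (simp add: dist_real_def abs_minus_commute mult.commute)
  qed (use B in simp)
  then show ?thesis by (rule lipschitz_on_continuous_on)
qed

lemma balakrishnan_integrable:
  assumes "0 < \<beta>" "\<beta> < 1"
  shows "(\<lambda>\<tau>. \<tau> powr (-\<beta>) *\<^sub>R R_re \<tau> x) integrable_on {0..}"
proof -
  obtain B where B: "B > 0" "\<And>\<tau> x. \<tau> \<ge> 0 \<Longrightarrow> norm (R_re \<tau> x) \<le> B * norm x"
    using R_positive_bound by blast
  show ?thesis
  proof (rule integral_powr_kernel_bound(1)[OF assms zero_less_one R_positive_continuous])
    show "norm (R_re \<tau> x) \<le> B * norm x" if "0 < \<tau>" for \<tau> using B(2) that by simp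
    show "norm (R_re \<tau> x) \<le> M * norm x / \<tau>" if "0 < \<tau>" for \<tau>
      using norm_R_le[of "of_real \<tau>" x] that by simp
  qed (use B M_pos in auto)
qed

lemma balakrishnan_commute:
  assumes \<beta>: "0 < \<beta>" "\<beta> < 1" and S: "bounded_linear S" "\<And>\<tau> x. \<tau> \<ge> 0 \<Longrightarrow> S (R_re \<tau> x) = R_re \<tau> (S x)"
  shows "S (balakrishnan \<beta> x) = balakrishnan \<beta> (S x)"
proof -
  have "integral {0..} (S \<circ> (\<lambda>\<tau>. \<tau> powr (-\<beta>) *\<^sub>R R_re \<tau> x)) = S (balakrishnan \<beta> x)"
    unfolding balakrishnan_def by (rule integral_linear[OF balakrishnan_integrable[OF \<beta>] S(1)])
  moreover have "integral {0..} (S \<circ> (\<lambda>\<tau>. \<tau> powr (-\<beta>) *\<^sub>R R_re \<tau> x)) = balakrishnan \<beta> (S x)"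
    unfolding balakrishnan_def
    by (rule Henstock_Kurzweil_Integration.integral_cong) (simp add: S linear_simps[OF S(1)])
  ultimately show ?thesis by simp
qed

text \<open>The operator \<open>S\<close> is applied under the integral, where it may improve on the bound \<open>O(1/\<tau>)\<close> of the resolvent for small \<open>\<tau>\<close>.\<close>

lemma balakrishnan_bound:
  fixes S :: "'a \<Rightarrow> 'a"
  assumes \<beta>: "0 < \<beta>" "\<beta> < 1" and \<delta>: "\<delta> > 0" and S: "bounded_linear S"
    and a: "a \<ge> 0" "\<And>\<tau> x. \<tau> > 0 \<Longrightarrow> norm (S (R_re \<tau> x)) \<le> a * norm x"
    and b: "b \<ge> 0" "\<And>\<tau> x. \<tau> > 0 \<Longrightarrow> norm (S (R_re \<tau> x)) \<le> b / \<tau> * norm x"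
  shows "norm (S (balakrishnan \<beta> x)) \<le> (a * \<delta> powr (1 - \<beta>) / (1 - \<beta>) + b * \<delta> powr (-\<beta>) / \<beta>) * norm x"
proof -
  have "S (balakrishnan \<beta> x) = integral {0..} (S \<circ> (\<lambda>\<tau>. \<tau> powr (-\<beta>) *\<^sub>R R_re \<tau> x))"
    unfolding balakrishnan_def by (rule integral_linear[OF balakrishnan_integrable[OF \<beta>] S, symmetric])
  also have "\<dots> = integral {0..} (\<lambda>\<tau>. \<tau> powr (-\<beta>) *\<^sub>R S (R_re \<tau> x))"
    by (simp add: o_def linear_simps[OF S])
  also have "norm \<dots> \<le> (a * norm x) * \<delta> powr (1 - \<beta>) / (1 - \<beta>) + (b * norm x) * \<delta> powr (-\<beta>) / \<beta>"
    using a b by (intro integral_powr_kernel_bound(2) \<beta> \<delta> bounded_linear.continuous_on[OF S] R_positive_continuous) auto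
  finally show ?thesis by (simp add: field_simps)
qed

lemma balakrishnan_bounded_linear:
  assumes \<beta>: "0 < \<beta>" "\<beta> < 1"
  shows "bounded_linear (balakrishnan \<beta>)"
proof -
  obtain B where B: "B > 0" "\<And>\<tau> x. \<tau> \<ge> 0 \<Longrightarrow> norm (R_re \<tau> x) \<le> B * norm x"
    using R_positive_bound by blast
  show ?thesis
  proof (rule bounded_linear_intro)
    show "balakrishnan \<beta> (x + y) = balakrishnan \<beta> x + balakrishnan \<beta> y" for x y
    proof -
      have "balakrishnan \<beta> (x + y) = integral {0..} (\<lambda>\<tau>. \<tau> powr (-\<beta>) *\<^sub>R R_re \<tau> x + \<tau> powr (-\<beta>) *\<^sub>R R_re \<tau> y)"
        unfolding balakrishnan_def
        by (rule Henstock_Kurzweil_Integration.integral_cong) (simp add: R_linear_simps scaleR_add_right)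
      then show ?thesis unfolding balakrishnan_def
        by (simp only: Henstock_Kurzweil_Integration.integral_add[OF balakrishnan_integrable[OF \<beta>] balakrishnan_integrable[OF \<beta>]])
    qed
    show "balakrishnan \<beta> (r *\<^sub>R x) = r *\<^sub>R balakrishnan \<beta> x" for r x
      by (rule balakrishnan_commute[OF \<beta>, symmetric]) (auto simp: bounded_linear_scaleR_right R_linear_simps)
    show "norm (balakrishnan \<beta> x) \<le> norm x * (B * 1 powr (1 - \<beta>) / (1 - \<beta>) + M * 1 powr (-\<beta>) / \<beta>)" for x
    proof -
      have "norm (balakrishnan \<beta> x) \<le> (B * 1 powr (1 - \<beta>) / (1 - \<beta>) + M * 1 powr (-\<beta>) / \<beta>) * norm x"
      proof (rule balakrishnan_bound[OF \<beta> zero_less_one bounded_linear_ident])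
        show "norm (R_re \<tau> x) \<le> M / \<tau> * norm x" if "\<tau> > 0" for \<tau> x
          using norm_R_le[of "of_real \<tau>" x] that by simp
      qed (use B M_pos in auto)
      then show ?thesis by (simp only: mult.commute)
    qed
  qed
qed

abbreviation frac_power :: "real \<Rightarrow> 'a \<Rightarrow> 'a" where
  "frac_power \<equiv> neg_frac_power D (\<lambda>x. - A x)"

definition frac_part :: "real \<Rightarrow> 'a \<Rightarrow> 'a" where
  "frac_part \<beta> x = (if \<beta> = 0 then x else (sin (pi * \<beta>) / pi) *\<^sub>R balakrishnan \<beta> x)"

lemma frac_power_eq: "frac_power \<alpha> x = (G ^^ nat \<lfloor>\<alpha>\<rfloor>) (frac_part (frac \<alpha>) x)"
proof -
  have "inv_into D (\<lambda>x. - A x) = G" by (simp add: G_def resolvent_def scaleC.zero_left)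
  moreover have "inv_into D (\<lambda>y. \<tau> *\<^sub>R y + - A y) = R_re \<tau>" for \<tau>
    by (simp add: resolvent_def scaleC_of_real)
  ultimately show ?thesis
    by (simp add: neg_frac_power_def frac_part_def balakrishnan_def)
qed

lemma sin_frac_pos: "0 < \<beta> \<Longrightarrow> \<beta> < 1 \<Longrightarrow> sin (pi * \<beta>) / pi > 0"
  by (simp add: sin_gt_zero)

lemma frac_part_bounded_linear:
  assumes "0 \<le> \<beta>" "\<beta> < 1" shows "bounded_linear (frac_part \<beta>)"
proof (cases "\<beta> = 0")
  case False
  then have "bounded_linear (\<lambda>x. (sin (pi * \<beta>) / pi) *\<^sub>R balakrishnan \<beta> x)"
    using assms by (intro bounded_linear_const_scaleR balakrishnan_bounded_linear) auto
  moreover have "frac_part \<beta> = (\<lambda>x. (sin (pi * \<beta>) / pi) *\<^sub>R balakrishnan \<beta> x)"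
    using False by (auto simp: frac_part_def)
  ultimately show ?thesis by simp
qed (simp add: frac_part_def[abs_def] bounded_linear_ident)

lemma frac_part_commute:
  assumes \<beta>: "0 \<le> \<beta>" "\<beta> < 1" and S: "bounded_linear S" "\<And>\<tau> x. \<tau> \<ge> 0 \<Longrightarrow> S (R_re \<tau> x) = R_re \<tau> (S x)"
  shows "S (frac_part \<beta> x) = frac_part \<beta> (S x)"
  using balakrishnan_commute[OF _ \<beta>(2) S, of x] \<beta> by (simp add: frac_part_def linear_simps[OF S(1)])

lemma frac_power_bounded_linear: "bounded_linear (frac_power \<alpha>)"
  unfolding frac_power_eq[abs_def]
  by (intro bounded_linear_compose[OF bounded_linear_funpow[OF G_bounded_linear]] frac_part_bounded_linear)
     (simp_all add: frac_ge_0 frac_lt_1)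

lemma frac_power_T: assumes "t \<ge> 0" shows "frac_power \<alpha> (T t x) = T t (frac_power \<alpha> x)"
proof -
  have "frac_part (frac \<alpha>) (T t x) = T t (frac_part (frac \<alpha>) x)"
    using assms by (intro frac_part_commute[symmetric] T_bounded_linear) (auto simp: frac_ge_0 frac_lt_1 R_T_commute)
  moreover have "(G ^^ n) (T t y) = T t ((G ^^ n) y)" for n y
    by (rule funpow_commute) (rule G_T_commute[OF assms])
  ultimately show ?thesis by (simp add: frac_power_eq)
qed


section \<open>From decay on the domain to decay on the range of the fractional power\<close>

text \<open>Under the integral, \<open>T(t) R(\<tau>)\<close> is bounded by \<open>M\<^sup>2 / \<tau>\<close> and, since \<open>R(\<tau>)\<close> factors through \<open>G\<close>, by a
multiple of \<open>t\<close> to the power \<open>-1/\<alpha>\<close>. Up to constants, the two agree at the threshold \<open>\<delta>\<close>.\<close>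

lemma norm_T_frac_part_le:
  assumes \<alpha>: "\<alpha> > 0" and \<beta>: "0 \<le> \<beta>" "\<beta> < 1" and C: "C \<ge> 0" and t0: "t0 \<ge> 1"
    and decay: "\<And>t x. t \<ge> t0 \<Longrightarrow> norm (T t (G x)) \<le> C * t powr (- (1 / \<alpha>)) * norm x"
  obtains K where "K \<ge> 0" "\<And>t x. t \<ge> t0 \<Longrightarrow> norm (T t (frac_part \<beta> x)) \<le> K * t powr (- (\<beta> / \<alpha>)) * norm x"
proof (cases "\<beta> = 0")
  case True
  then show ?thesis using that[of M] norm_T_le M_pos t0 by (simp add: frac_part_def)
next
  case False
  then have \<beta>0: "0 < \<beta>" using \<beta> by simp
  define c where "c = sin (pi * \<beta>) / pi"
  have c: "c > 0" unfolding c_def by (rule sin_frac_pos[OF \<beta>0 \<beta>(2)])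
  define K where "K = c * (C * (1 + M) / (1 - \<beta>) + M * M / \<beta>)"
  have "norm (T t (frac_part \<beta> x)) \<le> K * t powr (- (\<beta> / \<alpha>)) * norm x" if t: "t \<ge> t0" for t x
  proof -
    have t1: "t \<ge> 0" "t \<noteq> 0" using t t0 by auto
    define \<delta> where "\<delta> = t powr (1 / \<alpha>)"
    have \<delta>: "\<delta> > 0" using t1 by (simp add: \<delta>_def)
    have "norm (T t (balakrishnan \<beta> x)) \<le> ((C * t powr (- (1 / \<alpha>)) * (1 + M)) * \<delta> powr (1 - \<beta>) / (1 - \<beta>)
        + (M * M) * \<delta> powr (-\<beta>) / \<beta>) * norm x"
    proof (rule balakrishnan_bound[OF \<beta>0 \<beta>(2) \<delta> T_bounded_linear[OF t1(1)]])
      fix \<tau> :: real and x assume \<tau>: "\<tau> > 0"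
      obtain y where y: "R_re \<tau> x = G y" "norm y \<le> (1 + M) * norm x"
        using norm_R_positive_le_G[of \<tau> x] \<tau> by auto
      have "norm (T t (G y)) \<le> C * t powr (- (1 / \<alpha>)) * norm y" by (rule decay[OF t])
      also have "\<dots> \<le> C * t powr (- (1 / \<alpha>)) * ((1 + M) * norm x)" using y C by (intro mult_left_mono) auto
      finally show "norm (T t (R_re \<tau> x)) \<le> C * t powr (- (1 / \<alpha>)) * (1 + M) * norm x"
        by (simp add: y mult.assoc)
      have "norm (T t (R_re \<tau> x)) \<le> M * (M / Re (complex_of_real \<tau>) * norm x)"
        using M_pos \<tau> t1 by (intro order_trans[OF norm_T_le] mult_left_mono norm_R_le) auto
      then show "norm (T t (R_re \<tau> x)) \<le> M * M / \<tau> * norm x" by simp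
    qed (use C M_pos in auto)
    also have "t powr (- (1 / \<alpha>)) = inverse \<delta>" by (simp add: \<delta>_def powr_minus)
    also have "(C * inverse \<delta> * (1 + M)) * \<delta> powr (1 - \<beta>) = C * (1 + M) * \<delta> powr (-\<beta>)"
      using \<delta> by (simp add: powr_diff powr_minus field_simps)
    also have "\<delta> powr (-\<beta>) = t powr (- (\<beta> / \<alpha>))" by (simp add: \<delta>_def powr_powr)
    finally have "c * norm (T t (balakrishnan \<beta> x)) \<le> c * ((C * (1 + M) * t powr (- (\<beta> / \<alpha>)) / (1 - \<beta>)
        + M * M * t powr (- (\<beta> / \<alpha>)) / \<beta>) * norm x)"
      using c by (intro mult_left_mono) auto
    also have "\<dots> = K * t powr (- (\<beta> / \<alpha>)) * norm x" by (simp add: K_def algebra_simps add_divide_distrib)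
    finally show ?thesis
      using False c t1 by (simp add: frac_part_def c_def[symmetric] T_linear_simps)
  qed
  moreover have "K \<ge> 0" using c C M_pos \<beta> \<beta>0 by (simp add: K_def)
  ultimately show ?thesis using that by blast
qed

lemma norm_T_G_pow_le:
  fixes t C :: real
  assumes C: "C \<ge> 0" and t: "t \<ge> 0" and decay: "\<And>x. norm (T t (G x)) \<le> C * norm x"
  shows "norm (T (n * t) ((G ^^ n) x)) \<le> C ^ n * norm x"
proof (induction n)
  case (Suc n)
  have "T (Suc n * t) ((G ^^ Suc n) x) = T t (G (T (n * t) ((G ^^ n) x)))"
    using T_add[of t "n * t" "(G ^^ Suc n) x"] t by (simp add: algebra_simps G_T_commute)
  also have "norm \<dots> \<le> C * norm (T (n * t) ((G ^^ n) x))" by (rule decay)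
  also have "\<dots> \<le> C * (C ^ n * norm x)" by (intro mult_left_mono Suc C)
  finally show ?case by (simp add: mult.assoc)
qed simp

text \<open>The time is split into \<open>n\<close> parts for the \<open>n\<close> factors \<open>G\<close> and one part for the fractional factor; the exponents add up to \<open>(n + \<beta>)/\<alpha> = 1\<close>.\<close>

theorem frac_power_decay_of_domain_decay:
  assumes \<alpha>: "\<alpha> > 0" and "decays_like G (1 / \<alpha>)"
  shows "decays_like (frac_power \<alpha>) 1"
proof -
  obtain C t0 where C: "C > 0" and t0: "t0 \<ge> 1"
    and decay: "\<And>t x. t \<ge> t0 \<Longrightarrow> norm (T t (G x)) \<le> C * t powr (- (1 / \<alpha>)) * norm x"
    using decays_likeE[OF assms(2)] by blast
  define n where "n = nat \<lfloor>\<alpha>\<rfloor>"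
  define \<beta> where "\<beta> = frac \<alpha>"
  have \<beta>: "0 \<le> \<beta>" "\<beta> < 1" by (auto simp: \<beta>_def frac_ge_0 frac_lt_1)
  have sum: "n + \<beta> = \<alpha>" using \<alpha> by (simp add: n_def \<beta>_def frac_def)
  obtain K where K: "K \<ge> 0" "\<And>t x. t \<ge> t0 \<Longrightarrow> norm (T t (frac_part \<beta> x)) \<le> K * t powr (- (\<beta> / \<alpha>)) * norm x"
    using norm_T_frac_part_le[OF \<alpha> \<beta> less_imp_le[OF C] t0 decay] by blast
  have main: "norm (T (Suc n * t) (frac_power \<alpha> x)) \<le> C ^ n * K * t powr (- 1) * norm x" if t: "t \<ge> t0" for t :: real and x
  proof -
    have t1: "t \<ge> 0" "n * t \<ge> 0" "t \<noteq> 0" using t t0 by auto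
    have "T (Suc n * t) (frac_power \<alpha> x) = T (n * t) (T t ((G ^^ n) (frac_part \<beta> x)))"
      using T_add[of "n * t" t "frac_power \<alpha> x"] t1 by (simp add: algebra_simps frac_power_eq n_def \<beta>_def)
    also have "T t ((G ^^ n) (frac_part \<beta> x)) = (G ^^ n) (T t (frac_part \<beta> x))"
      by (rule funpow_commute[symmetric]) (rule G_T_commute[OF t1(1)])
    also have "norm (T (n * t) ((G ^^ n) (T t (frac_part \<beta> x)))) \<le> (C * t powr (- (1 / \<alpha>))) ^ n * norm (T t (frac_part \<beta> x))"
      by (rule norm_T_G_pow_le) (use C t t1 decay in auto)
    also have "\<dots> \<le> (C * t powr (- (1 / \<alpha>))) ^ n * (K * t powr (- (\<beta> / \<alpha>)) * norm x)"
      using C by (intro mult_left_mono K t) auto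
    also have "\<dots> = C ^ n * K * ((t powr (- (1 / \<alpha>))) ^ n * t powr (- (\<beta> / \<alpha>))) * norm x"
      by (simp add: power_mult_distrib)
    also have "(t powr (- (1 / \<alpha>))) ^ n * t powr (- (\<beta> / \<alpha>)) = t powr (n * (- (1 / \<alpha>)) + (- (\<beta> / \<alpha>)))"
    proof -
      have "(t powr (- (1 / \<alpha>))) ^ n = t powr (n * (- (1 / \<alpha>)))"
        using t1 by (simp add: powr_powr mult.commute flip: powr_realpow)
      then show ?thesis by (simp only: powr_add)
    qed
    also have "n * (- (1 / \<alpha>)) + (- (\<beta> / \<alpha>)) = - 1"
    proof -
      have "n * (- (1 / \<alpha>)) + (- (\<beta> / \<alpha>)) = - ((n + \<beta>) / \<alpha>)" by (simp add: add_divide_distrib)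
      then show ?thesis using \<alpha> by (simp add: sum)
    qed
    finally show ?thesis .
  qed
  have "norm (T t (frac_power \<alpha> x)) \<le> (C ^ n * K * Suc n) * t powr (- 1) * norm x"
    if t: "t \<ge> Suc n * t0" for t :: real and x
  proof -
    have "t > 0" using t t0 by (smt (verit, best) mult_le_cancel_left1 of_nat_0_less_iff zero_less_Suc of_nat_Suc)
    have "t / Suc n \<ge> t0" using t by (simp add: pos_le_divide_eq mult.commute)
    from main[OF this, of x] \<open>t > 0\<close> show ?thesis by (simp add: powr_minus_divide mult_ac)
  qed
  then show ?thesis unfolding decays_like_def by blast
qed

end

section \<open>From decay on the range of the fractional power to resolvent growth\<close>

text \<open>This is the fractional integral for the number \<open>-is\<close> in place of \<open>-A\<close>. For the lower bound, its imaginary part, whose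
integrand has constant sign, is integrated over \<open>{0..\<bar>s\<bar>}\<close> only.\<close>

lemma scalar_balakrishnan:
  fixes s :: real
  assumes \<beta>: "0 < \<beta>" "\<beta> < 1" and s: "s \<noteq> 0"
  shows "(\<lambda>\<tau>. \<tau> powr (-\<beta>) *\<^sub>R (1 / (of_real \<tau> - \<i> * s))) integrable_on {0..}" (is "?f integrable_on _")
    and "cmod (integral {0..} (\<lambda>\<tau>. \<tau> powr (-\<beta>) *\<^sub>R (1 / (of_real \<tau> - \<i> * s))))
      \<ge> \<bar>s\<bar> powr (-\<beta>) / (2 * (1 - \<beta>))"
proof -
  have ne: "of_real \<tau> - \<i> * s \<noteq> 0" for \<tau> using s by (auto simp: complex_eq_iff)
  have ge: "\<bar>s\<bar> \<le> cmod (of_real \<tau> - \<i> * s)" "\<bar>\<tau>\<bar> \<le> cmod (of_real \<tau> - \<i> * s)" for \<tau>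
    using abs_Im_le_cmod[of "of_real \<tau> - \<i> * s"] abs_Re_le_cmod[of "of_real \<tau> - \<i> * s"] by auto
  show int: "?f integrable_on {0..}"
  proof (rule integral_powr_kernel_bound(1)[OF \<beta> zero_less_one])
    show "continuous_on {0..} (\<lambda>\<tau>. 1 / (of_real \<tau> - \<i> * s))"
      using ne by (intro continuous_intros) auto
    show "norm (1 / (of_real \<tau> - \<i> * s)) \<le> 1 / \<bar>s\<bar>" for \<tau>
      using s ge(1)[of \<tau>] by (simp add: norm_divide frac_le)
    show "norm (1 / (of_real \<tau> - \<i> * s)) \<le> 1 / \<tau>" if "0 < \<tau>" for \<tau>
      using ge(2)[of \<tau>] that by (simp add: norm_divide frac_le)
  qed auto
  define \<phi> where "\<phi> \<tau> = \<bar>s\<bar> * \<tau> powr (-\<beta>) / (\<tau>\<^sup>2 + s\<^sup>2)" for \<tau>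
  have \<phi>: "\<phi> \<tau> = sgn s * Im (?f \<tau>)" for \<tau>
    by (simp add: \<phi>_def Im_divide power2_eq_square abs_sgn mult_ac)
  have "((\<lambda>\<tau>. sgn s * Im (?f \<tau>)) has_integral sgn s * Im (integral {0..} ?f)) {0..}"
    by (intro has_integral_mult_right has_integral_linear[OF integrable_integral[OF int] bounded_linear_Im, unfolded o_def])
  then have 1: "(\<phi> has_integral sgn s * Im (integral {0..} ?f)) {0..}" by (simp only: \<phi>[abs_def])
  define \<psi> where "\<psi> \<tau> = (if \<tau> \<in> {0..\<bar>s\<bar>} then 1 / (2 * \<bar>s\<bar>) * \<tau> powr (-\<beta>) else 0)" for \<tau>
  have "((\<lambda>\<tau>. 1 / (2 * \<bar>s\<bar>) * \<tau> powr (-\<beta>)) has_integral 1 / (2 * \<bar>s\<bar>) * (\<bar>s\<bar> powr (-\<beta> + 1) / (-\<beta> + 1))) {0..\<bar>s\<bar>}"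
    using \<beta> by (intro has_integral_mult_right has_integral_powr_from_0) auto
  then have 2: "(\<psi> has_integral 1 / (2 * \<bar>s\<bar>) * (\<bar>s\<bar> powr (-\<beta> + 1) / (-\<beta> + 1))) {0..}"
    unfolding \<psi>_def by (subst has_integral_restrict) auto
  have "1 / (2 * \<bar>s\<bar>) * (\<bar>s\<bar> powr (-\<beta> + 1) / (-\<beta> + 1)) \<le> sgn s * Im (integral {0..} ?f)"
  proof (rule has_integral_le[OF 2 1])
    fix \<tau> :: real assume "\<tau> \<in> {0..}"
    show "\<psi> \<tau> \<le> \<phi> \<tau>"
    proof (cases "\<tau> \<in> {0..\<bar>s\<bar>}")
      case True
      then have "\<tau>\<^sup>2 \<le> s\<^sup>2" using power_mono[of \<tau> "\<bar>s\<bar>" 2] by simp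
      then have "\<tau>\<^sup>2 + s\<^sup>2 \<le> 2 * \<bar>s\<bar> * \<bar>s\<bar>" by (simp add: power2_eq_square flip: abs_mult)
      moreover have "\<tau>\<^sup>2 + s\<^sup>2 > 0" using s by (simp add: add_nonneg_pos)
      ultimately have "1 / (2 * \<bar>s\<bar>) \<le> \<bar>s\<bar> / (\<tau>\<^sup>2 + s\<^sup>2)" using s by (simp add: field_simps)
      then have "1 / (2 * \<bar>s\<bar>) * \<tau> powr (-\<beta>) \<le> \<bar>s\<bar> / (\<tau>\<^sup>2 + s\<^sup>2) * \<tau> powr (-\<beta>)" by (rule mult_right_mono) simp
      then show ?thesis using True by (simp add: \<psi>_def \<phi>_def)
    qed (auto simp: \<psi>_def \<phi>_def)
  qed
  also have "\<dots> \<le> \<bar>Im (integral {0..} ?f)\<bar>" by (simp add: sgn_if abs_if)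
  also have "\<dots> \<le> cmod (integral {0..} ?f)" by (rule abs_Im_le_cmod)
  finally have le: "1 / (2 * \<bar>s\<bar>) * (\<bar>s\<bar> powr (-\<beta> + 1) / (-\<beta> + 1)) \<le> cmod (integral {0..} ?f)" .
  show "cmod (integral {0..} ?f) \<ge> \<bar>s\<bar> powr (-\<beta>) / (2 * (1 - \<beta>))"
  proof -
    have "\<bar>s\<bar> powr (-\<beta> + 1) = \<bar>s\<bar> powr (-\<beta>) * \<bar>s\<bar>" using s by (simp only: powr_add) simp
    then have "1 / (2 * \<bar>s\<bar>) * (\<bar>s\<bar> powr (-\<beta> + 1) / (-\<beta> + 1)) = \<bar>s\<bar> powr (-\<beta>) / (2 * (1 - \<beta>))"
      using s by simp
    with le show ?thesis by (simp only:)
  qed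
qed

context bounded_semigroup_generator
begin

text \<open>With \<open>y = R(is)x\<close> the resolvent identity gives \<open>y/(\<tau> - is) - R(\<tau>)y = R(\<tau>)x/(\<tau> - is)\<close>. Integrated against
\<open>\<tau>\<close> to the power \<open>-\<beta>\<close>, it compares the scalar fractional power of \<open>-is\<close> with that of \<open>-A\<close>, with an error
controlled by \<open>\<parallel>x\<parallel>\<close>.\<close>

lemma norm_le_frac_part:
  assumes \<beta>: "0 \<le> \<beta>" "\<beta> < 1"
  obtains C where "C > 0" "\<And>s x. \<bar>s\<bar> \<ge> 1 \<Longrightarrow> norm (R_im s x)
    \<le> C * \<bar>s\<bar> powr \<beta> * (norm (frac_part \<beta> (R_im s x)) + norm x)"
proof (cases "\<beta> = 0")
  case True
  have "norm (R_im s x)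
      \<le> 1 * \<bar>s\<bar> powr \<beta> * (norm (frac_part \<beta> (R_im s x)) + norm x)" if "\<bar>s\<bar> \<ge> 1" for s x
    using True that by (auto simp: frac_part_def)
  then show ?thesis by (intro that[of 1]) auto
next
  case False
  then have \<beta>0: "0 < \<beta>" using \<beta> by simp
  define c where "c = sin (pi * \<beta>) / pi"
  have c: "c > 0" unfolding c_def by (rule sin_frac_pos[OF \<beta>0 \<beta>(2)])
  obtain B where B: "B > 0" "\<And>\<tau> x. \<tau> \<ge> 0 \<Longrightarrow> norm (R_re \<tau> x) \<le> B * norm x"
    using R_positive_bound by blast
  define K where "K = B / (1 - \<beta>) + M / \<beta>"
  have K: "K \<ge> 0" using B M_pos \<beta> \<beta>0 by (simp add: K_def)
  define C where "C = 2 * (1 - \<beta>) * (1 / c + K)"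
  have "norm (R_im s x)
      \<le> C * \<bar>s\<bar> powr \<beta> * (norm (frac_part \<beta> (R_im s x)) + norm x)" if s: "\<bar>s\<bar> \<ge> 1" for s x
  proof -
    define y where "y = R_im s x"
    have s0: "s \<noteq> 0" using s by auto
    let ?d = "\<lambda>\<tau>. of_real \<tau> - \<i> * s"
    let ?f = "\<lambda>\<tau>. \<tau> powr (-\<beta>) *\<^sub>R (1 / ?d \<tau>)"
    let ?e = "\<lambda>\<tau>. \<tau> powr (-\<beta>) *\<^sub>R ((1 / ?d \<tau>) *\<^sub>C R_re \<tau> x)"
    have ne: "?d \<tau> \<noteq> 0" for \<tau> using s0 by (auto simp: complex_eq_iff)
    have f_le: "cmod (1 / ?d \<tau>) \<le> 1" for \<tau>
      using abs_Im_le_cmod[of "?d \<tau>"] s by (simp add: norm_divide divide_simps)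
    have e_bound: "norm (integral {0..} ?e) \<le> (B * norm x) * 1 powr (1 - \<beta>) / (1 - \<beta>) + (M * norm x) * 1 powr (-\<beta>) / \<beta>"
    proof (rule integral_powr_kernel_bound(2)[OF \<beta>0 \<beta>(2) zero_less_one])
      show "continuous_on {0..} (\<lambda>\<tau>. (1 / ?d \<tau>) *\<^sub>C R_re \<tau> x)" using ne
        by (intro scaleC.continuous_on R_positive_continuous continuous_intros) auto
      show "norm ((1 / ?d \<tau>) *\<^sub>C R_re \<tau> x) \<le> B * norm x" if "0 < \<tau>" for \<tau>
        using mult_mono[OF f_le[of \<tau>] B(2)[of \<tau> x]] that by simp
      show "norm ((1 / ?d \<tau>) *\<^sub>C R_re \<tau> x) \<le> M * norm x / \<tau>" if "0 < \<tau>" for \<tau>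
        using mult_mono[OF f_le[of \<tau>] norm_R_le[of "of_real \<tau>" x]] that by simp
    qed (use B M_pos in auto)
    have e_eq: "?e \<tau> = ?f \<tau> *\<^sub>C y - \<tau> powr (-\<beta>) *\<^sub>R R_re \<tau> y" if "\<tau> \<in> {0..}" for \<tau>
    proof -
      have r: "Re (\<i> * complex_of_real s) \<ge> 0" "Re (complex_of_real \<tau>) \<ge> 0" using that by auto
      have "y - R_re \<tau> x = ?d \<tau> *\<^sub>C R_re \<tau> y"
        unfolding y_def R_commute[OF r(2,1)] by (rule R_identity[OF r])
      then have "R_re \<tau> x = y - ?d \<tau> *\<^sub>C R_re \<tau> y"
        by (metis diff_diff_eq2 add_diff_cancel_left' diff_add_cancel)
      moreover have "(1 / ?d \<tau>) *\<^sub>C ?d \<tau> *\<^sub>C R_re \<tau> y = R_re \<tau> y"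
        using ne[of \<tau>] by (auto simp: scaleC_scaleC)
      ultimately show ?thesis by (simp only: scaleC.diff_right scaleC_scaleR_left scaleR_diff_right)
    qed
    define \<sigma> where "\<sigma> = integral {0..} ?f"
    have "((\<lambda>\<tau>. ?f \<tau> *\<^sub>C y) has_integral \<sigma> *\<^sub>C y) {0..}"
      using has_integral_linear[OF integrable_integral[OF scalar_balakrishnan(1)[OF \<beta>0 \<beta>(2) s0]] scaleC.bounded_linear_left[of y]]
      by (simp add: o_def \<sigma>_def)
    moreover have "((\<lambda>\<tau>. \<tau> powr (-\<beta>) *\<^sub>R R_re \<tau> y) has_integral balakrishnan \<beta> y) {0..}"
      unfolding balakrishnan_def by (rule integrable_integral[OF balakrishnan_integrable[OF \<beta>0 \<beta>(2)]])
    ultimately have "((\<lambda>\<tau>. ?f \<tau> *\<^sub>C y - \<tau> powr (-\<beta>) *\<^sub>R R_re \<tau> y) has_integral \<sigma> *\<^sub>C y - balakrishnan \<beta> y) {0..}"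
      by (rule has_integral_diff)
    then have "(?e has_integral \<sigma> *\<^sub>C y - balakrishnan \<beta> y) {0..}"
      by (rule has_integral_eq[rotated]) (rule e_eq[symmetric])
    then have "integral {0..} ?e = \<sigma> *\<^sub>C y - balakrishnan \<beta> y" by (rule integral_unique)
    moreover have "norm (integral {0..} ?e) \<le> K * norm x"
      by (rule order_trans[OF e_bound]) (simp add: K_def algebra_simps)
    ultimately have "norm (\<sigma> *\<^sub>C y - balakrishnan \<beta> y) \<le> K * norm x" by (simp only:)
    then have "cmod \<sigma> * norm y \<le> norm (balakrishnan \<beta> y) + K * norm x"
      using norm_triangle_ineq2[of "\<sigma> *\<^sub>C y" "balakrishnan \<beta> y"] by simp
    moreover have "\<bar>s\<bar> powr (-\<beta>) / (2 * (1 - \<beta>)) * norm y \<le> cmod \<sigma> * norm y"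
      unfolding \<sigma>_def by (intro mult_right_mono scalar_balakrishnan(2) \<beta>0 \<beta> s0) auto
    moreover have "norm (balakrishnan \<beta> y) = 1 / c * norm (frac_part \<beta> y)"
      using False c by (simp add: frac_part_def c_def[symmetric])
    moreover have "1 / c * norm (frac_part \<beta> y) + K * norm x \<le> (1 / c + K) * (norm (frac_part \<beta> y) + norm x)"
      using c K by (simp add: algebra_simps)
    ultimately have "\<bar>s\<bar> powr (-\<beta>) / (2 * (1 - \<beta>)) * norm y \<le> (1 / c + K) * (norm (frac_part \<beta> y) + norm x)"
      by linarith
    then have "(\<bar>s\<bar> powr \<beta> * (2 * (1 - \<beta>))) * (\<bar>s\<bar> powr (-\<beta>) / (2 * (1 - \<beta>)) * norm y)
        \<le> (\<bar>s\<bar> powr \<beta> * (2 * (1 - \<beta>))) * ((1 / c + K) * (norm (frac_part \<beta> y) + norm x))"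
      using \<beta> by (intro mult_left_mono) auto
    moreover have "(\<bar>s\<bar> powr \<beta> * (2 * (1 - \<beta>))) * (\<bar>s\<bar> powr (-\<beta>) / (2 * (1 - \<beta>)) * norm y) = norm y"
      using \<beta> s by (simp add: powr_minus)
    moreover have "(\<bar>s\<bar> powr \<beta> * (2 * (1 - \<beta>))) * ((1 / c + K) * (norm (frac_part \<beta> y) + norm x))
        = C * \<bar>s\<bar> powr \<beta> * (norm (frac_part \<beta> y) + norm x)"
      by (simp only: C_def mult_ac)
    ultimately have "norm y \<le> C * \<bar>s\<bar> powr \<beta> * (norm (frac_part \<beta> y) + norm x)" by (simp only:)
    then show ?thesis by (simp add: y_def)
  qed
  moreover have "C > 0" using c K \<beta> by (simp add: C_def add_pos_nonneg)
  ultimately show ?thesis using that by blast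
qed

text \<open>Each of the \<open>n\<close> integer powers is peeled off by \<open>y = Gx - is Gy\<close>, which costs a factor \<open>\<bar>s\<bar>\<close>; the fractional factor is then \<open>norm_le_frac_part\<close>.\<close>

lemma norm_le_frac_power:
  assumes \<alpha>: "\<alpha> > 0"
  obtains L where "L > 0" "\<And>s x. \<bar>s\<bar> \<ge> 1 \<Longrightarrow> norm (R_im s x)
    \<le> L * \<bar>s\<bar> powr \<alpha> * (norm (frac_power \<alpha> (R_im s x)) + norm x)"
proof -
  define n where "n = nat \<lfloor>\<alpha>\<rfloor>"
  define \<beta> where "\<beta> = frac \<alpha>"
  have \<beta>: "0 \<le> \<beta>" "\<beta> < 1" by (auto simp: \<beta>_def frac_ge_0 frac_lt_1)
  have sum: "n + \<beta> = \<alpha>" using \<alpha> by (simp add: n_def \<beta>_def frac_def)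
  obtain g where g: "g > 0" "\<And>x. norm (G x) \<le> g * norm x" using G_bound by blast
  obtain C where C: "C > 0" "\<And>s x. \<bar>s\<bar> \<ge> 1 \<Longrightarrow> norm (R_im s x)
    \<le> C * \<bar>s\<bar> powr \<beta> * (norm (frac_part \<beta> (R_im s x)) + norm x)"
    using norm_le_frac_part[OF \<beta>] by blast
  have pow: "\<exists>K\<ge>0. \<forall>s x. \<bar>s\<bar> \<ge> 1 \<longrightarrow> norm (R_im s x)
      \<le> \<bar>s\<bar> ^ m * (norm ((G ^^ m) (R_im s x)) + K * norm x)" for m
  proof (induction m)
    case 0
    show ?case by (intro exI[of _ 0]) auto
  next
    case (Suc m)
    then obtain K where K: "K \<ge> 0" "\<And>s x. \<bar>s\<bar> \<ge> 1 \<Longrightarrow> norm (R_im s x)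
      \<le> \<bar>s\<bar> ^ m * (norm ((G ^^ m) (R_im s x)) + K * norm x)" by blast
    have "norm (R_im s x)
      \<le> \<bar>s\<bar> ^ Suc m * (norm ((G ^^ Suc m) (R_im s x)) + (g ^ Suc m + K) * norm x)" if s: "\<bar>s\<bar> \<ge> 1" for s x
    proof -
      let ?z = "\<i> * of_real s"
      let ?y = "(G ^^ m) (R ?z x)" and ?x = "(G ^^ m) x"
      have z: "Re ?z \<ge> 0" by simp
      have y: "?y = R ?z ?x" by (rule funpow_commute) (rule G_R_commute[OF z])
      have "?y = G ?x - ?z *\<^sub>C G ?y"
        using G_identity[OF z, of ?x] G_R_commute[OF z, of ?x] by (simp only: y) (metis add_diff_cancel_right')
      then have "norm ?y \<le> norm (G ?x) + norm (?z *\<^sub>C G ?y)" by (metis norm_triangle_ineq4)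
      also have "norm (?z *\<^sub>C G ?y) = \<bar>s\<bar> * norm (G ?y)" by (simp add: norm_mult)
      also have "norm (G ?x) \<le> g ^ Suc m * norm x" using norm_G_pow_le[of g "Suc m" x] g by simp
      also have "g ^ Suc m * norm x \<le> \<bar>s\<bar> * (g ^ Suc m * norm x)"
        using s g mult_right_mono[of 1 "\<bar>s\<bar>" "g ^ Suc m * norm x"] by simp
      finally have "norm ?y + K * norm x \<le> \<bar>s\<bar> * (g ^ Suc m * norm x) + \<bar>s\<bar> * norm (G ?y) + \<bar>s\<bar> * (K * norm x)"
        using mult_right_mono[OF s, of "K * norm x"] K by simp
      then have "\<bar>s\<bar> ^ m * (norm ?y + K * norm x)
          \<le> \<bar>s\<bar> ^ m * (\<bar>s\<bar> * (g ^ Suc m * norm x) + \<bar>s\<bar> * norm (G ?y) + \<bar>s\<bar> * (K * norm x))"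
        by (rule mult_left_mono) simp
      also have "\<dots> = \<bar>s\<bar> ^ Suc m * (norm ((G ^^ Suc m) (R ?z x)) + (g ^ Suc m + K) * norm x)"
        by (simp add: algebra_simps)
      finally show ?thesis using K(2)[OF s, of x] by linarith
    qed
    then show ?case using K g by (intro exI[of _ "g ^ Suc m + K"]) auto
  qed
  obtain K where K: "K \<ge> 0" "\<And>s x. \<bar>s\<bar> \<ge> 1 \<Longrightarrow> norm (R_im s x)
      \<le> \<bar>s\<bar> ^ n * (norm ((G ^^ n) (R_im s x)) + K * norm x)" using pow[of n] by blast
  have "norm (R_im s x)
      \<le> (C + C * g ^ n + K) * \<bar>s\<bar> powr \<alpha> * (norm (frac_power \<alpha> (R_im s x)) + norm x)" if s: "\<bar>s\<bar> \<ge> 1" for s x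
  proof -
    let ?z = "\<i> * of_real s"
    have z: "Re ?z \<ge> 0" by simp
    have "(G ^^ n) (R ?z x) = R ?z ((G ^^ n) x)" by (rule funpow_commute) (rule G_R_commute[OF z])
    then have "norm ((G ^^ n) (R ?z x)) \<le> C * \<bar>s\<bar> powr \<beta> * (norm (frac_part \<beta> ((G ^^ n) (R ?z x))) + norm ((G ^^ n) x))"
      using C(2)[OF s, of "(G ^^ n) x"] by (simp only:)
    also have "frac_part \<beta> ((G ^^ n) (R ?z x)) = (G ^^ n) (frac_part \<beta> (R ?z x))"
      by (rule frac_part_commute[symmetric, OF \<beta> bounded_linear_funpow[OF G_bounded_linear]], rule funpow_commute, rule G_R_commute) simp
    also have "\<dots> = frac_power \<alpha> (R ?z x)" by (simp add: frac_power_eq n_def \<beta>_def)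
    finally have 1: "norm ((G ^^ n) (R ?z x)) \<le> C * \<bar>s\<bar> powr \<beta> * (norm (frac_power \<alpha> (R ?z x)) + norm ((G ^^ n) x))" .
    let ?F = "norm (frac_power \<alpha> (R ?z x))"
    have sb: "1 \<le> \<bar>s\<bar> powr \<beta>" using s \<beta> by (intro ge_one_powr_ge_zero) auto
    have "norm ((G ^^ n) x) \<le> g ^ n * norm x" using norm_G_pow_le g by auto
    then have "C * \<bar>s\<bar> powr \<beta> * (?F + norm ((G ^^ n) x)) \<le> C * \<bar>s\<bar> powr \<beta> * (?F + g ^ n * norm x)"
      using C by (intro mult_left_mono add_left_mono) auto
    with 1 have "norm ((G ^^ n) (R ?z x)) + K * norm x \<le> C * \<bar>s\<bar> powr \<beta> * (?F + g ^ n * norm x) + \<bar>s\<bar> powr \<beta> * (K * norm x)"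
      using mult_right_mono[OF sb, of "K * norm x"] K by simp
    also have "\<dots> = \<bar>s\<bar> powr \<beta> * (C * ?F + (C * g ^ n + K) * norm x)" by (simp add: algebra_simps)
    also have "\<dots> \<le> \<bar>s\<bar> powr \<beta> * ((C + C * g ^ n + K) * (?F + norm x))"
      using C K g by (intro mult_left_mono) (auto simp: algebra_simps)
    finally have "\<bar>s\<bar> ^ n * (norm ((G ^^ n) (R ?z x)) + K * norm x) \<le> \<bar>s\<bar> ^ n * (\<bar>s\<bar> powr \<beta> * ((C + C * g ^ n + K) * (?F + norm x)))"
      by (rule mult_left_mono) simp
    also have "\<dots> = (C + C * g ^ n + K) * (\<bar>s\<bar> ^ n * \<bar>s\<bar> powr \<beta>) * (?F + norm x)" by (simp only: mult_ac)
    also have "\<bar>s\<bar> ^ n * \<bar>s\<bar> powr \<beta> = \<bar>s\<bar> powr \<alpha>"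
      using s by (simp add: sum[symmetric] powr_add powr_realpow)
    finally show ?thesis using K(2)[OF s, of x] by linarith
  qed
  moreover have "C + C * g ^ n + K > 0" using C K g by (simp add: add_pos_nonneg)
  ultimately show ?thesis using that by blast
qed

text \<open>The comparison \<open>norm_le_frac_power\<close> is applied to \<open>T(t)y = R(is)T(t)x\<close>, where the decay of the fractional power makes the
first term small relative to \<open>\<parallel>y\<parallel>\<close>. Since \<open>e\<^sup>-\<^sup>i\<^sup>s\<^sup>t T(t)y\<close> is within \<open>M t \<parallel>x\<parallel>\<close> of \<open>y\<close>, the norm of
\<open>y\<close> can be absorbed.\<close>

theorem resolvent_growth_of_frac_power_decay:
  assumes \<alpha>: "\<alpha> > 0" and "decays_like (frac_power \<alpha>) 1"
  shows "resolvent_growth \<alpha>"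
proof -
  obtain C t0 where C: "C > 0" and t0: "t0 \<ge> 1"
    and decay: "\<And>t x. t \<ge> t0 \<Longrightarrow> norm (T t (frac_power \<alpha> x)) \<le> C * t powr (- 1) * norm x"
    using decays_likeE[OF assms(2)] by blast
  obtain L where L: "L > 0" "\<And>s x. \<bar>s\<bar> \<ge> 1 \<Longrightarrow> norm (R_im s x)
    \<le> L * \<bar>s\<bar> powr \<alpha> * (norm (frac_power \<alpha> (R_im s x)) + norm x)"
    using norm_le_frac_power[OF \<alpha>] by blast
  define K where "K = 2 * L * (C + 1)"
  have K: "K > 0" using L C by (simp add: K_def)
  define S where "S = max 1 ((t0 / K) powr (1 / \<alpha>))"
  have "norm (R_im s x) \<le> (2 * (L * M + M * K)) * \<bar>s\<bar> powr \<alpha> * norm x" if s: "\<bar>s\<bar> \<ge> S" for s x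
  proof -
    let ?z = "\<i> * of_real s"
    let ?y = "R ?z x"
    have z: "Re ?z \<ge> 0" by simp
    have s1: "\<bar>s\<bar> \<ge> 1" using s by (simp add: S_def)
    \<comment> \<open>this multiple of \<open>\<bar>s\<bar>\<^sup>\<alpha>\<close> makes the coefficient of \<open>\<parallel>y\<parallel>\<close> below at most \<open>1/2\<close>\<close>
    define t where "t = K * \<bar>s\<bar> powr \<alpha>"
    have t: "t > 0" using K s1 by (simp add: t_def)
    have "t0 / K = ((t0 / K) powr (1 / \<alpha>)) powr \<alpha>" using \<alpha> K t0 by (simp add: powr_powr)
    also have "\<dots> \<le> \<bar>s\<bar> powr \<alpha>" using s \<alpha> by (intro powr_mono2) (auto simp: S_def)
    finally have "t0 \<le> t" using K by (simp add: t_def field_simps)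
    have "T t ?y = R ?z (T t x)" using t by (simp add: R_T_commute)
    then have "norm (T t ?y) \<le> L * \<bar>s\<bar> powr \<alpha> * (norm (frac_power \<alpha> (T t ?y)) + norm (T t x))"
      using L(2)[OF s1, of "T t x"] by (simp only:)
    also have "\<dots> \<le> L * \<bar>s\<bar> powr \<alpha> * (C / t * norm ?y + M * norm x)"
    proof (intro mult_left_mono add_mono)
      have "norm (frac_power \<alpha> (T t ?y)) \<le> C * t powr (- 1) * norm ?y"
        using decay[OF \<open>t0 \<le> t\<close>] t by (simp add: frac_power_T)
      then show "norm (frac_power \<alpha> (T t ?y)) \<le> C / t * norm ?y" using t by (simp add: powr_minus_divide)
      show "norm (T t x) \<le> M * norm x" using t by (intro norm_T_le) simp
    qed (use L C t in auto)
    also have "\<dots> = (L * \<bar>s\<bar> powr \<alpha> * C / t) * norm ?y + L * M * \<bar>s\<bar> powr \<alpha> * norm x"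
      by (simp add: algebra_simps)
    also have "L * \<bar>s\<bar> powr \<alpha> * C / t \<le> 1 / 2"
    proof -
      have "t / 2 = L * \<bar>s\<bar> powr \<alpha> * C + L * \<bar>s\<bar> powr \<alpha>" by (simp add: t_def K_def algebra_simps)
      then have "L * \<bar>s\<bar> powr \<alpha> * C \<le> 1 / 2 * t" using L by simp
      then show ?thesis using t by (simp only: pos_divide_le_eq)
    qed
    finally have "norm (T t ?y) \<le> 1 / 2 * norm ?y + L * M * \<bar>s\<bar> powr \<alpha> * norm x" by (simp add: mult_right_mono)
    moreover have "norm ?y \<le> norm (T t ?y) + M * t * norm x"
    proof -
      have "norm (cis (- s * t) *\<^sub>C T t ?y - ?y) \<le> M * t * norm x"
        using norm_rotated_T_diff_le[OF R_in_domain[OF z], of t s x] t by (simp add: R_right_inverse[OF z])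
      then show ?thesis using norm_triangle_ineq3[of "cis (- s * t) *\<^sub>C T t ?y" ?y] by simp
    qed
    moreover have "a \<le> 2 * (c + d)" if "b \<le> 1 / 2 * a + c" "a \<le> b + d" for a b c d :: real
      using that by argo
    ultimately have "norm ?y \<le> 2 * (L * M * \<bar>s\<bar> powr \<alpha> * norm x + M * t * norm x)" by blast
    then show ?thesis by (simp add: t_def algebra_simps)
  qed
  then show ?thesis unfolding resolvent_growth_def by blast
qed

end

section \<open>Density of the domain\<close>

lemma tendsto_average_at_right:
  fixes f :: "real \<Rightarrow> 'a::banach"
  assumes cont: "continuous_on {0..} f" and a: "a \<ge> 0"
  shows "((\<lambda>h. integral {a..a + h} f /\<^sub>R h) \<longlongrightarrow> f a) (at_right 0)"
proof (rule tendstoI)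
  fix e :: real assume e: "e > 0"
  have "(f \<longlongrightarrow> f a) (at a within {0..})" using cont a by (auto simp: continuous_on_def)
  then obtain d where d: "d > 0" "\<And>x. x \<ge> 0 \<Longrightarrow> dist x a < d \<Longrightarrow> dist (f x) (f a) < e / 2"
    using continuous_on_iff[THEN iffD1, OF cont] a e by (metis atLeast_iff half_gt_zero)
  have "dist (integral {a..a + h} f /\<^sub>R h) (f a) < e" if h: "0 < h" "h < d" for h
  proof -
    have int: "f integrable_on {a..a + h}"
      using a by (intro integrable_continuous_interval continuous_on_subset[OF cont]) auto
    have "((\<lambda>x. f x - f a) has_integral integral {a..a + h} f - h *\<^sub>R f a) {a..a + h}"
      using has_integral_diff[OF integrable_integral[OF int] has_integral_const_real[of "f a" a "a + h"]] h by simp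
    moreover have "norm (f x - f a) \<le> e / 2" if "x \<in> {a..a + h} - {}" for x
      using d(2)[of x] that h a by (auto simp: dist_norm)
    ultimately have "norm (integral {a..a + h} f - h *\<^sub>R f a) \<le> e / 2 * measure lborel {a..a + h}"
      using e by (intro has_integral_bound_real[where S = "{}"]) auto
    then have "norm (integral {a..a + h} f - h *\<^sub>R f a) \<le> h * (e / 2)" using h by (simp add: mult.commute)
    moreover have "integral {a..a + h} f - h *\<^sub>R f a = h *\<^sub>R (integral {a..a + h} f /\<^sub>R h - f a)"
      using h by (simp add: scaleR_diff_right)
    ultimately have "h * norm (integral {a..a + h} f /\<^sub>R h - f a) \<le> h * (e / 2)"
      using h by simp
    then have "norm (integral {a..a + h} f /\<^sub>R h - f a) \<le> e / 2" by (rule mult_left_le_imp_le) (rule h)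
    then show ?thesis using e by (simp add: dist_norm)
  qed
  then show "\<forall>\<^sub>F h in at_right 0. dist (integral {a..a + h} f /\<^sub>R h) (f a) < e"
    using d(1) by (auto simp: eventually_at_right[of 0 1])
qed

context bounded_semigroup_generator
begin

lemma orbit_continuous: "continuous_on {0..} (\<lambda>t. T t x)"
proof -
  have near: "\<exists>d>0. \<forall>h. 0 \<le> h \<and> h < d \<longrightarrow> norm (T h x - x) < e" if "e > 0" for e
  proof -
    have "\<forall>\<^sub>F h in at_right 0. dist (T h x) x < e" using tendstoD[OF T_at_0 that] .
    then obtain d where "d > 0" "\<And>h. 0 < h \<Longrightarrow> h < d \<Longrightarrow> dist (T h x) x < e"
      by (auto simp: eventually_at_right[of 0 1])
    then show ?thesis using that by (intro exI[of _ d]) (auto simp: dist_norm le_less)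
  qed
  have diff: "norm (T s x - T t x) \<le> M * norm (T \<bar>s - t\<bar> x - x)" if "0 \<le> s" "0 \<le> t" for s t
    using that
  proof (induction s t rule: linorder_wlog)
    case (le s t)
    have eq: "T t x - T s x = T s (T (t - s) x - x)"
      using le T_add[of s "t - s" x] by (simp add: T_linear_simps)
    have abs: "\<bar>s - t\<bar> = t - s" using le by simp
    show ?case unfolding abs norm_minus_commute[of "T s x"] eq by (rule norm_T_le) fact
  qed (simp add: norm_minus_commute abs_minus_commute)
  show ?thesis
    unfolding continuous_on_iff
  proof (intro ballI allI impI)
    fix t e :: real assume t: "t \<in> {0..}" and e: "e > 0"
    obtain d where d: "d > 0" "\<And>h. 0 \<le> h \<Longrightarrow> h < d \<Longrightarrow> norm (T h x - x) < e / M"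
      using near[of "e / M"] e M_pos by auto
    have "dist (T s x) (T t x) < e" if s: "s \<in> {0..}" "dist s t < d" for s
    proof -
      have "norm (T s x - T t x) \<le> M * norm (T \<bar>s - t\<bar> x - x)" using s t by (intro diff) auto
      also have "\<dots> < M * (e / M)" using M_pos s by (intro mult_strict_left_mono d(2)) (auto simp: dist_real_def)
      finally show ?thesis using M_pos by (simp add: dist_norm)
    qed
    then show "\<exists>d>0. \<forall>x'\<in>{0..}. dist x' t < d \<longrightarrow> dist (T x' x) (T t x) < e" using d(1) by blast
  qed
qed

text \<open>The difference quotient of the integral is a difference of averages of the orbit near \<open>h\<close> and near \<open>0\<close>.\<close>

lemma integral_orbit_in_domain:
  assumes h: "h > 0" shows "integral {0..h} (\<lambda>t. T t x) \<in> D"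
proof -
  let ?F = "\<lambda>t. T t x"
  have int: "?F integrable_on {a..b}" if "0 \<le> a" for a b
    using that by (intro integrable_continuous_interval continuous_on_subset[OF orbit_continuous]) auto
  have eq: "integral {h..h + \<epsilon>} ?F /\<^sub>R \<epsilon> - integral {0..0 + \<epsilon>} ?F /\<^sub>R \<epsilon>
      = (T \<epsilon> (integral {0..h} ?F) - integral {0..h} ?F) /\<^sub>R \<epsilon>" if \<epsilon>: "\<epsilon> > 0" for \<epsilon>
  proof -
    have "T \<epsilon> (integral {0..h} ?F) = integral {0..h} (T \<epsilon> \<circ> ?F)"
      using \<epsilon> by (intro integral_linear[symmetric] int T_bounded_linear) auto
    also have "\<dots> = integral {0..h} (?F \<circ> (+) \<epsilon>)"
      using \<epsilon> by (intro Henstock_Kurzweil_Integration.integral_cong) (simp add: T_add)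
    also have "\<dots> = integral {\<epsilon>..h + \<epsilon>} ?F"
      unfolding integral_shift_Icc_real by simp
    finally have 1: "T \<epsilon> (integral {0..h} ?F) = integral {\<epsilon>..h + \<epsilon>} ?F" .
    have "integral {0..h} ?F + integral {h..h + \<epsilon>} ?F = integral {0..h + \<epsilon>} ?F"
      using h \<epsilon> by (intro Henstock_Kurzweil_Integration.integral_combine int) auto
    moreover have "integral {0..\<epsilon>} ?F + integral {\<epsilon>..h + \<epsilon>} ?F = integral {0..h + \<epsilon>} ?F"
      using h \<epsilon> by (intro Henstock_Kurzweil_Integration.integral_combine int) auto
    moreover have "q - p = r - i" if "i + q = u" "p + r = u" for i p q r u :: 'a
    proof -
      have "q = u - i" using that(1)[symmetric] by simp
      moreover have "r = u - p" using that(2)[symmetric] by simp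
      ultimately show ?thesis by (simp add: algebra_simps)
    qed
    ultimately have "integral {h..h + \<epsilon>} ?F - integral {0..\<epsilon>} ?F = integral {\<epsilon>..h + \<epsilon>} ?F - integral {0..h} ?F"
      by blast
    then show ?thesis by (simp add: 1 flip: scaleR_diff_right)
  qed
  have "((\<lambda>\<epsilon>. integral {h..h + \<epsilon>} ?F /\<^sub>R \<epsilon> - integral {0..0 + \<epsilon>} ?F /\<^sub>R \<epsilon>) \<longlongrightarrow> T h x - T 0 x) (at_right 0)"
    using h by (intro tendsto_diff tendsto_average_at_right orbit_continuous) auto
  then show ?thesis by (rule generator_quotientI(1)[OF _ eq])
qed

lemma G_minus_A: "x \<in> D \<Longrightarrow> G (- A x) = x"
  unfolding G_def by (rule R_eqI) (simp_all add: scaleC.zero_left)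

text \<open>The averages of the orbit over \<open>{0..h}\<close> are in the domain, which is the range of \<open>G\<close>, and converge to \<open>x\<close>.\<close>

lemma range_G_dense:
  assumes e: "e > 0" shows "\<exists>z. norm (x - G z) < e"
proof -
  have "((\<lambda>h. integral {0..0 + h} (\<lambda>t. T t x) /\<^sub>R h) \<longlongrightarrow> T 0 x) (at_right 0)"
    by (rule tendsto_average_at_right[OF orbit_continuous]) simp
  then have "\<forall>\<^sub>F h in at_right 0. dist (integral {0..h} (\<lambda>t. T t x) /\<^sub>R h) x < e"
    using tendstoD[OF _ e] by fastforce
  then obtain h where h: "h > 0" "dist (integral {0..h} (\<lambda>t. T t x) /\<^sub>R h) x < e"
    using eventually_happens'[OF trivial_limit_at_right_real eventually_conj[OF eventually_at_right_less[of "0::real"]]]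
    by blast
  define y where "y = integral {0..h} (\<lambda>t. T t x) /\<^sub>R h"
  have "y \<in> D"
    unfolding y_def scaleC_of_real[symmetric] by (intro generator_scaleC integral_orbit_in_domain h)
  then have "G (- A y) = y" by (rule G_minus_A)
  then show ?thesis using h by (intro exI[of _ "- A y"]) (simp add: y_def dist_norm norm_minus_commute)
qed


section \<open>Uniform and pointwise rates\<close>

lemma decays_like_iff_onorm:
  assumes B: "bounded_linear B"
  shows "decays_like B \<gamma> \<longleftrightarrow> (\<lambda>t. onorm (T t \<circ> B)) \<in> O[at_top](\<lambda>t. t powr (- \<gamma>))"
proof -
  have "\<forall>\<^sub>F t in at_top. bounded_linear (T t \<circ> B)"
    using eventually_ge_at_top[of 0]
    by eventually_elim (simp add: o_def bounded_linear_compose[OF T_bounded_linear B])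
  from onorm_bigo_iff[OF this] show ?thesis
    by (auto simp: decays_like_def eventually_at_top_linorder)
qed

lemma resolvent_growth_iff_onorm:
  "resolvent_growth \<alpha> \<longleftrightarrow>
    (\<lambda>s::real. onorm (R_im s)) \<in> O[at_infinity](\<lambda>s. \<bar>s\<bar> powr \<alpha>)"
proof -
  have "\<forall>\<^sub>F s in at_infinity. bounded_linear (R_im s)"
    by (intro always_eventually allI R_bounded_linear) simp
  from onorm_bigo_iff[OF this] show ?thesis
    by (auto simp: resolvent_growth_def eventually_at_infinity)
qed

text \<open>Uniform boundedness of the operators \<open>t\<^sup>\<gamma> T(t) B\<close>; for \<open>t\<close> in a bounded interval they are bounded because the semigroup is.\<close>

lemma pointwise_decay_imp_decays_like:
  assumes B: "bounded_linear B"
    and pt: "\<And>x. (\<lambda>t. norm (T t (B x))) \<in> o[at_top](\<lambda>t. t powr (- \<gamma>))"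
  shows "decays_like B \<gamma>"
proof -
  define f where "f t x = t powr \<gamma> *\<^sub>R T t (B x)" for t x
  have lin: "bounded_linear (f t)" if "t \<in> {1..}" for t
    unfolding f_def using that
    by (intro bounded_linear_const_scaleR bounded_linear_compose[OF T_bounded_linear B]) simp
  have bound: "\<exists>b. \<forall>t\<in>{1..}. norm (f t x) \<le> b" for x
  proof -
    have "\<forall>\<^sub>F t in at_top. norm (norm (T t (B x))) \<le> 1 * norm (t powr (- \<gamma>))"
      by (rule landau_o.smallD[OF pt]) simp
    then obtain t1 where t1: "\<And>t. t \<ge> t1 \<Longrightarrow> norm (T t (B x)) \<le> t powr (- \<gamma>)"
      unfolding eventually_at_top_linorder by auto
    have "norm (f t x) \<le> max 1 ((max 1 t1) powr \<bar>\<gamma>\<bar> * (M * norm (B x)))" if t: "t \<in> {1..}" for t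
    proof (cases "t \<ge> t1")
      case True
      have "norm (f t x) \<le> t powr \<gamma> * t powr (- \<gamma>)" unfolding f_def using t1[OF True] by (simp add: mult_left_mono)
      also have "\<dots> = 1" using t by (simp add: powr_minus)
      finally show ?thesis by simp
    next
      case False
      have "t powr \<gamma> \<le> t powr \<bar>\<gamma>\<bar>" using t by (intro powr_mono) auto
      also have "\<dots> \<le> (max 1 t1) powr \<bar>\<gamma>\<bar>" using t False by (intro powr_mono2) auto
      finally have "t powr \<gamma> * norm (T t (B x)) \<le> (max 1 t1) powr \<bar>\<gamma>\<bar> * (M * norm (B x))"
        using t M_pos by (intro mult_mono norm_T_le) auto
      then show ?thesis by (simp add: f_def)
    qed
    then show ?thesis by blast
  qed
  obtain C where C: "C > 0" "\<And>t x. t \<in> {1..} \<Longrightarrow> norm (f t x) \<le> C * norm x"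
    using banach_steinhaus[of "{1..}" f, OF lin bound] by blast
  have "norm (T t (B x)) \<le> C * t powr (- \<gamma>) * norm x" if t: "t \<ge> 1" for t x
  proof -
    have "t powr (- \<gamma>) * norm (f t x) \<le> t powr (- \<gamma>) * (C * norm x)" using t by (intro mult_left_mono C) auto
    moreover have "t powr (- \<gamma>) * norm (f t x) = norm (T t (B x))" using t by (simp add: f_def powr_minus)
    ultimately show ?thesis by (simp add: mult_ac)
  qed
  then show ?thesis unfolding decays_like_def by blast
qed

text \<open>On a vector \<open>G z\<close> one writes \<open>T(t) = T(t/2) T(t/2)\<close> and spends one factor on \<open>B\<close> and the other on \<open>G\<close>, which gives an
additional factor tending to \<open>0\<close>. The general case follows by density.\<close>

lemma decays_like_imp_pointwise_decay:
  assumes B: "bounded_linear B" and comm: "\<And>t x. t \<ge> 0 \<Longrightarrow> B (T t x) = T t (B x)"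
    and dec: "decays_like B \<gamma>"
    and decG: "decays_like G \<delta>" and \<delta>: "\<delta> > 0"
  shows "(\<lambda>t. norm (T t (B x))) \<in> o[at_top](\<lambda>t. t powr (- \<gamma>))"
proof (rule landau_o.smallI)
  fix c :: real assume c: "c > 0"
  obtain C t0 where C: "\<And>t x. t \<ge> t0 \<Longrightarrow> norm (T t (B x)) \<le> C * t powr (- \<gamma>) * norm x"
    using dec unfolding decays_like_def by blast
  obtain K t1 where K: "\<And>t x. t \<ge> t1 \<Longrightarrow> norm (T t (G x)) \<le> K * t powr (- \<delta>) * norm x"
    using decG unfolding decays_like_def by blast
  define C' where "C' = max C 1"
  have C': "C' > 0" "C \<le> C'" by (auto simp: C'_def)
  obtain z where z: "norm (x - G z) < c / 2 / C'" using range_G_dense[of "c / 2 / C'" x] c C' by auto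
  define q where "q t = C' * 2 powr \<gamma> * (K * (t / 2) powr (- \<delta>) * norm z)" for t
  have "((\<lambda>t::real. (t / 2) powr (- \<delta>)) \<longlongrightarrow> 0) at_top" using \<delta> by real_asymp
  then have "(q \<longlongrightarrow> C' * 2 powr \<gamma> * (K * 0 * norm z)) at_top" unfolding q_def by (intro tendsto_intros)
  then have q: "\<forall>\<^sub>F t in at_top. q t < c / 2" using c by (intro order_tendstoD(2)) auto
  show "\<forall>\<^sub>F t in at_top. norm (norm (T t (B x))) \<le> c * norm (t powr (- \<gamma>))"
    using q eventually_ge_at_top[of "max 1 (2 * max t0 t1)"]
  proof eventually_elim
    case (elim t)
    then have t: "t > 0" "t \<ge> 1" "t / 2 \<ge> t0" "t / 2 \<ge> t1" by auto
    have "t \<ge> t0" using t by (cases "t0 \<ge> 0") auto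
    have up: "norm (T s (B y)) \<le> C' * s powr (- \<gamma>) * norm y" if "s \<ge> t0" for s y
      using C[OF that, of y] mult_right_mono[OF C'(2), of "s powr (- \<gamma>) * norm y"] by (simp add: mult.assoc)
    have "T t (B (G z)) = T (t / 2) (B (T (t / 2) (G z)))"
      using T_add[of "t / 2" "t / 2" "B (G z)"] t comm[of "t / 2" "G z"] by simp
    then have "norm (T t (B (G z))) \<le> C' * (t / 2) powr (- \<gamma>) * norm (T (t / 2) (G z))" using up t by simp
    also have "\<dots> \<le> C' * (t / 2) powr (- \<gamma>) * (K * (t / 2) powr (- \<delta>) * norm z)"
      using C' by (intro mult_left_mono K t) auto
    also have "\<dots> = q t * t powr (- \<gamma>)" using t by (simp add: q_def powr_divide powr_minus field_simps)
    also have "\<dots> \<le> c / 2 * t powr (- \<gamma>)" using elim by (intro mult_right_mono) auto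
    finally have 1: "norm (T t (B (G z))) \<le> c / 2 * t powr (- \<gamma>)" .
    have "norm (T t (B (x - G z))) \<le> C' * t powr (- \<gamma>) * norm (x - G z)" by (rule up) fact
    also have "\<dots> \<le> C' * t powr (- \<gamma>) * (c / 2 / C')" using z C' by (intro mult_left_mono) auto
    also have "\<dots> = c / 2 * t powr (- \<gamma>)" using C' by simp
    finally have 2: "norm (T t (B (x - G z))) \<le> c / 2 * t powr (- \<gamma>)" .
    have "T t (B x) = T t (B (x - G z)) + T t (B (G z))"
      using t by (simp add: linear_simps[OF B] T_linear_simps)
    then have "norm (T t (B x)) \<le> norm (T t (B (x - G z))) + norm (T t (B (G z)))" by (metis norm_triangle_ineq)
    then show ?case using 1 2 by simp
  qed
qed

lemma inv_generator_eq: "inv_into D A x = - G x"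
proof -
  have inj: "inj_on A D"
  proof (rule inj_onI)
    fix x y assume xy: "x \<in> D" "y \<in> D" "A x = A y"
    have "x = G (- A x)" by (rule G_minus_A[OF xy(1), symmetric])
    also have "\<dots> = G (- A y)" by (simp only: xy(3))
    also have "\<dots> = y" by (rule G_minus_A[OF xy(2)])
    finally show "x = y" .
  qed
  have inD: "- G x \<in> D" using generator_scaleC(1)[OF G_in_domain, of "- 1" x] by (simp add: scaleC.minus_left)
  have "A (- G x) = x"
    using generator_scaleC(2)[OF G_in_domain, of "- 1" x] by (simp add: scaleC.minus_left A_G)
  then show ?thesis using inv_into_f_f[OF inj inD] by simp
qed

lemma inv_generator_bounded_linear: "bounded_linear (inv_into D A)"
  unfolding inv_generator_eq[abs_def] by (rule bounded_linear_minus[OF G_bounded_linear])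

lemma inv_generator_T: "t \<ge> 0 \<Longrightarrow> inv_into D A (T t x) = T t (inv_into D A x)"
  by (simp add: inv_generator_eq G_T_commute T_linear_simps)

lemma decays_like_mono:
  assumes "decays_like B \<gamma>" and le: "\<And>t x. t \<ge> 0 \<Longrightarrow> norm (T t (B' x)) \<le> norm (T t (B x))"
  shows "decays_like B' \<gamma>"
proof -
  obtain C t0 where C: "C > 0" "t0 \<ge> 1" "\<And>t x. t \<ge> t0 \<Longrightarrow> norm (T t (B x)) \<le> C * t powr (- \<gamma>) * norm x"
    by (rule decays_likeE[OF assms(1)]) (rule that)
  have "norm (T t (B' x)) \<le> C * t powr (- \<gamma>) * norm x" if "t \<ge> t0" for t x
    using that C(2) by (intro order_trans[OF le C(3)]) auto
  then show ?thesis unfolding decays_like_def by blast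
qed

lemma decays_like_inv_generator_iff: "decays_like (inv_into D A) \<gamma> \<longleftrightarrow> decays_like G \<gamma>"
proof -
  have eq: "norm (T t (inv_into D A x)) = norm (T t (G x))" if "t \<ge> 0" for t x
    using that by (simp add: inv_generator_eq T_linear_simps)
  show ?thesis by (intro iffI; erule decays_like_mono; simp add: eq)
qed

end

theorem theorem2p4:
  fixes T :: "real \<Rightarrow> 'a::complex_hilbert_space \<Rightarrow> 'a"
    and D :: "'a set" and A :: "'a \<Rightarrow> 'a" and \<alpha> :: real
  assumes "C0_semigroup T"
    and "bounded_semigroup T"
    and "is_generator D A T"
    and "\<forall>s::real. \<i> * complex_of_real s \<in> resolvent_set D A"
    and "\<alpha> > 0"
  shows
   "let i = (\<lambda>s::real. onorm (resolvent D A (\<i> * complex_of_real s)))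
              \<in> O[at_infinity](\<lambda>s. \<bar>s\<bar> powr \<alpha>);
        ii = (\<lambda>t. onorm (T t \<circ> neg_frac_power D (\<lambda>x. - A x) \<alpha>)) \<in> O[at_top](\<lambda>t. 1 / t);
        iii = (\<forall>x. (\<lambda>t. norm (T t (neg_frac_power D (\<lambda>x. - A x) \<alpha> x))) \<in> o[at_top](\<lambda>t. 1 / t));
        iv = (\<lambda>t. onorm (T t \<circ> inv_into D A)) \<in> O[at_top](\<lambda>t. t powr (- (1 / \<alpha>)));
        v = (\<forall>x. (\<lambda>t. norm (T t (inv_into D A x))) \<in> o[at_top](\<lambda>t. t powr (- (1 / \<alpha>))))
    in (i \<longleftrightarrow> ii) \<and> (i \<longleftrightarrow> iii) \<and> (i \<longleftrightarrow> iv) \<and> (i \<longleftrightarrow> v)"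
proof -
  interpret bounded_semigroup_generator T D A
    using assms by unfold_locales auto
  note \<alpha> = \<open>\<alpha> > 0\<close>
  have \<delta>: "1 / \<alpha> > 0" using \<alpha> by simp
  have rate: "eventually (\<lambda>t::real. 1 / t = t powr (- 1)) at_top"
    using eventually_gt_at_top[of "0::real"] by eventually_elim (simp add: powr_minus_divide)
  have i: "(\<lambda>s::real. onorm (R_im s)) \<in> O[at_infinity](\<lambda>s. \<bar>s\<bar> powr \<alpha>)
      \<longleftrightarrow> resolvent_growth \<alpha>"
    by (rule resolvent_growth_iff_onorm[symmetric])
  have ii: "(\<lambda>t. onorm (T t \<circ> frac_power \<alpha>)) \<in> O[at_top](\<lambda>t. 1 / t) \<longleftrightarrow> decays_like (frac_power \<alpha>) 1"
    unfolding decays_like_iff_onorm[OF frac_power_bounded_linear] landau_o.big.cong[OF rate] ..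
  have iv: "(\<lambda>t. onorm (T t \<circ> inv_into D A)) \<in> O[at_top](\<lambda>t. t powr (- (1 / \<alpha>))) \<longleftrightarrow> decays_like G (1 / \<alpha>)"
    using decays_like_iff_onorm[OF inv_generator_bounded_linear] decays_like_inv_generator_iff by blast
  note i_iv = domain_decay_of_resolvent_growth[OF \<alpha>]
    and iv_ii = frac_power_decay_of_domain_decay[OF \<alpha>]
    and ii_i = resolvent_growth_of_frac_power_decay[OF \<alpha>]
  have iii: "(\<forall>x. (\<lambda>t. norm (T t (frac_power \<alpha> x))) \<in> o[at_top](\<lambda>t. 1 / t)) \<longleftrightarrow> resolvent_growth \<alpha>"
  proof -
    have "(\<lambda>t. norm (T t (frac_power \<alpha> x))) \<in> o[at_top](\<lambda>t. 1 / t)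
        \<longleftrightarrow> (\<lambda>t. norm (T t (frac_power \<alpha> x))) \<in> o[at_top](\<lambda>t. t powr (- 1))" for x
      unfolding landau_o.small.cong[OF rate] ..
    moreover have "resolvent_growth \<alpha>" if "\<And>x. (\<lambda>t. norm (T t (frac_power \<alpha> x))) \<in> o[at_top](\<lambda>t. t powr (- 1))"
      using that by (intro ii_i pointwise_decay_imp_decays_like frac_power_bounded_linear)
    moreover have "(\<lambda>t. norm (T t (frac_power \<alpha> x))) \<in> o[at_top](\<lambda>t. t powr (- 1))" if "resolvent_growth \<alpha>" for x
      using that by (intro decays_like_imp_pointwise_decay[OF _ _ _ _ \<delta>] frac_power_bounded_linear frac_power_T iv_ii i_iv)
    ultimately show ?thesis by blast
  qed
  have v: "(\<forall>x. (\<lambda>t. norm (T t (inv_into D A x))) \<in> o[at_top](\<lambda>t. t powr (- (1 / \<alpha>)))) \<longleftrightarrow> resolvent_growth \<alpha>"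
  proof -
    have "resolvent_growth \<alpha>" if "\<And>x. (\<lambda>t. norm (T t (inv_into D A x))) \<in> o[at_top](\<lambda>t. t powr (- (1 / \<alpha>)))"
      using pointwise_decay_imp_decays_like[OF inv_generator_bounded_linear that] decays_like_inv_generator_iff
      by (blast intro: ii_i iv_ii)
    moreover have "(\<lambda>t. norm (T t (inv_into D A x))) \<in> o[at_top](\<lambda>t. t powr (- (1 / \<alpha>)))" if "resolvent_growth \<alpha>" for x
      using i_iv[OF that] decays_like_inv_generator_iff
      by (intro decays_like_imp_pointwise_decay[OF _ _ _ _ \<delta>] inv_generator_bounded_linear inv_generator_T) auto
    ultimately show ?thesis by blast
  qed
  show ?thesis
    unfolding Let_def i ii iii iv v using i_iv iv_ii ii_i by blast
qed

end
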